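(* Let $(A,\circ,[\cdot,\cdot])$ be a Gel'fand-Dorfman algebra and let $R=\mathbf{k}[\partial]A$ be the Lie conformal algebra corresponding to it. Suppose that $\delta_0,\Delta: R\to R\otimes R$ are $\mathbf{k}[\partial]$-module homomorphisms such that $\delta_0(A)\subset A\otimes A$ and $\Delta(A)\subset A\otimes A$. Let $\delta:R\to R\otimes R$ be the $\mathbf{k}[\partial]$-module homomorphism determined by $$\delta(a)=\delta_0(a)+(\partial\otimes \mathrm{id})\Delta(a)-\tau(\partial\otimes \mathrm{id})\Delta(a),\qquad a\in A.$$ Then $(R,[\cdot_\lambda\cdot],\delta)$ is a Lie conformal bialgebra if and only if $(A,\circ,[\cdot,\cdot],\Delta,\delta_0)$ (with $\Delta,\delta_0$ restricted to $A$) is a Gel'fand-Dorfman bialgebra.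
   Context: Conventions: $\mathbf{k}$ is a field of characteristic $0$; vector spaces over $\mathbf{k}$ are finite-dimensional and $\mathbf{k}[\partial]$-modules are finitely generated; $\otimes=\otimes_{\mathbf{k}}$; $\tau(a\otimes b)=b\otimes a$. For a binary operation $\circ$: $L_\circ(a)b=a\circ b$, $R_\circ(a)b=b\circ a$, $a\star b=a\circ b+b\circ a$, $L_\star(a)b=a\star b$. For a Lie bracket, $\mathrm{ad}(a)b=[a,b]$ and $a.(b\otimes c)=[a,b]\otimes c+b\otimes[a,c]$. A Novikov algebra $(A,\circ)$ satisfies $(a\circ b)\circ c-a\circ(b\circ c)=(b\circ a)\circ c-b\circ(a\circ c)$ and $(a\circ b)\circ c=(a\circ c)\circ b$. A Gel'fand-Dorfman (GD) algebra $(A,\circ,[\cdot,\cdot])$ is a Novikov algebra $(A,\circ)$ and a Lie algebra $(A,[\cdot,\cdot])$ with $[a\circ b,c]-[a\circ c,b]+[a,b]\circ c-[a,c]\circ b-a\circ[b,c]=0$ for all $a,b,c$. A Novikov coalgebra $(A,\Delta)$: $\Delta:A\to A\otimes A$ linear with $(\mathrm{id}\otimes\Delta)\Delta(a)-(\tau\otimes\mathrm{id})(\mathrm{id}\otimes\Delta)\Delta(a)=(\Delta\otimes\mathrm{id})\Delta(a)-(\tau\otimes\mathrm{id})(\Delta\otimes\mathrm{id})\Delta(a)$ and $(\tau\otimes\mathrm{id})(\mathrm{id}\otimes\Delta)\tau\Delta(a)=(\Delta\otimes\mathrm{id})\Delta(a)$. A Lie coalgebra $(A,\delta)$: $\delta=-\tau\delta$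 and $(\mathrm{id}\otimes\delta)\delta-(\tau\otimes\mathrm{id})(\mathrm{id}\otimes\delta)\delta=(\delta\otimes\mathrm{id})\delta$. A GD coalgebra $(A,\Delta,\delta)$: $(A,\Delta)$ is a Novikov coalgebra, $(A,\delta)$ is a Lie coalgebra, and $(\mathrm{id}\otimes\delta)\Delta(a)-(\tau\otimes\mathrm{id})(\mathrm{id}\otimes\Delta)\delta(a)+(\tau\otimes\mathrm{id})(\mathrm{id}\otimes\delta)\tau\Delta(a)=(\Delta\otimes\mathrm{id})\delta(a)+(\delta\otimes\mathrm{id})\Delta(a)$. A Novikov bialgebra $(A,\circ,\Delta)$: $(A,\circ)$ is a Novikov algebra, $(A,\Delta)$ is a Novikov coalgebra, and for all $a,b$: $\Delta(a\circ b)=(R_\circ(b)\otimes\mathrm{id})\Delta(a)+(\mathrm{id}\otimes L_\star(a))(\Delta(b)+\tau\Delta(b))$; $(L_\star(a)\otimes\mathrm{id})\Delta(b)-(\mathrm{id}\otimes L_\star(a))\tau\Delta(b)=(L_\star(b)\otimes\mathrm{id})\Delta(a)-(\mathrm{id}\otimes L_\star(b))\tau\Delta(a)$; $(\mathrm{id}\otimes R_\circ(a)-R_\circ(a)\otimes\mathrm{id})(\Delta(b)+\tau\Delta(b))=(\mathrm{id}\otimes R_\circ(b)-R_\circ(b)\otimes\mathrm{id})(\Delta(a)+\tau\Delta(a))$. A Lie bialgebra $(A,[\cdot,\cdot],\delta)$: a Lie algebra and Lie coalgebra with $\delta([a,b])=a.\delta(b)-b.\delta(a)$. A GD bialgebra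 $(A,\circ,[\cdot,\cdot],\Delta,\delta)$: $(A,\circ,[\cdot,\cdot])$ is a GD algebra, $(A,\Delta,\delta)$ is a GD coalgebra, $(A,\circ,\Delta)$ is a Novikov bialgebra, $(A,[\cdot,\cdot],\delta)$ is a Lie bialgebra, and for all $a,b$ $$\delta(b\circ a)+\Delta([a,b])=(R_\circ(a)\otimes\mathrm{id})\delta(b)+(L_\circ(b)\otimes\mathrm{id})\delta(a)+(\mathrm{id}\otimes L_\star(b))\delta(a)+a.\Delta(b)-(\mathrm{id}\otimes\mathrm{ad}(b))(\Delta(a)+\tau\Delta(a)).$$ A Lie conformal algebra is a $\mathbf{k}[\partial]$-module $R$ with a $\mathbf{k}$-bilinear map $[\cdot_\lambda\cdot]:R\times R\to R[\lambda]$ such that $[\partial a_\lambda b]=-\lambda[a_\lambda b]$, $[a_\lambda\partial b]=(\lambda+\partial)[a_\lambda b]$, $[a_\lambda b]=-[b_{-\lambda-\partial}a]$, $[a_\lambda[b_\mu c]]=[[a_\lambda b]_{\lambda+\mu}c]+[b_\mu[a_\lambda c]]$. The Lie conformal algebra corresponding to a GD algebra $(A,\circ,[\cdot,\cdot])$ is the free module $R=\mathbf{k}[\partial]A=\mathbf{k}[\partial]\otimes_{\mathbf{k}}A$ with $[a_\lambda b]=\partial(b\circ a)+\lambda(a\star b)+[a,b]$ for $a,b\in A$, extended by the first two identities. $R\otimes R$ is a $\mathbf{k}[\partial]$-module via $\partial\otimes\mathrm{id}+\mathrm{id}\otimes\partial$. A Lie conformal coalgebra $(R,\delta)$: $\delta:R\to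 R\otimes R$ a $\mathbf{k}[\partial]$-module homomorphism with $\delta=-\tau\delta$ and $(\mathrm{id}\otimes\delta)\delta-(\tau\otimes\mathrm{id})(\mathrm{id}\otimes\delta)\delta=(\delta\otimes\mathrm{id})\delta$. A Lie conformal bialgebra $(R,[\cdot_\lambda\cdot],\delta)$: a Lie conformal algebra and Lie conformal coalgebra with $a_\lambda\delta(b)-b_{-\lambda-\partial}\delta(a)=\delta([a_\lambda b])$ for all $a,b\in R$, where $a_\lambda(\sum b_{(1)}\otimes b_{(2)})=\sum([a_\lambda b_{(1)}]\otimes b_{(2)}+b_{(1)}\otimes[a_\lambda b_{(2)}])$, and in $b_{-\lambda-\partial}\delta(a)$ the symbol $\partial$ denotes $\partial\otimes\mathrm{id}+\mathrm{id}\otimes\partial$. *)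

theory Defs
  imports "HOL-Library.Function_Algebras" "HOL-Computational_Algebra.Polynomial"
begin

section \<open>Tensor products of vector spaces\<close>

text \<open>
  A vector space over \<open>'k\<close> is a type \<open>'a\<close> with a scalar multiplication \<open>s\<close>. A tensor type
  depending on the parameter \<open>s\<close> is not available, so \<open>V \<otimes> V\<close> and \<open>V \<otimes> V \<otimes> V\<close> are subspaces of
  function spaces (with pointwise operations): \<open>x \<otimes> y\<close> is evaluation at \<open>(x, y)\<close> on bilinear
  forms, and the tensor product consists of the finite sums of such elements. Over a field this
  is the tensor product: bilinear maps into arbitrary vector spaces factor through it, see
  \<open>tens_lift_sum\<close> and \<open>tens3_lift_sum\<close>. The value on functions that are not bilinear is
  normalised to \<open>0\<close>, so that equality of tensors is equality of functions.
  Working with the threefold product directly builds in the usual identification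
  \<open>(V \<otimes> V) \<otimes> V = V \<otimes> (V \<otimes> V)\<close>.
\<close>

definition bilinear_map ::
  "('k::field \<Rightarrow> 'a::ab_group_add \<Rightarrow> 'a) \<Rightarrow> ('k \<Rightarrow> 'b::ab_group_add \<Rightarrow> 'b) \<Rightarrow>
   ('k \<Rightarrow> 'c::ab_group_add \<Rightarrow> 'c) \<Rightarrow> ('a \<Rightarrow> 'b \<Rightarrow> 'c) \<Rightarrow> bool" where
  "bilinear_map s1 s2 s3 f \<longleftrightarrow>
     (\<forall>x. Vector_Spaces.linear s2 s3 (f x)) \<and> (\<forall>y. Vector_Spaces.linear s1 s3 (\<lambda>x. f x y))"

definition trilinear_map ::
  "('k::field \<Rightarrow> 'a::ab_group_add \<Rightarrow> 'a) \<Rightarrow> ('k \<Rightarrow> 'c::ab_group_add \<Rightarrow> 'c) \<Rightarrow>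
   ('a \<Rightarrow> 'a \<Rightarrow> 'a \<Rightarrow> 'c) \<Rightarrow> bool" where
  "trilinear_map s s' f \<longleftrightarrow>
     (\<forall>x y. Vector_Spaces.linear s s' (\<lambda>z. f x y z)) \<and>
     (\<forall>x z. Vector_Spaces.linear s s' (\<lambda>y. f x y z)) \<and>
     (\<forall>y z. Vector_Spaces.linear s s' (\<lambda>x. f x y z))"

type_synonym ('a, 'k) tensor2 = "('a \<Rightarrow> 'a \<Rightarrow> 'k) \<Rightarrow> 'k"
type_synonym ('a, 'k) tensor3 = "('a \<Rightarrow> 'a \<Rightarrow> 'a \<Rightarrow> 'k) \<Rightarrow> 'k"

definition tens ::
  "('k::field \<Rightarrow> 'a::ab_group_add \<Rightarrow> 'a) \<Rightarrow> 'a \<Rightarrow> 'a \<Rightarrow> ('a, 'k) tensor2" where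
  "tens s x y = (\<lambda>\<phi>. if bilinear_map s s (*) \<phi> then \<phi> x y else 0)"

definition tens3 ::
  "('k::field \<Rightarrow> 'a::ab_group_add \<Rightarrow> 'a) \<Rightarrow> 'a \<Rightarrow> 'a \<Rightarrow> 'a \<Rightarrow> ('a, 'k) tensor3" where
  "tens3 s x y z = (\<lambda>\<phi>. if trilinear_map s (*) \<phi> then \<phi> x y z else 0)"

definition tens_scale :: "'k::field \<Rightarrow> ('f \<Rightarrow> 'k) \<Rightarrow> ('f \<Rightarrow> 'k)" where
  "tens_scale c t = (\<lambda>\<phi>. c * t \<phi>)"

definition tens_space ::
  "('k::field \<Rightarrow> 'a::ab_group_add \<Rightarrow> 'a) \<Rightarrow> ('a, 'k) tensor2 set" where
  "tens_space s = {t. \<exists>ps. t = (\<Sum>(x, y)\<leftarrow>ps. tens s x y)}"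

text \<open>
  The linear map on the tensor product induced by a multilinear map \<open>f\<close>:
  \<open>\<Sum> x \<otimes> y \<mapsto> \<Sum> f x y\<close>. It does not depend on the chosen representation.
\<close>

definition tens_lift ::
  "('k::field \<Rightarrow> 'a::ab_group_add \<Rightarrow> 'a) \<Rightarrow> ('a \<Rightarrow> 'a \<Rightarrow> 'v::ab_group_add) \<Rightarrow>
   ('a, 'k) tensor2 \<Rightarrow> 'v" where
  "tens_lift s f t =
     (\<Sum>(x, y)\<leftarrow>(SOME ps. t = (\<Sum>(x, y)\<leftarrow>ps. tens s x y)). f x y)"

definition tens3_lift ::
  "('k::field \<Rightarrow> 'a::ab_group_add \<Rightarrow> 'a) \<Rightarrow> ('a \<Rightarrow> 'a \<Rightarrow> 'a \<Rightarrow> 'v::ab_group_add) \<Rightarrow>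
   ('a, 'k) tensor3 \<Rightarrow> 'v" where
  "tens3_lift s f t =
     (\<Sum>(x, y, z)\<leftarrow>(SOME ps. t = (\<Sum>(x, y, z)\<leftarrow>ps. tens3 s x y z)). f x y z)"

lemma sum_list_fun_apply: "sum_list (map F ps) \<phi> = sum_list (map (\<lambda>p. F p \<phi>) ps)"
  for F :: "'p \<Rightarrow> 'f \<Rightarrow> 'k::comm_monoid_add"
  by (induction ps) auto

lemma separating_functional:
  fixes sV :: "'k::field \<Rightarrow> 'v::ab_group_add \<Rightarrow> 'v"
  assumes "vector_space sV" and "v \<noteq> 0"
  shows "\<exists>l. Vector_Spaces.linear sV (*) l \<and> l v \<noteq> 0"
proof -
  interpret V: vector_space sV by fact
  interpret K: vector_space "(*) :: 'k \<Rightarrow> 'k \<Rightarrow> 'k"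
    by unfold_locales (auto simp: algebra_simps)
  interpret vector_space_pair sV "(*) :: 'k \<Rightarrow> 'k \<Rightarrow> 'k" ..
  have "V.independent {v}" using assms(2) by simp
  then obtain l where "Vector_Spaces.linear sV (*) l" "\<forall>x\<in>{v}. l x = 1"
    using linear_independent_extend[of "{v}" "\<lambda>_. 1"] by blast
  then show ?thesis by (intro exI[of _ l]) auto
qed

lemma linear_comp:
  "Vector_Spaces.linear s1 s2 f \<Longrightarrow> Vector_Spaces.linear s2 s3 g \<Longrightarrow>
   Vector_Spaces.linear s1 s3 (\<lambda>x. g (f x))"
  using Vector_Spaces.linear_compose[of s1 s2 f s3 g] by (simp add: o_def)

lemma linear_imp_module_hom: "Vector_Spaces.linear s1 s2 f \<Longrightarrow> module_hom s1 s2 f"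
  by (simp add: Vector_Spaces.linear_def)

lemma linear_sum_list:
  assumes "Vector_Spaces.linear s1 s2 l"
  shows "l (sum_list xs) = sum_list (map l xs)"
proof -
  interpret Vector_Spaces.linear s1 s2 l by fact
  show ?thesis by (induction xs) (auto simp: add zero)
qed

lemma tens_lift_sum:
  assumes f: "bilinear_map s s sV f"
  shows "tens_lift s f (\<Sum>(x, y)\<leftarrow>ps. tens s x y) = (\<Sum>(x, y)\<leftarrow>ps. f x y)"
proof -
  let ?t = "\<Sum>(x, y)\<leftarrow>ps. tens s x y"
  define qs where "qs = (SOME qs. ?t = (\<Sum>(x, y)\<leftarrow>qs. tens s x y))"
  have qs: "?t = (\<Sum>(x, y)\<leftarrow>qs. tens s x y)"
    unfolding qs_def by (rule someI) (rule refl)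
  have sV: "vector_space sV"
    using f by (auto simp: bilinear_map_def Vector_Spaces.linear_def)
  have "(\<Sum>(x, y)\<leftarrow>qs. f x y) - (\<Sum>(x, y)\<leftarrow>ps. f x y) = 0"
  proof (rule ccontr)
    assume "\<not> ?thesis"
    from separating_functional[OF sV this] obtain l where
      l: "Vector_Spaces.linear sV (*) l" and
      l0: "l ((\<Sum>(x, y)\<leftarrow>qs. f x y) - (\<Sum>(x, y)\<leftarrow>ps. f x y)) \<noteq> 0" by blast
    have b: "bilinear_map s s (*) (\<lambda>x y. l (f x y))"
      using f unfolding bilinear_map_def by (auto intro: linear_comp[OF _ l])
    have ev: "(\<Sum>(x, y)\<leftarrow>rs. tens s x y) (\<lambda>x y. l (f x y)) = l (\<Sum>(x, y)\<leftarrow>rs. f x y)" for rs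
      unfolding sum_list_fun_apply linear_sum_list[OF l] map_map o_def
      by (rule arg_cong[of _ _ sum_list]) (auto simp: tens_def b)
    have "l (\<Sum>(x, y)\<leftarrow>qs. f x y) = l (\<Sum>(x, y)\<leftarrow>ps. f x y)"
      using ev[of ps] ev[of qs] qs by simp
    then show False using l0 l by (simp add: module_hom.diff[OF linear_imp_module_hom])
  qed
  then show ?thesis unfolding tens_lift_def qs_def by simp
qed

lemma tens3_lift_sum:
  assumes f: "trilinear_map s sV f"
  shows "tens3_lift s f (\<Sum>(x, y, z)\<leftarrow>ps. tens3 s x y z) = (\<Sum>(x, y, z)\<leftarrow>ps. f x y z)"
proof -
  let ?t = "\<Sum>(x, y, z)\<leftarrow>ps. tens3 s x y z"
  define qs where "qs = (SOME qs. ?t = (\<Sum>(x, y, z)\<leftarrow>qs. tens3 s x y z))"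
  have qs: "?t = (\<Sum>(x, y, z)\<leftarrow>qs. tens3 s x y z)"
    unfolding qs_def by (rule someI) (rule refl)
  have sV: "vector_space sV"
    using f by (auto simp: trilinear_map_def Vector_Spaces.linear_def)
  have "(\<Sum>(x, y, z)\<leftarrow>qs. f x y z) - (\<Sum>(x, y, z)\<leftarrow>ps. f x y z) = 0"
  proof (rule ccontr)
    assume "\<not> ?thesis"
    from separating_functional[OF sV this] obtain l where
      l: "Vector_Spaces.linear sV (*) l" and
      l0: "l ((\<Sum>(x, y, z)\<leftarrow>qs. f x y z) - (\<Sum>(x, y, z)\<leftarrow>ps. f x y z)) \<noteq> 0" by blast
    have b: "trilinear_map s (*) (\<lambda>x y z. l (f x y z))"
      using f unfolding trilinear_map_def by (auto intro: linear_comp[OF _ l])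
    have ev: "(\<Sum>(x, y, z)\<leftarrow>rs. tens3 s x y z) (\<lambda>x y z. l (f x y z)) =
              l (\<Sum>(x, y, z)\<leftarrow>rs. f x y z)" for rs
      unfolding sum_list_fun_apply linear_sum_list[OF l] map_map o_def
      by (rule arg_cong[of _ _ sum_list]) (auto simp: tens3_def b)
    have "l (\<Sum>(x, y, z)\<leftarrow>qs. f x y z) = l (\<Sum>(x, y, z)\<leftarrow>ps. f x y z)"
      using ev[of ps] ev[of qs] qs by simp
    then show False using l0 l by (simp add: module_hom.diff[OF linear_imp_module_hom])
  qed
  then show ?thesis unfolding tens3_lift_def qs_def by simp
qed

text \<open>\<open>f \<otimes> g\<close> for linear maps \<open>f, g\<close> from \<open>(V, s)\<close> to \<open>(W, s')\<close>, and the flip \<open>\<tau>\<close>.\<close>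

definition tens_map ::
  "('k::field \<Rightarrow> 'a::ab_group_add \<Rightarrow> 'a) \<Rightarrow> ('k \<Rightarrow> 'b::ab_group_add \<Rightarrow> 'b) \<Rightarrow>
   ('a \<Rightarrow> 'b) \<Rightarrow> ('a \<Rightarrow> 'b) \<Rightarrow> ('a, 'k) tensor2 \<Rightarrow> ('b, 'k) tensor2" where
  "tens_map s s' f g = tens_lift s (\<lambda>x y. tens s' (f x) (g y))"

definition tens_flip ::
  "('k::field \<Rightarrow> 'a::ab_group_add \<Rightarrow> 'a) \<Rightarrow> ('a, 'k) tensor2 \<Rightarrow> ('a, 'k) tensor2" where
  "tens_flip s = tens_lift s (\<lambda>x y. tens s y x)"

text \<open>\<open>id \<otimes> D\<close>, \<open>D \<otimes> id\<close> and \<open>\<tau> \<otimes> id\<close>, with values in \<open>V \<otimes> V \<otimes> V\<close>.\<close>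

definition id_tens_cop ::
  "('k::field \<Rightarrow> 'a::ab_group_add \<Rightarrow> 'a) \<Rightarrow> ('a \<Rightarrow> ('a, 'k) tensor2) \<Rightarrow>
   ('a, 'k) tensor2 \<Rightarrow> ('a, 'k) tensor3" where
  "id_tens_cop s D = tens_lift s (\<lambda>x y. tens_lift s (\<lambda>u v. tens3 s x u v) (D y))"

definition cop_tens_id ::
  "('k::field \<Rightarrow> 'a::ab_group_add \<Rightarrow> 'a) \<Rightarrow> ('a \<Rightarrow> ('a, 'k) tensor2) \<Rightarrow>
   ('a, 'k) tensor2 \<Rightarrow> ('a, 'k) tensor3" where
  "cop_tens_id s D = tens_lift s (\<lambda>x y. tens_lift s (\<lambda>u v. tens3 s u v y) (D x))"

definition flip_tens_id ::
  "('k::field \<Rightarrow> 'a::ab_group_add \<Rightarrow> 'a) \<Rightarrow> ('a, 'k) tensor3 \<Rightarrow> ('a, 'k) tensor3" where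
  "flip_tens_id s = tens3_lift s (\<lambda>x y z. tens3 s y x z)"


section \<open>Gel'fand-Dorfman algebras, coalgebras and bialgebras\<close>

locale fd_space = vector_space s
  for s :: "'k::field_char_0 \<Rightarrow> 'a::ab_group_add \<Rightarrow> 'a" +
  assumes finite_dimensional: "\<exists>B. finite_dimensional_vector_space s B"

locale novikov_algebra = fd_space s
  for s :: "'k::field_char_0 \<Rightarrow> 'a::ab_group_add \<Rightarrow> 'a" +
  fixes circ :: "'a \<Rightarrow> 'a \<Rightarrow> 'a" (infixl "\<odot>" 70)
  assumes circ_bilinear: "bilinear_map s s s circ"
    and left_symmetric: "(a \<odot> b) \<odot> c - a \<odot> (b \<odot> c) = (b \<odot> a) \<odot> c - b \<odot> (a \<odot> c)"
    and right_commutative: "(a \<odot> b) \<odot> c = (a \<odot> c) \<odot> b"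

locale lie_algebra = fd_space s
  for s :: "'k::field_char_0 \<Rightarrow> 'a::ab_group_add \<Rightarrow> 'a" +
  fixes br :: "'a \<Rightarrow> 'a \<Rightarrow> 'a"
  assumes br_bilinear: "bilinear_map s s s br"
    and br_alternating: "br a a = 0"
    and br_jacobi: "br a (br b c) + br b (br c a) + br c (br a b) = 0"

locale gd_algebra = novikov_algebra s circ + lie_algebra s br
  for s :: "'k::field_char_0 \<Rightarrow> 'a::ab_group_add \<Rightarrow> 'a"
    and circ :: "'a \<Rightarrow> 'a \<Rightarrow> 'a" (infixl "\<odot>" 70)
    and br :: "'a \<Rightarrow> 'a \<Rightarrow> 'a" +
  assumes gd_compat:
    "br (a \<odot> b) c - br (a \<odot> c) b + br a b \<odot> c - br a c \<odot> b - a \<odot> br b c = 0"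

locale novikov_coalgebra = fd_space s
  for s :: "'k::field_char_0 \<Rightarrow> 'a::ab_group_add \<Rightarrow> 'a" +
  fixes \<Delta> :: "'a \<Rightarrow> ('a, 'k) tensor2"
  assumes cop_linear: "Vector_Spaces.linear s tens_scale \<Delta>"
    and cop_in_tens: "\<Delta> a \<in> tens_space s"
    and cop_left_symmetric:
      "id_tens_cop s \<Delta> (\<Delta> a) - flip_tens_id s (id_tens_cop s \<Delta> (\<Delta> a)) =
       cop_tens_id s \<Delta> (\<Delta> a) - flip_tens_id s (cop_tens_id s \<Delta> (\<Delta> a))"
    and cop_right_commutative:
      "flip_tens_id s (id_tens_cop s \<Delta> (tens_flip s (\<Delta> a))) = cop_tens_id s \<Delta> (\<Delta> a)"

locale lie_coalgebra = fd_space s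
  for s :: "'k::field_char_0 \<Rightarrow> 'a::ab_group_add \<Rightarrow> 'a" +
  fixes \<delta> :: "'a \<Rightarrow> ('a, 'k) tensor2"
  assumes cobr_linear: "Vector_Spaces.linear s tens_scale \<delta>"
    and cobr_in_tens: "\<delta> a \<in> tens_space s"
    and cobr_skew: "\<delta> a = - tens_flip s (\<delta> a)"
    and cobr_jacobi:
      "id_tens_cop s \<delta> (\<delta> a) - flip_tens_id s (id_tens_cop s \<delta> (\<delta> a)) =
       cop_tens_id s \<delta> (\<delta> a)"

locale gd_coalgebra = novikov_coalgebra s \<Delta> + lie_coalgebra s \<delta>
  for s :: "'k::field_char_0 \<Rightarrow> 'a::ab_group_add \<Rightarrow> 'a"
    and \<Delta> \<delta> :: "'a \<Rightarrow> ('a, 'k) tensor2" +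
  assumes gd_cop_compat:
    "id_tens_cop s \<delta> (\<Delta> a) - flip_tens_id s (id_tens_cop s \<Delta> (\<delta> a))
       + flip_tens_id s (id_tens_cop s \<delta> (tens_flip s (\<Delta> a))) =
     cop_tens_id s \<Delta> (\<delta> a) + cop_tens_id s \<delta> (\<Delta> a)"

locale novikov_bialgebra = novikov_algebra s circ + novikov_coalgebra s \<Delta>
  for s :: "'k::field_char_0 \<Rightarrow> 'a::ab_group_add \<Rightarrow> 'a"
    and circ :: "'a \<Rightarrow> 'a \<Rightarrow> 'a" (infixl "\<odot>" 70)
    and \<Delta> :: "'a \<Rightarrow> ('a, 'k) tensor2" +
  assumes nov_bialg1:
    "\<Delta> (a \<odot> b) = tens_map s s (\<lambda>x. x \<odot> b) id (\<Delta> a)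
       + tens_map s s id (\<lambda>x. a \<odot> x + x \<odot> a) (\<Delta> b + tens_flip s (\<Delta> b))"
    and nov_bialg2:
    "tens_map s s (\<lambda>x. a \<odot> x + x \<odot> a) id (\<Delta> b)
       - tens_map s s id (\<lambda>x. a \<odot> x + x \<odot> a) (tens_flip s (\<Delta> b)) =
     tens_map s s (\<lambda>x. b \<odot> x + x \<odot> b) id (\<Delta> a)
       - tens_map s s id (\<lambda>x. b \<odot> x + x \<odot> b) (tens_flip s (\<Delta> a))"
    and nov_bialg3:
    "tens_map s s id (\<lambda>x. x \<odot> a) (\<Delta> b + tens_flip s (\<Delta> b))
       - tens_map s s (\<lambda>x. x \<odot> a) id (\<Delta> b + tens_flip s (\<Delta> b)) =
     tens_map s s id (\<lambda>x. x \<odot> b) (\<Delta> a + tens_flip s (\<Delta> a))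
       - tens_map s s (\<lambda>x. x \<odot> b) id (\<Delta> a + tens_flip s (\<Delta> a))"

definition tens_ad ::
  "('k::field \<Rightarrow> 'a::ab_group_add \<Rightarrow> 'a) \<Rightarrow> ('a \<Rightarrow> 'a \<Rightarrow> 'a) \<Rightarrow>
   'a \<Rightarrow> ('a, 'k) tensor2 \<Rightarrow> ('a, 'k) tensor2" where
  "tens_ad s br a = tens_lift s (\<lambda>b c. tens s (br a b) c + tens s b (br a c))"

locale lie_bialgebra = lie_algebra s br + lie_coalgebra s \<delta>
  for s :: "'k::field_char_0 \<Rightarrow> 'a::ab_group_add \<Rightarrow> 'a"
    and br :: "'a \<Rightarrow> 'a \<Rightarrow> 'a"
    and \<delta> :: "'a \<Rightarrow> ('a, 'k) tensor2" +
  assumes lie_bialg: "\<delta> (br a b) = tens_ad s br a (\<delta> b) - tens_ad s br b (\<delta> a)"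

locale gd_bialgebra =
  gd_algebra s circ br + gd_coalgebra s \<Delta> \<delta> + novikov_bialgebra s circ \<Delta> + lie_bialgebra s br \<delta>
  for s :: "'k::field_char_0 \<Rightarrow> 'a::ab_group_add \<Rightarrow> 'a"
    and circ :: "'a \<Rightarrow> 'a \<Rightarrow> 'a" (infixl "\<odot>" 70)
    and br :: "'a \<Rightarrow> 'a \<Rightarrow> 'a"
    and \<Delta> \<delta> :: "'a \<Rightarrow> ('a, 'k) tensor2" +
  assumes gd_bialg:
    "\<delta> (b \<odot> a) + \<Delta> (br a b) =
       tens_map s s (\<lambda>x. x \<odot> a) id (\<delta> b) + tens_map s s (\<lambda>x. b \<odot> x) id (\<delta> a)
       + tens_map s s id (\<lambda>x. b \<odot> x + x \<odot> b) (\<delta> a) + tens_ad s br a (\<Delta> b)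
       - tens_map s s id (br b) (\<Delta> a + tens_flip s (\<Delta> a))"


section \<open>Lie conformal algebras, coalgebras and bialgebras\<close>

text \<open>
  A \<open>k[\<partial>]\<close>-module is a vector space \<open>(R, s)\<close> with a linear endomorphism \<open>D\<close>, the action of
  \<open>\<partial>\<close>. It is finitely generated when finitely many elements together with their iterated
  images under \<open>D\<close> span it over \<open>k\<close>.
\<close>

locale fg_kd_module = vector_space s
  for s :: "'k::field_char_0 \<Rightarrow> 'r::ab_group_add \<Rightarrow> 'r" +
  fixes D :: "'r \<Rightarrow> 'r"
  assumes D_linear: "Vector_Spaces.linear s s D"
    and finitely_generated: "\<exists>B. finite B \<and> span {(D ^^ n) b | n b. b \<in> B} = UNIV"

text \<open>
  \<open>R[\<lambda>]\<close> is \<open>'r poly\<close>, and \<open>R[\<lambda>, \<mu>]\<close> is \<open>'r poly poly\<close> with \<open>\<lambda>\<close> the inner and \<open>\<mu>\<close> the outer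
  variable. \<open>subst_var X \<iota> p\<close> is \<open>\<Sum> X\<^sup>i \<iota>(p\<^sub>i)\<close>, i.e. the operator \<open>X\<close> is substituted
  for the variable of \<open>p\<close>, acting from the left on the images of the coefficients \<open>p\<^sub>i\<close>.
\<close>

definition subst_var ::
  "('v \<Rightarrow> 'v) \<Rightarrow> ('r \<Rightarrow> 'v) \<Rightarrow> 'r::zero poly \<Rightarrow> 'v::comm_monoid_add" where
  "subst_var X \<iota> p = (\<Sum>i\<le>degree p. (X ^^ i) (\<iota> (coeff p i)))"

definition mult_lam2 :: "'r::zero poly poly \<Rightarrow> 'r poly poly" where
  "mult_lam2 = map_poly (pCons 0)"

definition mult_mu2 :: "'r::zero poly poly \<Rightarrow> 'r poly poly" where
  "mult_mu2 = pCons 0"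

definition const2 :: "'r::zero \<Rightarrow> 'r poly poly" where
  "const2 r = [:[:r:]:]"

text \<open>\<open>p(-\<lambda>-\<partial>)\<close>, where \<open>D\<close> is the action of \<open>\<partial>\<close> on coefficients.\<close>

definition subst_neg_lam_del ::
  "('r \<Rightarrow> 'r) \<Rightarrow> 'r::ab_group_add poly \<Rightarrow> 'r poly" where
  "subst_neg_lam_del D = subst_var (\<lambda>q. - pCons 0 q - map_poly D q) (\<lambda>r. [:r:])"

locale lie_conformal_algebra = fg_kd_module s D
  for s :: "'k::field_char_0 \<Rightarrow> 'r::ab_group_add \<Rightarrow> 'r" and D :: "'r \<Rightarrow> 'r" +
  fixes lbr :: "'r \<Rightarrow> 'r \<Rightarrow> 'r poly"
  assumes lbr_bilinear: "bilinear_map s s (\<lambda>c. map_poly (s c)) lbr"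
    and sesqui_left: "lbr (D a) b = - pCons 0 (lbr a b)"
    and sesqui_right: "lbr a (D b) = pCons 0 (lbr a b) + map_poly D (lbr a b)"
    and conf_skew: "lbr a b = - subst_neg_lam_del D (lbr b a)"
    and conf_jacobi:
      "subst_var mult_mu2 (\<lambda>x. subst_var mult_lam2 const2 (lbr a x)) (lbr b c) =
       subst_var mult_lam2
         (\<lambda>x. subst_var (\<lambda>q. mult_lam2 q + mult_mu2 q) const2 (lbr x c)) (lbr a b)
       + subst_var mult_lam2 (\<lambda>x. subst_var mult_mu2 const2 (lbr b x)) (lbr a c)"

text \<open>The action \<open>\<partial> \<otimes> id + id \<otimes> \<partial>\<close> of \<open>\<partial>\<close> on \<open>R \<otimes> R\<close>.\<close>

definition tens_del ::
  "('k::field \<Rightarrow> 'r::ab_group_add \<Rightarrow> 'r) \<Rightarrow> ('r \<Rightarrow> 'r) \<Rightarrow>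
   ('r, 'k) tensor2 \<Rightarrow> ('r, 'k) tensor2" where
  "tens_del s D t = tens_map s s D id t + tens_map s s id D t"

text \<open>\<open>k[\<partial>]\<close>-module homomorphisms \<open>R \<rightarrow> R \<otimes> R\<close>.\<close>

definition kd_hom_tens ::
  "('k::field \<Rightarrow> 'r::ab_group_add \<Rightarrow> 'r) \<Rightarrow> ('r \<Rightarrow> 'r) \<Rightarrow>
   ('r \<Rightarrow> ('r, 'k) tensor2) \<Rightarrow> bool" where
  "kd_hom_tens s D f \<longleftrightarrow>
     Vector_Spaces.linear s tens_scale f \<and> (\<forall>a. f a \<in> tens_space s) \<and>
     (\<forall>a. f (D a) = tens_del s D (f a))"

locale lie_conformal_coalgebra = fg_kd_module s D
  for s :: "'k::field_char_0 \<Rightarrow> 'r::ab_group_add \<Rightarrow> 'r" and D :: "'r \<Rightarrow> 'r" +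
  fixes \<delta> :: "'r \<Rightarrow> ('r, 'k) tensor2"
  assumes conf_cobr_hom: "kd_hom_tens s D \<delta>"
    and conf_cobr_skew: "\<delta> a = - tens_flip s (\<delta> a)"
    and conf_cobr_jacobi:
      "id_tens_cop s \<delta> (\<delta> a) - flip_tens_id s (id_tens_cop s \<delta> (\<delta> a)) =
       cop_tens_id s \<delta> (\<delta> a)"

text \<open>\<open>a\<^sub>\<lambda> t\<close> for \<open>t \<in> R \<otimes> R\<close>, an element of \<open>(R \<otimes> R)[\<lambda>]\<close>.\<close>

definition lam_act ::
  "('k::field \<Rightarrow> 'r::ab_group_add \<Rightarrow> 'r) \<Rightarrow> ('r \<Rightarrow> 'r \<Rightarrow> 'r poly) \<Rightarrow>
   'r \<Rightarrow> ('r, 'k) tensor2 \<Rightarrow> ('r, 'k) tensor2 poly" where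
  "lam_act s lbr a = tens_lift s (\<lambda>x y.
     map_poly (\<lambda>r. tens s r y) (lbr a x) + map_poly (\<lambda>r. tens s x r) (lbr a y))"

locale lie_conformal_bialgebra = lie_conformal_algebra s D lbr + lie_conformal_coalgebra s D \<delta>
  for s :: "'k::field_char_0 \<Rightarrow> 'r::ab_group_add \<Rightarrow> 'r" and D :: "'r \<Rightarrow> 'r"
    and lbr :: "'r \<Rightarrow> 'r \<Rightarrow> 'r poly"
    and \<delta> :: "'r \<Rightarrow> ('r, 'k) tensor2" +
  assumes conf_cocycle:
    "lam_act s lbr a (\<delta> b) - subst_neg_lam_del (tens_del s D) (lam_act s lbr b (\<delta> a)) =
     map_poly \<delta> (lbr a b)"


section \<open>The Lie conformal algebra of a Gel'fand-Dorfman algebra\<close>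

text \<open>
  \<open>R = k[\<partial>]A\<close> is \<open>'a poly\<close>, i.e. \<open>\<Sum> \<partial>\<^sup>i a\<^sub>i\<close> is the polynomial with coefficients \<open>a\<^sub>i\<close>;
  \<open>\<partial>\<close> acts by \<open>pCons 0\<close> and \<open>A\<close> embeds as the constant polynomials.
\<close>

definition kdA_scale :: "('k \<Rightarrow> 'a::zero \<Rightarrow> 'a) \<Rightarrow> 'k \<Rightarrow> 'a poly \<Rightarrow> 'a poly" where
  "kdA_scale s c = map_poly (s c)"

definition kdA_del :: "'a::zero poly \<Rightarrow> 'a poly" where
  "kdA_del = pCons 0"

definition kdA_const :: "'a::zero \<Rightarrow> 'a poly" where
  "kdA_const a = [:a:]"

text \<open>\<open>[a\<^sub>\<lambda> b] = \<partial>(b \<circ> a) + \<lambda>(a \<star> b) + [a, b]\<close> for \<open>a, b \<in> A\<close>.\<close>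

definition gd_lbr_base ::
  "('a::ab_group_add \<Rightarrow> 'a \<Rightarrow> 'a) \<Rightarrow> ('a \<Rightarrow> 'a \<Rightarrow> 'a) \<Rightarrow> 'a \<Rightarrow> 'a \<Rightarrow> 'a poly poly" where
  "gd_lbr_base circ br a b =
     [: kdA_del (kdA_const (circ b a)) + kdA_const (br a b), kdA_const (circ a b + circ b a) :]"

text \<open>Sesquilinear extension: \<open>[\<partial>\<^sup>i a\<^sub>\<lambda> \<partial>\<^sup>j b] = (-\<lambda>)\<^sup>i (\<lambda>+\<partial>)\<^sup>j [a\<^sub>\<lambda> b]\<close>.\<close>

definition gd_lbr ::
  "('a::ab_group_add \<Rightarrow> 'a \<Rightarrow> 'a) \<Rightarrow> ('a \<Rightarrow> 'a \<Rightarrow> 'a) \<Rightarrow> 'a poly \<Rightarrow> 'a poly \<Rightarrow> 'a poly poly" where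
  "gd_lbr circ br p q =
     (\<Sum>i\<le>degree p. \<Sum>j\<le>degree q.
        ((\<lambda>w. - pCons 0 w) ^^ i) (((\<lambda>w. pCons 0 w + map_poly kdA_del w) ^^ j)
          (gd_lbr_base circ br (coeff p i) (coeff q j))))"

text \<open>The embedding \<open>A \<otimes> A \<rightarrow> R \<otimes> R\<close>, and the map \<open>A \<rightarrow> A \<otimes> A\<close> obtained by
  restricting \<open>f : R \<rightarrow> R \<otimes> R\<close> with \<open>f(A) \<subseteq> A \<otimes> A\<close>.\<close>

definition tens_incl ::
  "('k::field \<Rightarrow> 'a::ab_group_add \<Rightarrow> 'a) \<Rightarrow> ('a, 'k) tensor2 \<Rightarrow> ('a poly, 'k) tensor2" where
  "tens_incl s = tens_map s (kdA_scale s) kdA_const kdA_const"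

definition restrict_to_A ::
  "('k::field \<Rightarrow> 'a::ab_group_add \<Rightarrow> 'a) \<Rightarrow> ('a poly \<Rightarrow> ('a poly, 'k) tensor2) \<Rightarrow>
   'a \<Rightarrow> ('a, 'k) tensor2" where
  "restrict_to_A s f a = the_inv_into (tens_space s) (tens_incl s) (f (kdA_const a))"

lemma vector_space_kdA:
  assumes "vector_space s"
  shows "vector_space (kdA_scale s)"
proof -
  interpret vector_space s by fact
  show ?thesis
    by unfold_locales
      (auto simp: kdA_scale_def poly_eq_iff coeff_map_poly scale_right_distrib scale_left_distrib)
qed

lemma vector_space_tens: "vector_space tens_scale"
  by unfold_locales (auto simp: tens_scale_def algebra_simps fun_eq_iff)

lemma tens_bilinear:
  assumes "vector_space s"
  shows "bilinear_map s s tens_scale (tens s)"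
proof -
  interpret vector_space s by fact
  interpret T: vector_space "tens_scale :: 'a \<Rightarrow> (('b \<Rightarrow> 'b \<Rightarrow> 'a) \<Rightarrow> 'a) \<Rightarrow> _"
    by (rule vector_space_tens)
  have "module_hom s tens_scale (tens s x)" "module_hom s tens_scale (\<lambda>x. tens s x y)" for x y
    by unfold_locales
      (auto simp: fun_eq_iff tens_def tens_scale_def bilinear_map_def Vector_Spaces.linear_def
          module_hom_def module_hom_axioms_def)
  then show ?thesis
    by (auto simp: bilinear_map_def Vector_Spaces.linear_def assms vector_space_tens)
qed

lemma inj_tens_incl:
  assumes s: "vector_space s"
  shows "inj_on (tens_incl s) (tens_space s)"
proof (rule inj_onI)
  interpret vector_space s by fact
  interpret P: vector_space "kdA_scale s" by (rule vector_space_kdA[OF s])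
  have lin_const: "Vector_Spaces.linear s (kdA_scale s) kdA_const"
    by unfold_locales (auto simp: kdA_const_def kdA_scale_def poly_eq_iff coeff_map_poly
        coeff_pCons split: nat.splits)
  have lin_c0: "Vector_Spaces.linear (kdA_scale s) s (\<lambda>p. coeff p 0)"
    by unfold_locales (auto simp: kdA_scale_def coeff_map_poly)
  have bil: "bilinear_map s s tens_scale (\<lambda>x y. tens (kdA_scale s) (kdA_const x) (kdA_const y))"
    using tens_bilinear[OF vector_space_kdA[OF s]] unfolding bilinear_map_def
    by (auto intro: linear_comp[OF lin_const])
  fix t u assume tu: "t \<in> tens_space s" "u \<in> tens_space s" "tens_incl s t = tens_incl s u"
  then obtain ps qs where ps: "t = (\<Sum>(x, y)\<leftarrow>ps. tens s x y)"
    and qs: "u = (\<Sum>(x, y)\<leftarrow>qs. tens s x y)" by (auto simp: tens_space_def)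
  have eq: "(\<Sum>(x, y)\<leftarrow>ps. tens (kdA_scale s) (kdA_const x) (kdA_const y)) =
        (\<Sum>(x, y)\<leftarrow>qs. tens (kdA_scale s) (kdA_const x) (kdA_const y))"
    using tu(3) by (simp add: tens_incl_def tens_map_def ps qs tens_lift_sum[OF bil])
  show "t = u"
  proof
    fix \<phi>
    show "t \<phi> = u \<phi>"
    proof (cases "bilinear_map s s (*) \<phi>")
      case False
      have "(\<Sum>(x, y)\<leftarrow>rs. tens s x y) \<phi> = 0" for rs
        unfolding sum_list_fun_apply by (induction rs) (auto simp: tens_def False)
      then show ?thesis by (simp add: ps qs)
    next
      case True
      define \<psi> where "\<psi> = (\<lambda>p q. \<phi> (coeff p 0) (coeff q 0))"
      have b: "bilinear_map (kdA_scale s) (kdA_scale s) (*) \<psi>"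
        using True unfolding bilinear_map_def \<psi>_def
        by (auto intro: linear_comp[OF lin_c0])
      have ev: "(\<Sum>(x, y)\<leftarrow>rs. tens s x y) \<phi> =
          (\<Sum>(x, y)\<leftarrow>rs. tens (kdA_scale s) (kdA_const x) (kdA_const y)) \<psi>" for rs
        unfolding sum_list_fun_apply
        by (rule arg_cong[of _ _ sum_list]) (auto simp: tens_def True b, simp add: \<psi>_def kdA_const_def)
      show ?thesis using eq by (simp add: ps qs ev)
    qed
  qed
qed

end

theory Submission
  imports Defs
begin

text \<open>
  Elements of \<open>R = k[\<partial>]A\<close>, of \<open>R \<otimes> R\<close>, of \<open>R \<otimes> R \<otimes> R\<close> and of \<open>R[\<lambda>]\<close> are polynomials with
  coefficients in \<open>A\<close> or in its tensor powers. The field is infinite, so they are determined by their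
  values at scalars (\<open>vpoly_separation\<close>, \<open>tens_eq_vpolyI\<close>, \<open>tens3_eq_vpolyI\<close>). Replacing every \<open>\<partial>\<close>
  and \<open>\<lambda>\<close> by a number turns the axioms of a Lie conformal bialgebra into identities on \<open>A\<close> that depend
  polynomially on scalar parameters, and the axioms of a Gel'fand-Dorfman bialgebra are the
  coefficients of these polynomials.

  If \<open>\<partial>\<close> acts as \<open>u\<close> on \<open>a\<close> and as \<open>v\<close> on \<open>b\<close>, the \<open>\<lambda>\<close>-bracket becomes
  \<open>M\<^bsub>u,v\<^esub>(a, b) = [a, b] + v (b \<circ> a) - u (a \<circ> b)\<close> (\<open>vpoly_gd_lbr\<close>), and if \<open>\<partial>\<close> acts as \<open>x\<close> and \<open>y\<close> on the
  two tensor factors, the cobracket becomes \<open>D\<^bsub>x,y\<^esub>(a) = \<delta>\<^sub>0(a) + x \<Delta>(a) - y \<tau>\<Delta>(a)\<close> (\<open>\<delta>_vpoly\<close>). Three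
  families of identities remain.

  \<^item> The Jacobi identity for \<open>M\<close> holds because \<open>A\<close> is a Gel'fand-Dorfman algebra (\<open>gd_pair_jacobi\<close>), so
    \<open>R\<close> is a Lie conformal algebra.

  \<^item> Skew-symmetry of \<open>D\<close> is that of \<open>\<delta>\<^sub>0\<close>. The co-Jacobi identity for \<open>D\<close> is a quadratic polynomial in
    three parameters whose coefficients are, up to permuting tensor factors, the axioms of a
    Gel'fand-Dorfman coalgebra (\<open>conf_cojacobi_expand\<close>).

  \<^item> The cocycle condition relates \<open>D\<^bsub>x,y\<^esub>(M\<^bsub>u,v\<^esub>(a, b))\<close> to brackets of \<open>a\<close> with \<open>D(b)\<close> and of \<open>b\<close> with
    \<open>D(a)\<close>, where \<open>x + y = u + v\<close>. It is a quadratic polynomial whose coefficients are the compatibility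
    conditions of a Lie bialgebra, of a Novikov bialgebra and of a Gel'fand-Dorfman bialgebra
    (\<open>conf_cocycle_expand\<close>).

  Tensors are functionals on multilinear forms, so every identity between tensors is verified as
  an identity between scalars, for an arbitrary form.
\<close>

section \<open>Evaluating polynomials with vector coefficients\<close>

text \<open>
  The value of a vector-valued polynomial at a scalar. It is used for all polynomial modules that
  occur, with \<open>s\<close> the scalar multiplication of the coefficient space: for \<open>R = k[\<partial>]A\<close>, where it
  substitutes a number for \<open>\<partial>\<close>, for \<open>R[\<lambda>]\<close> and \<open>R[\<lambda>, \<mu>]\<close>, and for \<open>(R \<otimes> R)[\<lambda>]\<close>.
\<close>
definition vpoly :: "('k::field \<Rightarrow> 'v::ab_group_add \<Rightarrow> 'v) \<Rightarrow> 'k \<Rightarrow> 'v poly \<Rightarrow> 'v" where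
  "vpoly s c p = (\<Sum>i\<le>degree p. s (c ^ i) (coeff p i))"

lemma vector_space_linearI:
  assumes "vector_space s" "vector_space s'"
    and "\<And>x y. f (x + y) = f x + f y" "\<And>c x. f (s c x) = s' c (f x)"
  shows "Vector_Spaces.linear s s' f"
  using assms
  by (simp add: Vector_Spaces.linear_def module_hom_def module_hom_axioms_def module_def vector_space_def)

lemma linear_rules:
  assumes "Vector_Spaces.linear s s' f"
  shows "f (x + y) = f x + f y" "f (s c x) = s' c (f x)" "f 0 = 0" "f (- x) = - f x"
    "f (x - y) = f x - f y" "vector_space s" "vector_space s'"
    "f (sum g I) = (\<Sum>i\<in>I. f (g i))"
proof -
  interpret Vector_Spaces.linear s s' f by fact
  show "f (x + y) = f x + f y" "f (s c x) = s' c (f x)" "f 0 = 0" "f (- x) = - f x"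
    "f (x - y) = f x - f y" "vector_space s" "vector_space s'"
    "f (sum g I) = (\<Sum>i\<in>I. f (g i))"
    by (auto simp: add scale zero neg diff sum vs1.vector_space_axioms vs2.vector_space_axioms)
qed

lemma linear_identity: "vector_space s \<Longrightarrow> Vector_Spaces.linear s s (\<lambda>x. x)"
  by (rule vector_space_linearI) auto

lemma vector_space_field: "vector_space ((*) :: 'k::field \<Rightarrow> 'k \<Rightarrow> 'k)"
  by unfold_locales (auto simp: algebra_simps)

context vector_space begin

lemma vpoly_altdef:
  assumes "degree p \<le> N"
  shows "vpoly scale c p = (\<Sum>i\<le>N. scale (c ^ i) (coeff p i))"
  unfolding vpoly_def using assms
  by (intro sum.mono_neutral_left) (auto simp: coeff_eq_0)

lemma vpoly_0 [simp]: "vpoly scale c 0 = 0"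
  by (simp add: vpoly_def)

lemma vpoly_pCons [simp]: "vpoly scale c (pCons a p) = a + scale c (vpoly scale c p)"
proof -
  have "vpoly scale c (pCons a p) = (\<Sum>i\<le>Suc (degree p). scale (c ^ i) (coeff (pCons a p) i))"
    by (rule vpoly_altdef) (simp add: degree_pCons_le)
  also have "\<dots> = a + scale c (vpoly scale c p)"
    by (subst sum.atMost_Suc_shift) (simp add: vpoly_def scale_sum_right)
  finally show ?thesis .
qed

lemma linear_vpoly: "Vector_Spaces.linear (kdA_scale scale) scale (vpoly scale c)"
proof (rule vector_space_linearI)
  show "vector_space scale" by unfold_locales
  then show "vector_space (kdA_scale scale)" by (rule vector_space_kdA)
  fix p q :: "'b poly" and d
  define N where "N = max (degree p) (degree q)"
  have "degree (p + q) \<le> N" by (simp add: N_def degree_add_le_max)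
  then show "vpoly scale c (p + q) = vpoly scale c p + vpoly scale c q"
    by (simp add: vpoly_altdef[of _ N] N_def scale_right_distrib sum.distrib)
  have "degree (kdA_scale scale d p) \<le> degree p"
    unfolding kdA_scale_def by (rule map_poly_degree_leq)
  then show "vpoly scale c (kdA_scale scale d p) = scale d (vpoly scale c p)"
    by (simp add: vpoly_altdef[of _ "degree p"] kdA_scale_def coeff_map_poly scale_sum_right mult.commute)
qed

lemma vpoly_map_poly:
  assumes f: "Vector_Spaces.linear scale s' f"
  shows "vpoly s' c (map_poly f p) = f (vpoly scale c p)"
proof -
  note lf = linear_rules[OF f]
  interpret s': vector_space s' by (rule lf)
  have "degree (map_poly f p) \<le> degree p" by (rule map_poly_degree_leq)
  then show ?thesis
    by (simp add: s'.vpoly_altdef[of _ "degree p"] vpoly_altdef[of _ "degree p"] coeff_map_poly lf)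
qed

text \<open>
  Substituting an operator \<open>X\<close> for a variable becomes evaluation at a number \<open>c\<close> under any
  additive \<open>\<Phi>\<close> that turns \<open>X\<close> into multiplication by \<open>c\<close>. The set \<open>W\<close> is there because
  operators on tensor products behave well only on the tensors inside the ambient function space.
\<close>
lemma vpoly_subst_var:
  assumes F: "Vector_Spaces.linear scale s' F"
    and \<Phi>: "\<And>v w. \<Phi> (v + w) = \<Phi> v + \<Phi> w" "\<Phi> 0 = 0"
    and X: "\<And>v. v \<in> W \<Longrightarrow> X v \<in> W \<and> \<Phi> (X v) = s' c (\<Phi> v)"
    and \<iota>: "\<And>i. \<iota> (coeff p i) \<in> W \<and> \<Phi> (\<iota> (coeff p i)) = F (coeff p i)"
  shows "\<Phi> (subst_var X \<iota> p) = F (vpoly scale c p)"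
proof -
  note lf = linear_rules[OF F]
  interpret s': vector_space s' by (rule lf)
  have pow: "(X ^^ n) v \<in> W \<and> \<Phi> ((X ^^ n) v) = s' (c ^ n) (\<Phi> v)" if "v \<in> W" for n v
    using that by (induction n) (auto simp: X)
  have sum: "\<Phi> (sum g I) = (\<Sum>i\<in>I. \<Phi> (g i))" if "finite I" for g and I :: "nat set"
    using that by (induction I) (auto simp: \<Phi>)
  show ?thesis
    unfolding subst_var_def vpoly_def by (simp add: sum lf pow \<iota>)
qed

end

lemma scalar_poly_eq_0:
  fixes g :: "nat \<Rightarrow> 'k::field_char_0"
  assumes "\<And>x. (\<Sum>i\<le>N. x ^ i * g i) = 0" and "n \<le> N"
  shows "g n = 0"
proof -
  define p where "p = (\<Sum>i\<le>N. monom (g i) i)"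
  have "poly p x = 0" for x
    using assms(1)[of x] by (simp add: p_def poly_sum poly_monom mult.commute)
  then have "p = 0" using poly_all_0_iff_0[of p] by simp
  then have "coeff p n = 0" by simp
  then show ?thesis using assms(2) by (simp add: p_def coeff_sum)
qed

text \<open>
  Evaluation at \<open>0, 1, -1\<close> suffices because \<open>2\<close> is invertible in characteristic \<open>0\<close>.
\<close>
lemma quadratic_eq_0:
  fixes f0 f1 f2 :: "'k::field_char_0"
  assumes "\<And>t. f0 + t * f1 + t^2 * f2 = 0"
  shows "f0 = 0" "f1 = 0" "f2 = 0"
proof -
  show f0: "f0 = 0" using assms[of 0] by simp
  have 1: "f1 + f2 = 0" using assms[of 1] by (simp add: f0)
  have 2: "f2 - f1 = 0" using assms[of "- 1"] by (simp add: f0)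
  have "2 * f1 = (f1 + f2) - (f2 - f1)" by simp
  then show "f1 = 0" unfolding 1 2 by simp
  then show "f2 = 0" using 1 by simp
qed

lemma linear_monom:
  assumes "vector_space s"
  shows "Vector_Spaces.linear s (kdA_scale s) (\<lambda>a. monom a n)"
proof -
  interpret vector_space s by fact
  show ?thesis
    by (rule vector_space_linearI) (auto simp: assms vector_space_kdA add_monom kdA_scale_def map_poly_monom)
qed

text \<open>
  Separation by evaluation, one argument at a time: a sum of terms, each linear in a polynomial
  \<open>p i\<close>, vanishes as soon as it vanishes after every \<open>p i\<close> is replaced by a monomial whose
  coefficient is the value of \<open>p i\<close> at a number. Indeed the hypothesis for a fixed \<open>n\<close> is a polynomial
  identity in the evaluation point; its coefficient of degree \<open>n\<close> is the contribution of the
  degree \<open>n\<close> parts of the \<open>p i\<close>. Iterating the lemma handles two- and threefold tensors.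
\<close>
lemma slot_separation:
  fixes s :: "'k::field_char_0 \<Rightarrow> 'a::ab_group_add \<Rightarrow> 'a" and H :: "'i \<Rightarrow> 'a poly \<Rightarrow> 'k"
  assumes s: "vector_space s"
    and H: "\<And>i. i \<in> set js \<Longrightarrow> Vector_Spaces.linear (kdA_scale s) (*) (H i)"
    and ev: "\<And>n x. (\<Sum>i\<leftarrow>js. H i (monom (vpoly s x (p i)) n)) = 0"
  shows "(\<Sum>i\<leftarrow>js. H i (p i)) = 0"
proof -
  interpret vector_space s by fact
  obtain N where N: "\<And>i. i \<in> set js \<Longrightarrow> degree (p i) \<le> N"
    using finite_nat_set_iff_bounded_le[of "(\<lambda>i. degree (p i)) ` set js"] by auto
  have coeff0: "(\<Sum>i\<leftarrow>js. H i (monom (coeff (p i) n) n)) = 0" if "n \<le> N" for n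
  proof (rule scalar_poly_eq_0[OF _ that, where g = "\<lambda>m. \<Sum>i\<leftarrow>js. H i (monom (coeff (p i) m) n)"])
    fix x
    have "H i (monom (vpoly s x (p i)) n) = (\<Sum>m\<le>N. x ^ m * H i (monom (coeff (p i) m) n))"
      if "i \<in> set js" for i
      using N[OF that] by (simp add: vpoly_altdef linear_rules[OF linear_comp[OF linear_monom[OF s] H[OF that]]])
    then have "(\<Sum>i\<leftarrow>js. H i (monom (vpoly s x (p i)) n)) =
        (\<Sum>i\<leftarrow>js. \<Sum>m\<le>N. x ^ m * H i (monom (coeff (p i) m) n))"
      by (intro arg_cong[of _ _ sum_list] map_cong) auto
    also have "\<dots> = (\<Sum>m\<le>N. x ^ m * (\<Sum>i\<leftarrow>js. H i (monom (coeff (p i) m) n)))"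
      by (induction js) (auto simp: sum.distrib algebra_simps)
    finally show "(\<Sum>m\<le>N. x ^ m * (\<Sum>i\<leftarrow>js. H i (monom (coeff (p i) m) n))) = 0"
      using ev by simp
  qed
  have "H i (p i) = (\<Sum>n\<le>N. H i (monom (coeff (p i) n) n))" if "i \<in> set js" for i
    using N[OF that]
    by (simp add: linear_rules(8)[OF H[OF that], symmetric] poly_as_sum_of_monoms')
  then have "(\<Sum>i\<leftarrow>js. H i (p i)) = (\<Sum>i\<leftarrow>js. \<Sum>n\<le>N. H i (monom (coeff (p i) n) n))"
    by (intro arg_cong[of _ _ sum_list] map_cong) auto
  also have "\<dots> = (\<Sum>n\<le>N. \<Sum>i\<leftarrow>js. H i (monom (coeff (p i) n) n))"
    by (induction js) (auto simp: sum.distrib algebra_simps)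
  finally show ?thesis using coeff0 by simp
qed

lemma vpoly_separation:
  fixes s :: "'k::field_char_0 \<Rightarrow> 'a::ab_group_add \<Rightarrow> 'a"
  assumes s: "vector_space s" and ev: "\<And>x. vpoly s x p = vpoly s x q"
  shows "p = q"
proof (rule ccontr)
  assume "p \<noteq> q"
  then obtain l where l: "Vector_Spaces.linear (kdA_scale s) (*) l" "l (p - q) \<noteq> 0"
    using separating_functional[OF vector_space_kdA[OF s], of "p - q"] by auto
  have "vpoly s x (p - q) = 0" for x
    using ev[of x] linear_rules(5)[OF vector_space.linear_vpoly[OF s]] by simp
  then have "(\<Sum>i\<leftarrow>[()]. l (p - q)) = 0"
    using l(1)
    by (intro slot_separation[OF s, where H = "\<lambda>_. l" and p = "\<lambda>_. p - q"])
      (simp_all add: linear_rules(3)[OF l(1)])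
  with l(2) show False by simp
qed

section \<open>Tensors as functionals on multilinear forms\<close>

lemma bilinear_rules:
  assumes "bilinear_map s1 s2 s3 f"
  shows "f (x + x') y = f x y + f x' y" "f x (y + y') = f x y + f x y'"
    "f (s1 c x) y = s3 c (f x y)" "f x (s2 c y) = s3 c (f x y)"
    "f (x - x') y = f x y - f x' y" "f x (y - y') = f x y - f x y'"
    "f (- x) y = - f x y" "f x (- y) = - f x y" "f 0 y = 0" "f x 0 = 0"
proof -
  have *: "Vector_Spaces.linear s2 s3 (f x)" "Vector_Spaces.linear s1 s3 (\<lambda>x. f x y)" for x y
    using assms by (auto simp: bilinear_map_def)
  show "f (x + x') y = f x y + f x' y" "f x (y + y') = f x y + f x y'"
    "f (s1 c x) y = s3 c (f x y)" "f x (s2 c y) = s3 c (f x y)"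
    "f (x - x') y = f x y - f x' y" "f x (y - y') = f x y - f x y'"
    "f (- x) y = - f x y" "f x (- y) = - f x y" "f 0 y = 0" "f x 0 = 0"
    by (simp_all add: linear_rules(1-5)[OF *(1)] linear_rules(1-5)[OF *(2)])
qed

lemma bilinearI:
  assumes "vector_space s1" "vector_space s2" "vector_space s3"
    and "\<And>x x' y. f (x + x') y = f x y + f x' y" "\<And>x y y'. f x (y + y') = f x y + f x y'"
    "\<And>c x y. f (s1 c x) y = s3 c (f x y)" "\<And>c x y. f x (s2 c y) = s3 c (f x y)"
  shows "bilinear_map s1 s2 s3 f"
  unfolding bilinear_map_def using assms by (auto intro!: vector_space_linearI)

lemma bilinear_comp:
  assumes "bilinear_map s1 s2 s3 f" "Vector_Spaces.linear t1 s1 g" "Vector_Spaces.linear t2 s2 h"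
  shows "bilinear_map t1 t2 s3 (\<lambda>x y. f (g x) (h y))"
  using assms unfolding bilinear_map_def by (auto intro: linear_comp)

lemma bilinear_swap: "bilinear_map s1 s2 s3 f \<Longrightarrow> bilinear_map s2 s1 s3 (\<lambda>x y. f y x)"
  by (simp add: bilinear_map_def)

lemma linear_bilinear:
  assumes "bilinear_map s1 s2 s3 f" "Vector_Spaces.linear s3 s4 l"
  shows "bilinear_map s1 s2 s4 (\<lambda>x y. l (f x y))"
  using assms unfolding bilinear_map_def by (auto intro: linear_comp)

lemma linear_apply_form: "Vector_Spaces.linear tens_scale (*) (\<lambda>t. t \<phi>)"
  by (rule vector_space_linearI) (auto simp: vector_space_tens vector_space_field tens_scale_def)

lemma tens_space_cases:
  assumes "t \<in> tens_space s"
  obtains ps where "t = (\<Sum>(x, y)\<leftarrow>ps. tens s x y)"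
  using assms by (auto simp: tens_space_def)

lemma zero_in_tens_space: "0 \<in> tens_space s"
  unfolding tens_space_def by (auto intro: exI[of _ "[]"])

lemma tens_in_tens_space: "tens s x y \<in> tens_space s"
  unfolding tens_space_def by (auto intro!: exI[of _ "[(x, y)]"])

lemma add_in_tens_space: "t \<in> tens_space s \<Longrightarrow> u \<in> tens_space s \<Longrightarrow> t + u \<in> tens_space s"
proof (elim tens_space_cases)
  fix ps qs
  assume "t = (\<Sum>(x, y)\<leftarrow>ps. tens s x y)" "u = (\<Sum>(x, y)\<leftarrow>qs. tens s x y)"
  then have "t + u = (\<Sum>(x, y)\<leftarrow>ps @ qs. tens s x y)" by simp
  then show ?thesis unfolding tens_space_def by blast
qed

lemma sum_list_in_tens_space:
  "(\<And>x. x \<in> set xs \<Longrightarrow> f x \<in> tens_space s) \<Longrightarrow> sum_list (map f xs) \<in> tens_space s"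
  by (induction xs) (auto intro: zero_in_tens_space add_in_tens_space)

lemma scale_in_tens_space:
  assumes s: "vector_space s" and "t \<in> tens_space s"
  shows "tens_scale c t \<in> tens_space s"
proof -
  obtain ps where t: "t = (\<Sum>(x, y)\<leftarrow>ps. tens s x y)" using assms(2) by (rule tens_space_cases)
  have "Vector_Spaces.linear tens_scale tens_scale (tens_scale c :: ('b, 'a) tensor2 \<Rightarrow> _)"
    by (intro vector_space_linearI vector_space_tens) (auto simp: tens_scale_def algebra_simps)
  from linear_sum_list[OF this] have "tens_scale c t = (\<Sum>(x, y)\<leftarrow>ps. tens s (s c x) y)"
    unfolding t by (simp add: bilinear_rules(3)[OF tens_bilinear[OF s]] o_def split_def)
  then show ?thesis by (auto intro!: sum_list_in_tens_space tens_in_tens_space)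
qed

lemma uminus_in_tens_space:
  assumes "vector_space s" "t \<in> tens_space s" shows "- t \<in> tens_space s"
proof -
  have "- t = tens_scale (- 1) t" by (auto simp: tens_scale_def)
  then show ?thesis using scale_in_tens_space[OF assms] by simp
qed

lemma diff_in_tens_space:
  assumes "vector_space s" "t \<in> tens_space s" "u \<in> tens_space s" shows "t - u \<in> tens_space s"
  using add_in_tens_space[OF assms(2) uminus_in_tens_space[OF assms(1,3)]] by simp

lemma tens_lift_in_tens_space:
  "(\<And>x y. f x y \<in> tens_space s') \<Longrightarrow> tens_lift s f t \<in> tens_space s'"
  unfolding tens_lift_def by (rule sum_list_in_tens_space) auto

lemma tens_map_in_tens_space: "tens_map s s' f g t \<in> tens_space s'"
  unfolding tens_map_def by (intro tens_lift_in_tens_space tens_in_tens_space)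

lemma tens_flip_in_tens_space: "tens_flip s t \<in> tens_space s"
  unfolding tens_flip_def by (intro tens_lift_in_tens_space tens_in_tens_space)

lemma tens_apply_not_bilinear:
  assumes "t \<in> tens_space s" "\<not> bilinear_map s s (*) \<phi>"
  shows "t \<phi> = 0"
  using assms(1)
proof (rule tens_space_cases)
  fix ps assume t: "t = (\<Sum>(x, y)\<leftarrow>ps. tens s x y)"
  show ?thesis unfolding t sum_list_fun_apply
    by (induction ps) (auto simp: tens_def assms(2))
qed

lemma tens_eqI:
  assumes "t \<in> tens_space s" "u \<in> tens_space s"
    and "\<And>\<phi>. bilinear_map s s (*) \<phi> \<Longrightarrow> t \<phi> = u \<phi>"
  shows "t = u"
proof
  fix \<phi> show "t \<phi> = u \<phi>"
    using assms by (cases "bilinear_map s s (*) \<phi>") (simp_all add: tens_apply_not_bilinear)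
qed

text \<open>
  A tensor is itself evaluation of forms, so composing an induced map with a functional gives
  back an evaluation. Together with the next two lemmas this moves every statement about tensors to
  one about scalars.
\<close>
lemma apply_tens_lift:
  assumes t: "t \<in> tens_space s" and f: "bilinear_map s s sV f" and l: "Vector_Spaces.linear sV (*) l"
  shows "l (tens_lift s f t) = t (\<lambda>x y. l (f x y))"
proof -
  obtain ps where ps: "t = (\<Sum>(x, y)\<leftarrow>ps. tens s x y)" using t by (rule tens_space_cases)
  have "l (tens_lift s f t) = (\<Sum>(x, y)\<leftarrow>ps. l (f x y))"
    unfolding ps tens_lift_sum[OF f] linear_sum_list[OF l] map_map o_def by (simp add: split_def)
  moreover have "t (\<lambda>x y. l (f x y)) = (\<Sum>(x, y)\<leftarrow>ps. l (f x y))"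
    unfolding ps sum_list_fun_apply by (simp add: split_def tens_def linear_bilinear[OF f l])
  ultimately show ?thesis by simp
qed

lemma apply_eq_tens_lift:
  assumes "t \<in> tens_space s" "bilinear_map s s (*) \<phi>"
  shows "t \<phi> = tens_lift s \<phi> t"
  using apply_tens_lift[where l = "\<lambda>x. x", OF assms linear_identity[OF vector_space_field]] by (rule sym)

lemma tens_lift_apply:
  assumes "t \<in> tens_space s" "bilinear_map s s tens_scale f"
  shows "tens_lift s f t \<phi> = t (\<lambda>x y. f x y \<phi>)"
  by (rule apply_tens_lift[where l = "\<lambda>t. t \<phi>", OF assms linear_apply_form])

lemma bilinear_tens_comp:
  assumes "Vector_Spaces.linear s s' f" "Vector_Spaces.linear s s' g"
  shows "bilinear_map s s tens_scale (\<lambda>x y. tens s' (f x) (g y))"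
  by (rule bilinear_comp[OF tens_bilinear assms]) (rule linear_rules(7)[OF assms(1)])

lemma tens_apply: "bilinear_map s s (*) \<phi> \<Longrightarrow> tens s x y \<phi> = \<phi> x y"
  by (simp add: tens_def)

lemma tens_map_apply:
  assumes "t \<in> tens_space s" "Vector_Spaces.linear s s' f" "Vector_Spaces.linear s s' g"
    "bilinear_map s' s' (*) \<phi>"
  shows "tens_map s s' f g t \<phi> = t (\<lambda>x y. \<phi> (f x) (g y))"
  unfolding tens_map_def
  by (simp add: tens_lift_apply[OF assms(1) bilinear_tens_comp[OF assms(2,3)]] tens_apply assms(4))

lemma tens_flip_apply:
  assumes "vector_space s" "t \<in> tens_space s" "bilinear_map s s (*) \<phi>"
  shows "tens_flip s t \<phi> = t (\<lambda>x y. \<phi> y x)"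
  unfolding tens_flip_def
  by (simp add: tens_lift_apply[OF assms(2) bilinear_swap[OF tens_bilinear[OF assms(1)]]]
      tens_apply assms(3))

text \<open>
  For scalar-valued \<open>f\<close>, \<open>tens_lift s f t\<close> equals \<open>t f\<close> when \<open>f\<close> is bilinear, but it is
  a sum over a chosen representation of \<open>t\<close> and hence linear in \<open>f\<close> without any hypothesis on \<open>f\<close>.
  Large expressions can therefore be expanded by rewriting alone, and this is the form in which
  the identities below are stated.
\<close>
lemma tens_lift_add: "tens_lift s (\<lambda>x y. f x y + g x y) t = tens_lift s f t + tens_lift s g t"
  unfolding tens_lift_def by (simp add: split_def sum_list_addf)

lemma tens_lift_linear_out:
  assumes "Vector_Spaces.linear sV sW l"
  shows "tens_lift s (\<lambda>x y. l (f x y)) t = l (tens_lift s f t)"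
  unfolding tens_lift_def linear_sum_list[OF assms] by (simp add: split_def o_def)

lemma linear_scale_by:
  assumes "vector_space s" shows "Vector_Spaces.linear s s (s c)"
proof -
  interpret vector_space s by fact
  show ?thesis by (intro vector_space_linearI assms scale_right_distrib scale_left_commute)
qed

lemma tens_lift_mult: "tens_lift s (\<lambda>x y. c * f x y) t = c * tens_lift s f t"
  for c :: "'k::field"
  by (rule tens_lift_linear_out[OF linear_scale_by[OF vector_space_field]])

lemma tens_lift_uminus: "tens_lift s (\<lambda>x y. - f x y) t = - tens_lift s f t"
  for f :: "_ \<Rightarrow> _ \<Rightarrow> 'k::field"
  using tens_lift_mult[of s "- 1" f t] by simp

lemma tens_lift_diff: "tens_lift s (\<lambda>x y. f x y - g x y) t = tens_lift s f t - tens_lift s g t"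
  for f :: "_ \<Rightarrow> _ \<Rightarrow> 'k::field"
  using tens_lift_add[of s f "\<lambda>x y. - g x y" t] by (simp add: tens_lift_uminus)

lemmas tens_lift_distribs = tens_lift_add tens_lift_diff tens_lift_uminus tens_lift_mult

lemma tens_lift_add_tensor:
  assumes f: "bilinear_map s s sV f" and "t \<in> tens_space s" "u \<in> tens_space s"
  shows "tens_lift s f (t + u) = tens_lift s f t + tens_lift s f u"
  using assms(2,3)
proof (elim tens_space_cases)
  fix ps qs
  assume t: "t = (\<Sum>(x, y)\<leftarrow>ps. tens s x y)" and u: "u = (\<Sum>(x, y)\<leftarrow>qs. tens s x y)"
  have "t + u = (\<Sum>(x, y)\<leftarrow>ps @ qs. tens s x y)" by (simp add: t u)
  then show ?thesis by (simp add: t u tens_lift_sum[OF f] del: map_append) simp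
qed

lemma tens_lift_scale_tensor:
  assumes f: "bilinear_map s s sV f" and t: "t \<in> tens_space s"
  shows "tens_lift s f (tens_scale c t) = sV c (tens_lift s f t)"
proof -
  obtain ps where ps: "t = (\<Sum>(x, y)\<leftarrow>ps. tens s x y)" using t by (rule tens_space_cases)
  have s: "vector_space s" and sV: "vector_space sV"
    using f by (auto simp: bilinear_map_def Vector_Spaces.linear_def)
  let ?qs = "map (\<lambda>(x, y). (s c x, y)) ps"
  have "tens_scale c t = (\<Sum>(x, y)\<leftarrow>?qs. tens s x y)"
    unfolding ps linear_sum_list[OF linear_scale_by[OF vector_space_tens]]
    by (simp add: bilinear_rules(3)[OF tens_bilinear[OF s]] o_def split_def)
  moreover have "sV c (tens_lift s f t) = (\<Sum>(x, y)\<leftarrow>?qs. f x y)"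
    unfolding ps tens_lift_sum[OF f] linear_sum_list[OF linear_scale_by[OF sV]]
    by (simp add: bilinear_rules(3)[OF f] o_def split_def)
  ultimately show ?thesis by (simp only: tens_lift_sum[OF f])
qed

lemma linear_tens_lift_cop:
  assumes D: "Vector_Spaces.linear s tens_scale D" "\<And>a. D a \<in> tens_space s"
    and f: "bilinear_map s s sV f"
  shows "Vector_Spaces.linear s sV (\<lambda>a. tens_lift s f (D a))"
  using linear_rules[OF D(1)] f
  by (intro vector_space_linearI) (auto simp: D(2) tens_lift_add_tensor[OF f] tens_lift_scale_tensor[OF f]
      bilinear_map_def Vector_Spaces.linear_def)

lemma trilinear_slice:
  assumes "trilinear_map s sV f"
  shows "bilinear_map s s sV (f x)" "bilinear_map s s sV (\<lambda>u v. f u x v)"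
    "bilinear_map s s sV (\<lambda>u v. f u v x)"
  using assms by (auto simp: trilinear_map_def bilinear_map_def)

lemma trilinear_swap12: "trilinear_map s sV f \<Longrightarrow> trilinear_map s sV (\<lambda>x y z. f y x z)"
  by (auto simp: trilinear_map_def)

lemma trilinear_swap23: "trilinear_map s sV f \<Longrightarrow> trilinear_map s sV (\<lambda>x y z. f x z y)"
  by (auto simp: trilinear_map_def)

lemma trilinear_swap13: "trilinear_map s sV f \<Longrightarrow> trilinear_map s sV (\<lambda>x y z. f z y x)"
  by (auto simp: trilinear_map_def)

lemma trilinear_comp:
  assumes "trilinear_map s sV f" "Vector_Spaces.linear t s g" "Vector_Spaces.linear t s h"
    "Vector_Spaces.linear t s k"
  shows "trilinear_map t sV (\<lambda>x y z. f (g x) (h y) (k z))"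
  unfolding trilinear_map_def
proof (intro conjI allI)
  show "Vector_Spaces.linear t sV (\<lambda>z. f (g x) (h y) (k z))" for x y
    using linear_comp[OF assms(4), of sV "f (g x) (h y)"] assms(1) by (simp add: trilinear_map_def)
  show "Vector_Spaces.linear t sV (\<lambda>y. f (g x) (h y) (k z))" for x z
    using linear_comp[OF assms(3), of sV "\<lambda>y. f (g x) y (k z)"] assms(1)
    by (simp add: trilinear_map_def)
  show "Vector_Spaces.linear t sV (\<lambda>x. f (g x) (h y) (k z))" for y z
    using linear_comp[OF assms(2), of sV "\<lambda>x. f x (h y) (k z)"] assms(1)
    by (simp add: trilinear_map_def)
qed

lemma trilinear_rules:
  assumes "trilinear_map s sV f"
  shows "f (x + x') y z = f x y z + f x' y z" "f x (y + y') z = f x y z + f x y' z"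
    "f x y (z + z') = f x y z + f x y z'" "f (s c x) y z = sV c (f x y z)"
    "f x (s c y) z = sV c (f x y z)" "f x y (s c z) = sV c (f x y z)"
proof -
  have *: "Vector_Spaces.linear s sV (f x y)" "Vector_Spaces.linear s sV (\<lambda>y. f x y z)"
    "Vector_Spaces.linear s sV (\<lambda>x. f x y z)" for x y z
    using assms by (auto simp: trilinear_map_def)
  show "f (x + x') y z = f x y z + f x' y z" "f x (y + y') z = f x y z + f x y' z"
    "f x y (z + z') = f x y z + f x y z'" "f (s c x) y z = sV c (f x y z)"
    "f x (s c y) z = sV c (f x y z)" "f x y (s c z) = sV c (f x y z)"
    by (simp_all add: linear_rules(1-2)[OF *(1)] linear_rules(1-2)[OF *(2)] linear_rules(1-2)[OF *(3)])
qed

lemma trilinear_tens3: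
  assumes s: "vector_space s"
  shows "trilinear_map s tens_scale (tens3 s)"
  unfolding trilinear_map_def
  by (intro conjI allI vector_space_linearI s vector_space_tens)
    (auto simp: fun_eq_iff tens3_def tens_scale_def trilinear_rules)

definition tens3_space ::
  "('k::field \<Rightarrow> 'a::ab_group_add \<Rightarrow> 'a) \<Rightarrow> ('a, 'k) tensor3 set" where
  "tens3_space s = {t. \<exists>ps. t = (\<Sum>(x, y, z)\<leftarrow>ps. tens3 s x y z)}"

lemma tens3_space_cases:
  assumes "t \<in> tens3_space s"
  obtains ps where "t = (\<Sum>(x, y, z)\<leftarrow>ps. tens3 s x y z)"
  using assms by (auto simp: tens3_space_def)

lemma tens3_in_tens3_space: "tens3 s x y z \<in> tens3_space s"
  unfolding tens3_space_def by (auto intro!: exI[of _ "[(x, y, z)]"])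

lemma add_in_tens3_space: "t \<in> tens3_space s \<Longrightarrow> u \<in> tens3_space s \<Longrightarrow> t + u \<in> tens3_space s"
proof (elim tens3_space_cases)
  fix ps qs
  assume "t = (\<Sum>(x, y, z)\<leftarrow>ps. tens3 s x y z)" "u = (\<Sum>(x, y, z)\<leftarrow>qs. tens3 s x y z)"
  then have "t + u = (\<Sum>(x, y, z)\<leftarrow>ps @ qs. tens3 s x y z)" by simp
  then show ?thesis unfolding tens3_space_def by blast
qed

lemma sum_list_in_tens3_space:
  "(\<And>x. x \<in> set xs \<Longrightarrow> f x \<in> tens3_space s) \<Longrightarrow> sum_list (map f xs) \<in> tens3_space s"
proof (induction xs)
  case Nil
  have "(0 :: ('b, 'c) tensor3) = (\<Sum>(x, y, z)\<leftarrow>[]. tens3 s x y z)" by simp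
  then show ?case unfolding tens3_space_def by (metis (mono_tags) list.map(1) mem_Collect_eq)
qed (auto intro: add_in_tens3_space)

lemma diff_in_tens3_space:
  assumes s: "vector_space s" and t: "t \<in> tens3_space s" and u: "u \<in> tens3_space s"
  shows "t - u \<in> tens3_space s"
proof -
  obtain ps where u: "u = (\<Sum>(x, y, z)\<leftarrow>ps. tens3 s x y z)" using u by (rule tens3_space_cases)
  have "tens3 s (- x) y z = - tens3 s x y z" for x y z
    using linear_rules(4)[of s tens_scale "\<lambda>x. tens3 s x y z" x] trilinear_tens3[OF s]
    by (simp add: trilinear_map_def)
  then have "- u = (\<Sum>(x, y, z)\<leftarrow>ps. tens3 s (- x) y z)"
    unfolding u by (simp add: uminus_sum_list_map o_def split_def)
  then have "- u \<in> tens3_space s"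
    by (auto intro!: sum_list_in_tens3_space tens3_in_tens3_space)
  from add_in_tens3_space[OF t this] show ?thesis by simp
qed

lemma tens_lift_in_tens3_space:
  "(\<And>x y. f x y \<in> tens3_space s) \<Longrightarrow> tens_lift s' f t \<in> tens3_space s"
  unfolding tens_lift_def by (rule sum_list_in_tens3_space) auto

lemma id_tens_cop_in_tens3_space: "id_tens_cop s D t \<in> tens3_space s"
  unfolding id_tens_cop_def by (intro tens_lift_in_tens3_space tens3_in_tens3_space)

lemma cop_tens_id_in_tens3_space: "cop_tens_id s D t \<in> tens3_space s"
  unfolding cop_tens_id_def by (intro tens_lift_in_tens3_space tens3_in_tens3_space)

lemma flip_tens_id_in_tens3_space: "flip_tens_id s t \<in> tens3_space s"
  unfolding flip_tens_id_def tens3_lift_def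
  by (rule sum_list_in_tens3_space) (auto intro: tens3_in_tens3_space)

lemmas in_tens3_space = id_tens_cop_in_tens3_space cop_tens_id_in_tens3_space
  flip_tens_id_in_tens3_space add_in_tens3_space diff_in_tens3_space

lemma tens3_sum_apply:
  assumes "trilinear_map s (*) \<Phi>"
  shows "(\<Sum>(x, y, z)\<leftarrow>ps. tens3 s x y z) \<Phi> = (\<Sum>(x, y, z)\<leftarrow>ps. \<Phi> x y z)"
  unfolding sum_list_fun_apply by (simp add: split_def tens3_def assms)

lemma tens_sum_apply:
  assumes "bilinear_map s s (*) \<phi>"
  shows "(\<Sum>(x, y)\<leftarrow>ps. tens s x y) \<phi> = (\<Sum>(x, y)\<leftarrow>ps. \<phi> x y)"
  unfolding sum_list_fun_apply by (simp add: split_def tens_def assms)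

lemma tens3_apply_not_trilinear:
  assumes "t \<in> tens3_space s" "\<not> trilinear_map s (*) \<Phi>"
  shows "t \<Phi> = 0"
  using assms(1)
proof (rule tens3_space_cases)
  fix ps assume t: "t = (\<Sum>(x, y, z)\<leftarrow>ps. tens3 s x y z)"
  show ?thesis unfolding t sum_list_fun_apply
    by (induction ps) (auto simp: tens3_def assms(2))
qed

lemma tens3_eqI:
  assumes "t \<in> tens3_space s" "u \<in> tens3_space s"
    and "\<And>\<Phi>. trilinear_map s (*) \<Phi> \<Longrightarrow> t \<Phi> = u \<Phi>"
  shows "t = u"
proof
  fix \<Phi> show "t \<Phi> = u \<Phi>"
    using assms by (cases "trilinear_map s (*) \<Phi>") (simp_all add: tens3_apply_not_trilinear)
qed

text \<open>
  The forms through which \<open>(id \<otimes> D) t\<close> and \<open>(D \<otimes> id) t\<close> are evaluated; bilinearity is what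
  allows nested evaluations to be read as evaluations of \<open>t\<close>.
\<close>
lemma bilinear_nested:
  assumes D: "Vector_Spaces.linear s tens_scale D" "\<And>a. D a \<in> tens_space s"
    and f: "trilinear_map s sV f"
  shows "bilinear_map s s sV (\<lambda>x y. tens_lift s (f x) (D y))"
proof -
  have l: "Vector_Spaces.linear s sV (\<lambda>x. f x u v)" for u v
    using f by (simp add: trilinear_map_def)
  note sp = linear_rules(6,7)[OF l]
  have "Vector_Spaces.linear s sV (\<lambda>x. tens_lift s (\<lambda>u v. f x u v) t)" for t
    by (rule vector_space_linearI[OF sp])
      (simp_all add: linear_rules(1,2)[OF l] tens_lift_add tens_lift_linear_out[OF linear_scale_by[OF sp(2)]])
  then show ?thesis
    using linear_tens_lift_cop[OF D trilinear_slice(1)[OF f]] by (simp add: bilinear_map_def)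
qed

lemma bilinear_nested':
  assumes D: "Vector_Spaces.linear s tens_scale D" "\<And>a. D a \<in> tens_space s"
    and f: "trilinear_map s sV f"
  shows "bilinear_map s s sV (\<lambda>x y. tens_lift s (\<lambda>u v. f u v y) (D x))"
  by (rule bilinear_swap[OF bilinear_nested[OF D trilinear_swap12[OF trilinear_swap23[OF f]]]])

lemma tens_lift_apply_tensor3:
  fixes s :: "'k::field \<Rightarrow> 'a::ab_group_add \<Rightarrow> 'a"
  assumes s: "vector_space s" and t: "t \<in> tens_space s"
    and D: "Vector_Spaces.linear s tens_scale D" "\<And>a. D a \<in> tens_space s"
    and \<Phi>: "trilinear_map s (*) \<Phi>"
  shows "id_tens_cop s D t \<Phi> = t (\<lambda>x y. D y (\<Phi> x))"
    and "cop_tens_id s D t \<Phi> = t (\<lambda>x y. D x (\<lambda>u v. \<Phi> u v y))"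
proof -
  note tri = trilinear_tens3[OF s]
  note b1 = bilinear_nested[OF D tri] and b2 = bilinear_nested'[OF D tri]
  have ev: "tens3 s x y z \<Phi> = \<Phi> x y z" for x y z
    by (simp add: tens3_def \<Phi>)
  show "id_tens_cop s D t \<Phi> = t (\<lambda>x y. D y (\<Phi> x))"
    unfolding id_tens_cop_def tens_lift_apply[OF t b1]
    by (simp add: tens_lift_apply[OF D(2) trilinear_slice(1)[OF tri]] ev)
  show "cop_tens_id s D t \<Phi> = t (\<lambda>x y. D x (\<lambda>u v. \<Phi> u v y))"
    unfolding cop_tens_id_def tens_lift_apply[OF t b2]
    by (simp add: tens_lift_apply[OF D(2) trilinear_slice(3)[OF tri]] ev)
qed

lemma tens_lift_eq_tensor3:
  fixes s :: "'k::field \<Rightarrow> 'a::ab_group_add \<Rightarrow> 'a"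
  assumes s: "vector_space s" and t: "t \<in> tens_space s"
    and D: "Vector_Spaces.linear s tens_scale D" "\<And>a. D a \<in> tens_space s"
    and \<Phi>: "trilinear_map s (*) \<Phi>"
  shows "id_tens_cop s D t \<Phi> = tens_lift s (\<lambda>x y. tens_lift s (\<Phi> x) (D y)) t"
    and "cop_tens_id s D t \<Phi> = tens_lift s (\<lambda>x y. tens_lift s (\<lambda>u v. \<Phi> u v y) (D x)) t"
  by (simp_all add: tens_lift_apply_tensor3[OF assms] apply_eq_tens_lift[OF D(2)]
      trilinear_slice[OF \<Phi>] apply_eq_tens_lift[OF t] bilinear_nested[OF D \<Phi>] bilinear_nested'[OF D \<Phi>])

lemma flip_tens_id_apply:
  assumes s: "vector_space s" and t: "t \<in> tens3_space s" and \<Phi>: "trilinear_map s (*) \<Phi>"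
  shows "flip_tens_id s t \<Phi> = t (\<lambda>x y z. \<Phi> y x z)"
proof -
  obtain ps where ps: "t = (\<Sum>(x, y, z)\<leftarrow>ps. tens3 s x y z)" using t by (rule tens3_space_cases)
  show ?thesis
    unfolding flip_tens_id_def ps tens3_lift_sum[OF trilinear_swap12[OF trilinear_tens3[OF s]]]
      tens3_sum_apply[OF trilinear_swap12[OF \<Phi>]] sum_list_fun_apply
    by (simp add: split_def tens3_def \<Phi> trilinear_swap12[OF \<Phi>])
qed

section \<open>Separating tensors over \<open>k[\<partial>]A\<close> by evaluation\<close>

text \<open>
  \<open>R \<otimes> R\<close> is \<open>(A \<otimes> A)[x, y]\<close> with \<open>x = \<partial> \<otimes> id\<close> and \<open>y = id \<otimes> \<partial>\<close>; testing on the forms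
  below means evaluating \<open>x\<close> and \<open>y\<close> at numbers and pairing the resulting element of \<open>A \<otimes> A\<close>
  with \<open>\<phi>\<close>.
\<close>
lemma tens_eq_vpolyI:
  fixes s :: "'k::field_char_0 \<Rightarrow> 'a::ab_group_add \<Rightarrow> 'a"
  assumes s: "vector_space s"
    and t: "t \<in> tens_space (kdA_scale s)" and u: "u \<in> tens_space (kdA_scale s)"
    and ev: "\<And>\<phi> x y. bilinear_map s s (*) \<phi> \<Longrightarrow>
      t (\<lambda>p q. \<phi> (vpoly s x p) (vpoly s y q)) = u (\<lambda>p q. \<phi> (vpoly s x p) (vpoly s y q))"
  shows "t = u"
proof (rule tens_eqI[OF t u])
  fix \<psi> assume \<psi>: "bilinear_map (kdA_scale s) (kdA_scale s) (*) \<psi>"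
  note lin = vector_space.linear_vpoly[OF s]
  obtain ps where ps: "t - u = (\<Sum>(p, q)\<leftarrow>ps. tens (kdA_scale s) p q)"
    using diff_in_tens_space[OF vector_space_kdA[OF s] t u] by (rule tens_space_cases)
  have lin1: "Vector_Spaces.linear (kdA_scale s) (*) (\<psi> p)"
    and lin2: "Vector_Spaces.linear (kdA_scale s) (*) (\<lambda>p. \<psi> p q)" for p q
    using \<psi> by (auto simp: bilinear_map_def)
  \<comment> \<open>By hypothesis the sum vanishes with both arguments evaluated; they are restored one at a time.\<close>
  have 2: "(\<Sum>i\<leftarrow>ps. \<psi> (monom (vpoly s x (fst i)) n) (monom (vpoly s y (snd i)) m)) = 0" for x y n m
  proof -
    have b: "bilinear_map s s (*) (\<lambda>a b. \<psi> (monom a n) (monom b m))"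
      by (rule bilinear_comp[OF \<psi> linear_monom[OF s] linear_monom[OF s]])
    from ev[OF this, of x y] have
      "(t - u) (\<lambda>p q. \<psi> (monom (vpoly s x p) n) (monom (vpoly s y q) m)) = 0" by simp
    moreover have "bilinear_map (kdA_scale s) (kdA_scale s) (*)
        (\<lambda>p q. \<psi> (monom (vpoly s x p) n) (monom (vpoly s y q) m))"
      using bilinear_comp[OF b lin lin] .
    ultimately show ?thesis
      unfolding ps by (subst (asm) tens_sum_apply) (auto simp: split_def)
  qed
  have 1: "(\<Sum>i\<leftarrow>ps. \<psi> (monom (vpoly s x (fst i)) n) (snd i)) = 0" for x n
    by (rule slot_separation[where p = snd and H = "\<lambda>i. \<psi> (monom (vpoly s x (fst i)) n)", OF s lin1 2])
  have "(\<Sum>i\<leftarrow>ps. \<psi> (fst i) (snd i)) = 0"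
    by (rule slot_separation[where p = fst and H = "\<lambda>i r. \<psi> r (snd i)", OF s lin2 1])
  then have "(t - u) \<psi> = 0" unfolding ps tens_sum_apply[OF \<psi>] by (simp add: split_def)
  then show "t \<psi> = u \<psi>" by simp
qed

lemma tens3_eq_vpolyI:
  fixes s :: "'k::field_char_0 \<Rightarrow> 'a::ab_group_add \<Rightarrow> 'a"
  assumes s: "vector_space s"
    and t: "t \<in> tens3_space (kdA_scale s)" and u: "u \<in> tens3_space (kdA_scale s)"
    and ev: "\<And>\<Phi> x y z. trilinear_map s (*) \<Phi> \<Longrightarrow>
      t (\<lambda>p q r. \<Phi> (vpoly s x p) (vpoly s y q) (vpoly s z r)) =
      u (\<lambda>p q r. \<Phi> (vpoly s x p) (vpoly s y q) (vpoly s z r))"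
  shows "t = u"
proof (rule tens3_eqI[OF t u])
  fix \<Psi> assume \<Psi>: "trilinear_map (kdA_scale s) (*) \<Psi>"
  note lin = vector_space.linear_vpoly[OF s]
  obtain ps where ps: "t - u = (\<Sum>(p, q, r)\<leftarrow>ps. tens3 (kdA_scale s) p q r)"
    using diff_in_tens3_space[OF vector_space_kdA[OF s] t u] by (rule tens3_space_cases)
  have lin1: "Vector_Spaces.linear (kdA_scale s) (*) (\<Psi> p q)"
    and lin2: "Vector_Spaces.linear (kdA_scale s) (*) (\<lambda>q. \<Psi> p q r)"
    and lin3: "Vector_Spaces.linear (kdA_scale s) (*) (\<lambda>p. \<Psi> p q r)" for p q r
    using \<Psi> by (auto simp: trilinear_map_def)
  \<comment> \<open>As for two factors, with three arguments to restore.\<close>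
  have 3: "(\<Sum>i\<leftarrow>ps. \<Psi> (monom (vpoly s x (fst i)) n) (monom (vpoly s y (fst (snd i))) m)
      (monom (vpoly s z (snd (snd i))) l)) = 0" for x y z n m l
  proof -
    have b: "trilinear_map s (*) (\<lambda>a b c. \<Psi> (monom a n) (monom b m) (monom c l))"
      by (rule trilinear_comp[OF \<Psi> linear_monom[OF s] linear_monom[OF s] linear_monom[OF s]])
    from ev[OF this, of x y z] have "(t - u) (\<lambda>p q r. \<Psi> (monom (vpoly s x p) n)
        (monom (vpoly s y q) m) (monom (vpoly s z r) l)) = 0" by simp
    moreover have "trilinear_map (kdA_scale s) (*) (\<lambda>p q r. \<Psi> (monom (vpoly s x p) n)
        (monom (vpoly s y q) m) (monom (vpoly s z r) l))"
      using trilinear_comp[OF b lin lin lin] .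
    ultimately show ?thesis
      unfolding ps by (subst (asm) tens3_sum_apply) (auto simp: split_def)
  qed
  have 2: "(\<Sum>i\<leftarrow>ps. \<Psi> (monom (vpoly s x (fst i)) n) (monom (vpoly s y (fst (snd i))) m)
      (snd (snd i))) = 0" for x y n m
    by (rule slot_separation[where p = "\<lambda>i. snd (snd i)" and H = "\<lambda>i. \<Psi> (monom (vpoly s x (fst i)) n)
          (monom (vpoly s y (fst (snd i))) m)", OF s lin1 3])
  have 1: "(\<Sum>i\<leftarrow>ps. \<Psi> (monom (vpoly s x (fst i)) n) (fst (snd i)) (snd (snd i))) = 0" for x n
    by (rule slot_separation[where p = "\<lambda>i. fst (snd i)" and
          H = "\<lambda>i q. \<Psi> (monom (vpoly s x (fst i)) n) q (snd (snd i))", OF s lin2 2])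
  have "(\<Sum>i\<leftarrow>ps. \<Psi> (fst i) (fst (snd i)) (snd (snd i))) = 0"
    by (rule slot_separation[where p = fst and H = "\<lambda>i p. \<Psi> p (fst (snd i)) (snd (snd i))",
          OF s lin3 1])
  then have "(t - u) \<Psi> = 0" unfolding ps tens3_sum_apply[OF \<Psi>] by (simp add: split_def)
  then show "t \<Psi> = u \<Psi>" by simp
qed

section \<open>The Lie conformal algebra of a Gel'fand-Dorfman algebra\<close>

context gd_algebra begin

abbreviation vR :: "'k \<Rightarrow> 'a poly \<Rightarrow> 'a poly" where "vR \<equiv> kdA_scale s"

lemma vector_space_s: "vector_space s" ..
lemma vector_space_vR: "vector_space vR" by (rule vector_space_kdA[OF vector_space_s])

text \<open>
  The \<open>\<lambda>\<close>-bracket of \<open>a\<close> and \<open>b\<close> when \<open>\<partial>\<close> acts on \<open>a\<close> as \<open>u\<close> and on \<open>b\<close> as \<open>v\<close>: then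
  \<open>\<lambda> = -u\<close>, the bracket has \<open>\<partial> = u + v\<close>, and \<open>\<partial>(b \<circ> a) + \<lambda>(a \<star> b) + [a, b]\<close> becomes the
  expression below. In these variables skew-symmetry and the Jacobi identity look as for an
  ordinary Lie bracket.
\<close>
definition gd_pair :: "'k \<Rightarrow> 'k \<Rightarrow> 'a \<Rightarrow> 'a \<Rightarrow> 'a" where
  "gd_pair u v a b = br a b + s v (b \<odot> a) - s u (a \<odot> b)"

lemmas circ_rules = bilinear_rules[OF circ_bilinear]
lemmas br_rules = bilinear_rules[OF br_bilinear]

lemma br_skew: "br a b = - br b a"
proof -
  have "br (a + b) (a + b) = 0" by (rule br_alternating)
  then have "br a b + br b a = 0" unfolding br_rules unfolding br_alternating by (simp add: add.commute)
  then show ?thesis by (rule eq_neg_iff_add_eq_0[THEN iffD2])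
qed

lemma bilinear_gd_pair: "bilinear_map s s s (gd_pair u v)"
  by (rule bilinearI)
    (simp_all add: vector_space_s gd_pair_def circ_rules br_rules scale_right_distrib
      scale_right_diff_distrib mult.commute)

lemma gd_pair_skew: "gd_pair u v a b = - gd_pair v u b a"
  unfolding gd_pair_def by (subst br_skew) simp

text \<open>
  Both sides are quadratic polynomials in \<open>u, v, w\<close>. The constant coefficient is the Jacobi
  identity, the linear coefficients are the compatibility of \<open>\<circ>\<close> with the Lie bracket, the squares
  \<open>u\<^sup>2, v\<^sup>2, w\<^sup>2\<close> are right commutativity, and the mixed terms are left symmetry.
\<close>
lemma gd_pair_jacobi:
  "gd_pair u (v + w) a (gd_pair v w b c) =
   gd_pair (u + v) w (gd_pair u v a b) c + gd_pair v (u + w) b (gd_pair u w a c)"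
proof -
  \<comment> \<open>The axioms are oriented as rewrite rules to a common normal form.\<close>
  have br: "br c b = - br b c" "br c a = - br a c" "br b a = - br a b"
    "br (c \<odot> b) a = - br a (c \<odot> b)" "br (c \<odot> a) b = - br b (c \<odot> a)"
    "br (b \<odot> c) a = - br a (b \<odot> c)" "br (a \<odot> c) b = - br b (a \<odot> c)"
    by (rule br_skew)+
  have rc: "(c \<odot> b) \<odot> a = (c \<odot> a) \<odot> b" "(b \<odot> c) \<odot> a = (b \<odot> a) \<odot> c" "(a \<odot> c) \<odot> b = (a \<odot> b) \<odot> c"
    by (rule right_commutative)+
  have ls: "a \<odot> (c \<odot> b) = c \<odot> (a \<odot> b) - (c \<odot> a) \<odot> b + (a \<odot> b) \<odot> c"
    "c \<odot> (b \<odot> a) = b \<odot> (c \<odot> a) + (c \<odot> a) \<odot> b - (b \<odot> a) \<odot> c"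
    "a \<odot> (b \<odot> c) = b \<odot> (a \<odot> c) + (a \<odot> b) \<odot> c - (b \<odot> a) \<odot> c"
    using left_symmetric[of a c b] left_symmetric[of c b a] left_symmetric[of a b c]
    by (simp_all add: rc algebra_simps)
  have gd: "br a (c \<odot> b) = br b (c \<odot> a) - br b c \<odot> a + br a c \<odot> b + c \<odot> br a b"
    "br a (b \<odot> c) = - br (b \<odot> a) c + br b c \<odot> a + br a b \<odot> c + b \<odot> br a c"
    "br (a \<odot> b) c = - br b (a \<odot> c) - br a b \<odot> c + br a c \<odot> b + a \<odot> br b c"
    using gd_compat[of c b a] gd_compat[of b c a] gd_compat[of a b c]
    by (simp_all add: br circ_rules algebra_simps)
  have jac: "br a (br b c) = br (br a b) c + br b (br a c)"
    using br_jacobi[of a b c] br_skew[of "br a b" c]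
    by (simp add: br br_rules algebra_simps)
  show ?thesis
    unfolding gd_pair_def
    by (simp add: circ_rules br_rules scale_right_distrib scale_right_diff_distrib
        scale_left_distrib rc ls gd jac algebra_simps)
qed

lemma linear_vpoly2: "Vector_Spaces.linear (kdA_scale vR) s (\<lambda>w. vpoly s x (vpoly vR l w))"
  by (rule linear_comp[OF vector_space.linear_vpoly[OF vector_space_vR] linear_vpoly])

lemma linear_const: "Vector_Spaces.linear s vR kdA_const"
  using linear_monom[OF vector_space_s, of 0] by (simp add: monom_0 kdA_const_def[abs_def])

lemma linear_del: "Vector_Spaces.linear vR vR kdA_del"
  by (rule vector_space_linearI) (simp_all add: vector_space_vR kdA_del_def kdA_scale_def map_poly_pCons)

lemma vpoly_del: "vpoly s x (kdA_del p) = s x (vpoly s x p)"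
  by (simp add: kdA_del_def)

lemma vpoly_const: "vpoly s x (kdA_const a) = a"
  by (simp add: kdA_const_def)

lemma vpoly_map_del: "vpoly s x (vpoly vR l (map_poly kdA_del w)) = s x (vpoly s x (vpoly vR l w))"
  by (simp add: vector_space.vpoly_map_poly[OF vector_space_vR linear_del] vpoly_del)

lemma vpoly_pCons_0: "vpoly s x (vpoly vR l (pCons 0 w)) = s l (vpoly s x (vpoly vR l w))"
  by (simp add: vector_space.vpoly_pCons[OF vector_space_vR] linear_rules[OF linear_vpoly])

lemma vpoly_gd_lbr:
  "vpoly s x (vpoly vR l (gd_lbr circ br p q)) =
   gd_pair (- l) (x + l) (vpoly s (- l) p) (vpoly s (x + l) q)"
proof -
  let ?E = "\<lambda>w. vpoly s x (vpoly vR l w)"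
  note lin = linear_rules[OF linear_vpoly2]
  have 1: "?E (((\<lambda>w. - pCons 0 w) ^^ i) w) = s ((- l) ^ i) (?E w)" for i w
    by (induction i) (simp_all add: lin vpoly_pCons_0)
  have 2: "?E (((\<lambda>w. pCons 0 w + map_poly kdA_del w) ^^ i) w) = s ((x + l) ^ i) (?E w)" for i w
    by (induction i) (simp_all add: lin vpoly_pCons_0 vpoly_map_del scale_left_distrib algebra_simps)
  have 3: "?E (gd_lbr_base circ br a b) = gd_pair (- l) (x + l) a b" for a b
    by (simp add: gd_lbr_base_def vector_space.vpoly_pCons[OF vector_space_vR]
        vector_space.vpoly_0[OF vector_space_vR] linear_rules[OF linear_vpoly] vpoly_del vpoly_const
        gd_pair_def algebra_simps)
  have l1: "Vector_Spaces.linear s s (\<lambda>a. gd_pair u v a b)"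
    and l2: "Vector_Spaces.linear s s (gd_pair u v a)" for u v a b
    using bilinear_gd_pair by (auto simp: bilinear_map_def)
  show ?thesis
    unfolding gd_lbr_def vpoly_def[of s "- l"] vpoly_def[of s "x + l" q]
    by (subst sum.swap)
      (simp add: lin 1 2 3 linear_rules(2,8)[OF l1] linear_rules(2,8)[OF l2] scale_sum_right
        mult.commute del: minus_pCons)
qed

lemma vpoly2_eqI:
  assumes "\<And>x l. vpoly s x (vpoly vR l p) = vpoly s x (vpoly vR l q)"
  shows "p = q"
  by (rule vpoly_separation[OF vector_space_vR], rule vpoly_separation[OF vector_space_s]) (rule assms)

lemma vpoly3_eqI:
  assumes "\<And>x l m. vpoly s x (vpoly vR l (vpoly (kdA_scale vR) m p)) =
    vpoly s x (vpoly vR l (vpoly (kdA_scale vR) m q))"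
  shows "p = q"
  by (rule vpoly_separation[OF vector_space_kdA[OF vector_space_vR]], rule vpoly2_eqI) (rule assms)

lemma bilinear_gd_lbr: "bilinear_map vR vR (kdA_scale vR) (gd_lbr circ br)"
proof (rule bilinearI[OF vector_space_vR vector_space_vR vector_space_kdA[OF vector_space_vR]])
qed (rule vpoly2_eqI, simp add: vpoly_gd_lbr linear_rules[OF linear_vpoly2]
    linear_rules[OF linear_vpoly] bilinear_rules[OF bilinear_gd_pair])+

text \<open>
  A basis of \<open>A\<close> generates \<open>k[\<partial>]A\<close>: \<open>\<partial>\<^sup>n a\<close> is the monomial of degree \<open>n\<close> with coefficient \<open>a\<close>.
\<close>
lemma fg_kd_module_kdA: "fg_kd_module vR kdA_del"
proof -
  obtain B where "finite_dimensional_vector_space s B" using finite_dimensional by blast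
  then interpret F: finite_dimensional_vector_space s B .
  interpret R: vector_space vR by (rule vector_space_vR)
  let ?G = "{(kdA_del ^^ n) b | n b. b \<in> kdA_const ` B}"
  have pow: "(kdA_del ^^ n) (kdA_const a) = monom a n" for n a
    by (induction n) (auto simp: kdA_const_def kdA_del_def monom_0 monom_Suc)
  have "monom a n \<in> R.span ?G" for a n
  proof -
    interpret M: Vector_Spaces.linear s vR "\<lambda>a. monom a n" by (rule linear_monom[OF vector_space_s])
    have "monom a n \<in> (\<lambda>a. monom a n) ` span B" using F.span_Basis by auto
    also have "\<dots> = R.span ((\<lambda>a. monom a n) ` B)" by (rule M.span_image[symmetric])
    also have "\<dots> \<subseteq> R.span ?G" by (rule R.span_mono) (auto simp: pow[symmetric])
    finally show ?thesis .
  qed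
  then have "p \<in> R.span ?G" for p
    by (subst poly_as_sum_of_monoms[symmetric]) (rule R.span_sum)
  then have "R.span ?G = UNIV" by auto
  moreover have "finite (kdA_const ` B)" by (simp add: F.finite_Basis)
  ultimately show ?thesis
    by (intro fg_kd_module.intro fg_kd_module_axioms.intro vector_space_vR linear_del) blast
qed

lemma linear_gd_lbr:
  "Vector_Spaces.linear vR (kdA_scale vR) (gd_lbr circ br p)"
  "Vector_Spaces.linear vR (kdA_scale vR) (\<lambda>p. gd_lbr circ br p q)"
  using bilinear_gd_lbr by (simp_all add: bilinear_map_def)

lemma lie_conformal_gd: "lie_conformal_algebra vR kdA_del (gd_lbr circ br)"
proof (intro lie_conformal_algebra.intro lie_conformal_algebra_axioms.intro fg_kd_module_kdA)
  note lin = linear_rules[OF linear_vpoly2] linear_rules[OF linear_vpoly]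
    bilinear_rules[OF bilinear_gd_pair]
  show "bilinear_map vR vR (\<lambda>c. map_poly (vR c)) (gd_lbr circ br)"
    using bilinear_gd_lbr unfolding kdA_scale_def[of vR, abs_def] .
  fix a b c
  show "gd_lbr circ br (kdA_del a) b = - pCons 0 (gd_lbr circ br a b)"
    by (rule vpoly2_eqI) (simp add: vpoly_gd_lbr vpoly_del vpoly_pCons_0 lin)
  show "gd_lbr circ br a (kdA_del b) = pCons 0 (gd_lbr circ br a b) + map_poly kdA_del (gd_lbr circ br a b)"
    by (rule vpoly2_eqI)
      (simp add: vpoly_gd_lbr vpoly_del vpoly_pCons_0 vpoly_map_del lin scale_left_distrib)
  have skew: "vpoly s x (vpoly vR l (subst_neg_lam_del kdA_del w)) = vpoly s x (vpoly vR (- l - x) w)"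
    for x l w
    unfolding subst_neg_lam_del_def
    by (rule vector_space.vpoly_subst_var[OF vector_space_vR linear_vpoly, where W = UNIV])
      (simp_all add: lin vpoly_pCons_0 vpoly_map_del vector_space.vpoly_pCons[OF vector_space_vR]
        vector_space.vpoly_0[OF vector_space_vR] linear_rules[OF linear_scale_by[OF vector_space_vR]]
        scale_left_diff_distrib)
  show "gd_lbr circ br a b = - subst_neg_lam_del kdA_del (gd_lbr circ br b a)"
  proof (rule vpoly2_eqI)
    fix x l
    show "vpoly s x (vpoly vR l (gd_lbr circ br a b)) =
      vpoly s x (vpoly vR l (- subst_neg_lam_del kdA_del (gd_lbr circ br b a)))"
      using gd_pair_skew[of "- l" "x + l" "vpoly s (- l) a" "vpoly s (x + l) b"]
      by (simp add: vpoly_gd_lbr skew lin add.commute)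
  qed
  show "subst_var mult_mu2 (\<lambda>x. subst_var mult_lam2 const2 (gd_lbr circ br a x)) (gd_lbr circ br b c) =
       subst_var mult_lam2
         (\<lambda>x. subst_var (\<lambda>q. mult_lam2 q + mult_mu2 q) const2 (gd_lbr circ br x c)) (gd_lbr circ br a b)
       + subst_var mult_lam2 (\<lambda>x. subst_var mult_mu2 const2 (gd_lbr circ br b x)) (gd_lbr circ br a c)"
  proof (rule vpoly3_eqI)
    fix x l m
    let ?E = "\<lambda>w. vpoly s x (vpoly vR l (vpoly (kdA_scale vR) m w))"
    \<comment> \<open>\<open>?E\<close> evaluates \<open>\<mu>\<close> at \<open>m\<close>, \<open>\<lambda>\<close> at \<open>l\<close> and \<open>\<partial>\<close> at \<open>x\<close>.\<close>
    note vp = vector_space.vpoly_pCons[OF vector_space_vR] vector_space.vpoly_0[OF vector_space_vR]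
      vector_space.vpoly_pCons[OF vector_space_kdA[OF vector_space_vR]]
      vector_space.vpoly_0[OF vector_space_kdA[OF vector_space_vR]]
    have linE: "Vector_Spaces.linear (kdA_scale (kdA_scale vR)) s ?E"
      by (rule linear_comp[OF vector_space.linear_vpoly[OF vector_space_kdA[OF vector_space_vR]]
            linear_vpoly2])
    note E = linear_rules[OF linE]
    have lin_shift: "Vector_Spaces.linear (kdA_scale vR) (kdA_scale vR) (pCons 0)"
      by (rule vector_space_linearI)
        (simp_all add: vector_space_kdA vector_space_vR kdA_scale_def[of vR] map_poly_pCons
          linear_rules[OF linear_scale_by[OF vector_space_vR]])
    have mu: "?E (mult_mu2 w) = s m (?E w)" for w
      by (simp add: mult_mu2_def vp lin)
    have lam: "?E (mult_lam2 w) = s l (?E w)" for w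
      by (simp add: mult_lam2_def vpoly_pCons_0
          vector_space.vpoly_map_poly[OF vector_space_kdA[OF vector_space_vR] lin_shift])
    have const: "?E (const2 r) = vpoly s x r" for r
      by (simp add: const2_def vp lin linear_rules[OF linear_scale_by[OF vector_space_vR]]
          linear_rules[OF linear_scale_by[OF vector_space_kdA[OF vector_space_vR]]])
    have inner: "?E (subst_var X const2 w) = vpoly s x (vpoly vR c w)"
      if "\<And>v. ?E (X v) = s c (?E v)" for X c w
      by (rule vector_space.vpoly_subst_var[OF vector_space_vR linear_vpoly, where W = UNIV])
        (simp_all add: E that const)
    have outer: "?E (subst_var X (\<lambda>y. subst_var Y const2 (f y)) w) = F (vpoly vR c w)"
      if "\<And>v. ?E (X v) = s c (?E v)" "\<And>v. ?E (Y v) = s d (?E v)"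
        "\<And>y. F y = vpoly s x (vpoly vR d (f y))" "Vector_Spaces.linear vR s F" for X Y f w F c d
      by (rule vector_space.vpoly_subst_var[OF vector_space_vR that(4), where W = UNIV])
        (simp_all add: E that inner)
    have 1: "?E (subst_var mult_mu2 (\<lambda>x. subst_var mult_lam2 const2 (gd_lbr circ br a x)) (gd_lbr circ br b c))
      = vpoly s x (vpoly vR l (gd_lbr circ br a (vpoly vR m (gd_lbr circ br b c))))"
      by (rule outer[OF mu lam refl linear_comp[OF linear_gd_lbr(1) linear_vpoly2]])
    have 2: "?E (subst_var mult_lam2
         (\<lambda>x. subst_var (\<lambda>q. mult_lam2 q + mult_mu2 q) const2 (gd_lbr circ br x c)) (gd_lbr circ br a b))
      = vpoly s x (vpoly vR (l + m) (gd_lbr circ br (vpoly vR l (gd_lbr circ br a b)) c))"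
      by (rule outer[OF lam _ refl linear_comp[OF linear_gd_lbr(2) linear_vpoly2]])
        (simp add: E mu lam scale_left_distrib)
    have 3: "?E (subst_var mult_lam2 (\<lambda>x. subst_var mult_mu2 const2 (gd_lbr circ br b x)) (gd_lbr circ br a c))
      = vpoly s x (vpoly vR m (gd_lbr circ br b (vpoly vR l (gd_lbr circ br a c))))"
      by (rule outer[OF lam mu refl linear_comp[OF linear_gd_lbr(1) linear_vpoly2]])
    show "?E (subst_var mult_mu2 (\<lambda>x. subst_var mult_lam2 const2 (gd_lbr circ br a x)) (gd_lbr circ br b c)) =
       ?E (subst_var mult_lam2
         (\<lambda>x. subst_var (\<lambda>q. mult_lam2 q + mult_mu2 q) const2 (gd_lbr circ br x c)) (gd_lbr circ br a b)
       + subst_var mult_lam2 (\<lambda>x. subst_var mult_mu2 const2 (gd_lbr circ br b x)) (gd_lbr circ br a c))"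
      unfolding E 1 2 3 vpoly_gd_lbr
      using gd_pair_jacobi[of "- l" "- m" "x + l + m" "vpoly s (- l) a" "vpoly s (- m) b"
          "vpoly s (x + l + m) c"]
      by (simp add: algebra_simps)
  qed
qed

end

section \<open>The cobracket evaluated at scalars\<close>

lemma tens_apply_mult:
  assumes t: "t \<in> tens_space s" and \<phi>: "bilinear_map s s (*) \<phi>"
  shows "t (\<lambda>x y. c * \<phi> x y) = c * t \<phi>"
  using apply_eq_tens_lift[OF t linear_bilinear[OF \<phi> linear_scale_by[OF vector_space_field], of c]]
  by (simp add: tens_lift_mult apply_eq_tens_lift[OF t \<phi>])

text \<open>
  \<open>d0\<close> and \<open>dl\<close> are the maps \<open>A \<rightarrow> A \<otimes> A\<close> which are to be the Lie and the Novikov cobracket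
  of a Gel'fand-Dorfman bialgebra; \<open>\<delta>\<close> is the conformal cobracket built from them.
\<close>
locale gd_cobracket = gd_algebra s circ br
  for s :: "'k::field_char_0 \<Rightarrow> 'a::ab_group_add \<Rightarrow> 'a"
    and circ :: "'a \<Rightarrow> 'a \<Rightarrow> 'a" (infixl "\<odot>" 70)
    and br :: "'a \<Rightarrow> 'a \<Rightarrow> 'a" +
  fixes dl d0 :: "'a \<Rightarrow> ('a, 'k) tensor2" and \<delta> :: "'a poly \<Rightarrow> ('a poly, 'k) tensor2"
  assumes dl: "Vector_Spaces.linear s tens_scale dl" "\<And>a. dl a \<in> tens_space s"
    and d0: "Vector_Spaces.linear s tens_scale d0" "\<And>a. d0 a \<in> tens_space s"
    and \<delta>_hom: "kd_hom_tens (kdA_scale s) kdA_del \<delta>"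
    and \<delta>_const: "\<And>a. \<delta> (kdA_const a) = tens_incl s (d0 a)
        + tens_map (kdA_scale s) (kdA_scale s) kdA_del id (tens_incl s (dl a))
        - tens_flip (kdA_scale s) (tens_map (kdA_scale s) (kdA_scale s) kdA_del id (tens_incl s (dl a)))"
begin

lemma \<delta>: "Vector_Spaces.linear vR tens_scale \<delta>" "\<delta> p \<in> tens_space vR"
  "\<delta> (kdA_del p) = tens_del vR kdA_del (\<delta> p)"
  using \<delta>_hom by (auto simp: kd_hom_tens_def)

text \<open>
  Dual to \<open>gd_pair\<close>: if \<open>\<partial>\<close> acts as \<open>x\<close> and \<open>y\<close> on the two tensor factors, then
  \<open>\<delta>(a) = \<delta>\<^sub>0(a) + (\<partial> \<otimes> id)\<Delta>(a) - \<tau>(\<partial> \<otimes> id)\<Delta>(a)\<close> becomes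
  \<open>D\<^bsub>x,y\<^esub>(a) = \<delta>\<^sub>0(a) + x \<Delta>(a) - y \<tau>\<Delta>(a)\<close>. This is its value on the form \<open>\<phi>\<close>.
\<close>
definition cobr_form :: "'k \<Rightarrow> 'k \<Rightarrow> 'a \<Rightarrow> ('a \<Rightarrow> 'a \<Rightarrow> 'k) \<Rightarrow> 'k" where
  "cobr_form x y a \<phi> =
     tens_lift s \<phi> (d0 a) + x * tens_lift s \<phi> (dl a) - y * tens_lift s (\<lambda>p q. \<phi> q p) (dl a)"

lemma linear_cobr_form:
  assumes "bilinear_map s s (*) \<phi>"
  shows "Vector_Spaces.linear s (*) (\<lambda>a. cobr_form x y a \<phi>)"
  unfolding cobr_form_def
  by (rule vector_space_linearI) (simp_all add: vector_space_s vector_space_field algebra_simps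
      linear_rules(1,2)[OF linear_tens_lift_cop[OF d0 assms]]
      linear_rules(1,2)[OF linear_tens_lift_cop[OF dl assms]]
      linear_rules(1,2)[OF linear_tens_lift_cop[OF dl bilinear_swap[OF assms]]])

lemma bilinear_vpoly:
  "bilinear_map s s (*) \<phi> \<Longrightarrow> bilinear_map vR vR (*) (\<lambda>p q. \<phi> (vpoly s x p) (vpoly s y q))"
  by (rule bilinear_comp[OF _ linear_vpoly linear_vpoly])

lemma linear_id_vR: "Vector_Spaces.linear vR vR id"
  using linear_identity[OF vector_space_vR] by (simp add: id_def)

lemma del_left_apply:
  assumes t: "t \<in> tens_space vR" and \<phi>: "bilinear_map s s (*) \<phi>"
  shows "tens_map vR vR kdA_del id t (\<lambda>p q. \<phi> (vpoly s x p) (vpoly s y q)) =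
    x * t (\<lambda>p q. \<phi> (vpoly s x p) (vpoly s y q))"
  unfolding tens_map_apply[OF t linear_del linear_id_vR bilinear_vpoly[OF \<phi>]]
  by (simp add: vpoly_del bilinear_rules[OF \<phi>] tens_apply_mult[OF t bilinear_vpoly[OF \<phi>]])

lemma del_right_apply:
  assumes t: "t \<in> tens_space vR" and \<phi>: "bilinear_map s s (*) \<phi>"
  shows "tens_map vR vR id kdA_del t (\<lambda>p q. \<phi> (vpoly s x p) (vpoly s y q)) =
    y * t (\<lambda>p q. \<phi> (vpoly s x p) (vpoly s y q))"
  unfolding tens_map_apply[OF t linear_id_vR linear_del bilinear_vpoly[OF \<phi>]]
  by (simp add: vpoly_del bilinear_rules[OF \<phi>] tens_apply_mult[OF t bilinear_vpoly[OF \<phi>]])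

lemma tens_del_apply:
  assumes t: "t \<in> tens_space vR" and \<phi>: "bilinear_map s s (*) \<phi>"
  shows "tens_del vR kdA_del t (\<lambda>p q. \<phi> (vpoly s x p) (vpoly s y q)) =
    (x + y) * t (\<lambda>p q. \<phi> (vpoly s x p) (vpoly s y q))"
  by (simp add: tens_del_def del_left_apply[OF assms] del_right_apply[OF assms] algebra_simps)

lemma tens_incl_apply:
  assumes t: "t \<in> tens_space s" and \<phi>: "bilinear_map s s (*) \<phi>"
  shows "tens_incl s t (\<lambda>p q. \<phi> (vpoly s x p) (vpoly s y q)) = tens_lift s \<phi> t"
  unfolding tens_incl_def tens_map_apply[OF t linear_const linear_const bilinear_vpoly[OF \<phi>]]
  by (simp add: vpoly_const apply_eq_tens_lift[OF t \<phi>])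

lemma tens_incl_in: "tens_incl s t \<in> tens_space vR"
  unfolding tens_incl_def by (rule tens_map_in_tens_space)

text \<open>
  Since \<open>\<delta>\<close> commutes with \<open>\<partial>\<close>, which acts on \<open>R \<otimes> R\<close> by \<open>\<partial> \<otimes> id + id \<otimes> \<partial>\<close>, the argument of \<open>\<delta>\<close>
  is evaluated at \<open>x + y\<close>.
\<close>
lemma \<delta>_vpoly:
  assumes \<phi>: "bilinear_map s s (*) \<phi>"
  shows "\<delta> r (\<lambda>p q. \<phi> (vpoly s x p) (vpoly s y q)) = cobr_form x y (vpoly s (x + y) r) \<phi>"
proof (induction r rule: pCons_induct)
  case 0
  show ?case by (simp add: linear_rules(3)[OF \<delta>(1)] linear_rules(3)[OF linear_cobr_form[OF \<phi>]])
next
  case (pCons a r)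
  have "pCons a r = kdA_const a + kdA_del r" by (simp add: kdA_const_def kdA_del_def)
  moreover have "\<delta> (kdA_const a) (\<lambda>p q. \<phi> (vpoly s x p) (vpoly s y q)) = cobr_form x y a \<phi>"
    by (simp add: \<delta>_const tens_flip_apply[OF vector_space_vR tens_map_in_tens_space bilinear_vpoly[OF \<phi>]]
        del_left_apply[OF tens_incl_in \<phi>] del_left_apply[OF tens_incl_in bilinear_swap[OF \<phi>]]
        tens_incl_apply \<phi> tens_incl_apply[OF _ bilinear_swap[OF \<phi>]] d0 dl cobr_form_def)
  ultimately show ?case
    by (simp only: linear_rules(1)[OF \<delta>(1)] \<delta>(3) plus_fun_apply tens_del_apply[OF \<delta>(2) \<phi>] pCons.IH
        linear_rules[OF linear_vpoly] vpoly_const vpoly_del linear_rules[OF linear_cobr_form[OF \<phi>]])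
qed

section \<open>The coalgebra axioms\<close>

text \<open>
  Left side minus right side of the coalgebra axioms on \<open>A\<close>, paired with a trilinear form. The
  permutations \<open>\<tau>\<close> and \<open>\<tau> \<otimes> id\<close> of tensor factors show up as permutations of the arguments of \<open>\<Phi>\<close>.
\<close>
definition cojacobi_defect where
  "cojacobi_defect a \<Phi> =
     tens_lift s (\<lambda>p q. tens_lift s (\<lambda>u v. \<Phi> p u v) (d0 q)) (d0 a)
   - tens_lift s (\<lambda>p q. tens_lift s (\<lambda>u v. \<Phi> u p v) (d0 q)) (d0 a)
   - tens_lift s (\<lambda>p q. tens_lift s (\<lambda>u v. \<Phi> u v q) (d0 p)) (d0 a)"

definition gd_cop_defect where
  "gd_cop_defect a \<Phi> =
     tens_lift s (\<lambda>p q. tens_lift s (\<lambda>u v. \<Phi> p u v) (d0 q)) (dl a)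
   - tens_lift s (\<lambda>p q. tens_lift s (\<lambda>u v. \<Phi> u p v) (dl q)) (d0 a)
   + tens_lift s (\<lambda>p q. tens_lift s (\<lambda>u v. \<Phi> u q v) (d0 p)) (dl a)
   - tens_lift s (\<lambda>p q. tens_lift s (\<lambda>u v. \<Phi> u v q) (dl p)) (d0 a)
   - tens_lift s (\<lambda>p q. tens_lift s (\<lambda>u v. \<Phi> u v q) (d0 p)) (dl a)"

definition cop_rc_defect where
  "cop_rc_defect a \<Phi> =
     tens_lift s (\<lambda>p q. tens_lift s (\<lambda>u v. \<Phi> u q v) (dl p)) (dl a)
   - tens_lift s (\<lambda>p q. tens_lift s (\<lambda>u v. \<Phi> u v q) (dl p)) (dl a)"

definition cop_ls_defect where
  "cop_ls_defect a \<Phi> =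
     tens_lift s (\<lambda>p q. tens_lift s (\<lambda>u v. \<Phi> p u v) (dl q)) (dl a)
   - tens_lift s (\<lambda>p q. tens_lift s (\<lambda>u v. \<Phi> u p v) (dl q)) (dl a)
   - tens_lift s (\<lambda>p q. tens_lift s (\<lambda>u v. \<Phi> u v q) (dl p)) (dl a)
   + tens_lift s (\<lambda>p q. tens_lift s (\<lambda>u v. \<Phi> v u q) (dl p)) (dl a)"

text \<open>
  The co-Jacobi identity of \<open>\<delta>\<close> with \<open>\<partial>\<close> acting as \<open>x, y, z\<close> on the three factors.
\<close>
definition conf_cojacobi_defect where
  "conf_cojacobi_defect x y z a \<Phi> =
     cobr_form x (y + z) a (\<lambda>p q. cobr_form y z q (\<lambda>u v. \<Phi> p u v))
   - cobr_form y (x + z) a (\<lambda>p q. cobr_form x z q (\<lambda>u v. \<Phi> u p v))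
   - cobr_form (x + y) z a (\<lambda>p q. cobr_form x y p (\<lambda>u v. \<Phi> u v q))"

definition d0_skew where
  "d0_skew \<longleftrightarrow> (\<forall>a \<phi>. bilinear_map s s (*) \<phi> \<longrightarrow> tens_lift s (\<lambda>p q. \<phi> q p) (d0 a) = - tens_lift s \<phi> (d0 a))"

text \<open>
  The coefficients of \<open>1, x, x\<^sup>2, xy\<close> of the evaluated co-Jacobi identity are the four axioms of a
  Gel'fand-Dorfman coalgebra other than skew-symmetry. Skew-symmetry of \<open>\<delta>\<close> makes the identity antisymmetric under
  simultaneous permutations of \<open>x, y, z\<close> and of the tensor factors, so up to sign the
  other coefficients are the same axioms for permuted forms.
\<close>
lemma conf_cojacobi_expand:
  assumes \<Phi>: "trilinear_map s (*) \<Phi>" and skew: "d0_skew"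
  shows "conf_cojacobi_defect x y z a \<Phi> = cojacobi_defect a \<Phi>
    + x * gd_cop_defect a \<Phi> - y * gd_cop_defect a (\<lambda>u v w. \<Phi> v u w)
    - z * gd_cop_defect a (\<lambda>u v w. \<Phi> w v u)
    + x^2 * cop_rc_defect a \<Phi> - y^2 * cop_rc_defect a (\<lambda>u v w. \<Phi> v u w)
    - z^2 * cop_rc_defect a (\<lambda>u v w. \<Phi> w v u)
    + x * y * cop_ls_defect a \<Phi> - x * z * cop_ls_defect a (\<lambda>u v w. \<Phi> u w v)
    - y * z * cop_ls_defect a (\<lambda>u v w. \<Phi> w v u)"
proof -
  have sk: "tens_lift s (\<lambda>p q. \<phi> q p) (d0 a) = - tens_lift s \<phi> (d0 a)"
    if "bilinear_map s s (*) \<phi>" for \<phi> a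
    using skew that by (auto simp: d0_skew_def)
  \<comment> \<open>Skew-symmetry of \<open>d0\<close> is needed both for the inner and for the outer cobracket; each rule picks one representative of the two orders.\<close>
  have inner: "tens_lift s (\<lambda>u v. \<Phi> p v u) (d0 q) = - tens_lift s (\<lambda>u v. \<Phi> p u v) (d0 q)"
    "tens_lift s (\<lambda>u v. \<Phi> v p u) (d0 q) = - tens_lift s (\<lambda>u v. \<Phi> u p v) (d0 q)"
    "tens_lift s (\<lambda>u v. \<Phi> v u p) (d0 q) = - tens_lift s (\<lambda>u v. \<Phi> u v p) (d0 q)" for p q
    by (rule sk, rule trilinear_slice[OF \<Phi>])+
  have outer: "tens_lift s (\<lambda>p q. tens_lift s (\<lambda>u v. \<Psi> q u v) (P p)) (d0 a) =
      - tens_lift s (\<lambda>p q. tens_lift s (\<lambda>u v. \<Psi> p u v) (P q)) (d0 a)"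
    if "trilinear_map s (*) \<Psi>" "P = d0 \<or> P = dl" for \<Psi> P
    using sk[OF bilinear_nested[OF d0 that(1)]] sk[OF bilinear_nested[OF dl that(1)]] that(2) by auto
  note swaps = trilinear_swap12 trilinear_swap23 trilinear_swap13
  have outer':
    "tens_lift s (\<lambda>p q. tens_lift s (\<lambda>u v. \<Phi> q u v) (P p)) (d0 a) =
      - tens_lift s (\<lambda>p q. tens_lift s (\<lambda>u v. \<Phi> p u v) (P q)) (d0 a)"
    "tens_lift s (\<lambda>p q. tens_lift s (\<lambda>u v. \<Phi> q v u) (P p)) (d0 a) =
      - tens_lift s (\<lambda>p q. tens_lift s (\<lambda>u v. \<Phi> p v u) (P q)) (d0 a)"
    "tens_lift s (\<lambda>p q. tens_lift s (\<lambda>u v. \<Phi> u q v) (P p)) (d0 a) =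
      - tens_lift s (\<lambda>p q. tens_lift s (\<lambda>u v. \<Phi> u p v) (P q)) (d0 a)"
    "tens_lift s (\<lambda>p q. tens_lift s (\<lambda>u v. \<Phi> v q u) (P p)) (d0 a) =
      - tens_lift s (\<lambda>p q. tens_lift s (\<lambda>u v. \<Phi> v p u) (P q)) (d0 a)"
    "tens_lift s (\<lambda>p q. tens_lift s (\<lambda>u v. \<Phi> u v q) (P p)) (d0 a) =
      - tens_lift s (\<lambda>p q. tens_lift s (\<lambda>u v. \<Phi> u v p) (P q)) (d0 a)"
    "tens_lift s (\<lambda>p q. tens_lift s (\<lambda>u v. \<Phi> v u q) (P p)) (d0 a) =
      - tens_lift s (\<lambda>p q. tens_lift s (\<lambda>u v. \<Phi> v u p) (P q)) (d0 a)"
    if "P = d0 \<or> P = dl" for P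
    using outer[OF \<Phi> that] outer[OF trilinear_swap23[OF \<Phi>] that]
      outer[OF trilinear_swap12[OF \<Phi>] that]
      outer[OF trilinear_swap23[OF trilinear_swap12[OF \<Phi>]] that]
      outer[OF trilinear_swap12[OF trilinear_swap23[OF \<Phi>]] that]
      outer[OF trilinear_swap13[OF \<Phi>] that] by simp_all
  show ?thesis
    unfolding conf_cojacobi_defect_def cobr_form_def cojacobi_defect_def gd_cop_defect_def
      cop_rc_defect_def cop_ls_defect_def
    by (simp add: tens_lift_distribs inner outer'[of d0] outer'[of dl])
      (simp add: algebra_simps power2_eq_square)
qed

end

lemma tens_eq_iff:
  assumes "t \<in> tens_space s" "u \<in> tens_space s"
  shows "t = u \<longleftrightarrow> (\<forall>\<phi>. bilinear_map s s (*) \<phi> \<longrightarrow> t \<phi> = u \<phi>)"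
  using tens_eqI[OF assms] by blast

lemma tens3_eq_iff:
  assumes "t \<in> tens3_space s" "u \<in> tens3_space s"
  shows "t = u \<longleftrightarrow> (\<forall>\<Phi>. trilinear_map s (*) \<Phi> \<longrightarrow> t \<Phi> = u \<Phi>)"
  using tens3_eqI[OF assms] by blast

lemma tens3_all_eq_iff:
  assumes "\<And>a. t a \<in> tens3_space s" "\<And>a. u a \<in> tens3_space s"
    and "\<And>a \<Phi>. trilinear_map s (*) \<Phi> \<Longrightarrow> t a \<Phi> - u a \<Phi> = d a \<Phi>"
  shows "(\<forall>a. t a = u a) \<longleftrightarrow> (\<forall>a \<Phi>. trilinear_map s (*) \<Phi> \<longrightarrow> d a \<Phi> = 0)"
  unfolding tens3_eq_iff[OF assms(1,2)] by (simp add: assms(3)[symmetric])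

lemma tens_lift_flip:
  assumes "vector_space s" "t \<in> tens_space s" "bilinear_map s s (*) \<phi>"
  shows "tens_lift s \<phi> (tens_flip s t) = tens_lift s (\<lambda>x y. \<phi> y x) t"
  using tens_flip_apply[OF assms]
  by (simp add: apply_eq_tens_lift[OF tens_flip_in_tens_space assms(3)]
      apply_eq_tens_lift[OF assms(2) bilinear_swap[OF assms(3)]])

context gd_cobracket begin

lemma d0_skew_iff: "(\<forall>a. d0 a = - tens_flip s (d0 a)) \<longleftrightarrow> d0_skew"
proof -
  have "d0 a = - tens_flip s (d0 a) \<longleftrightarrow> (\<forall>\<phi>. bilinear_map s s (*) \<phi> \<longrightarrow>
      tens_lift s (\<lambda>p q. \<phi> q p) (d0 a) = - tens_lift s \<phi> (d0 a))" for a
    unfolding tens_eq_iff[OF d0(2) uminus_in_tens_space[OF vector_space_s tens_flip_in_tens_space]]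
    by (intro all_cong1 imp_cong refl)
      (auto simp: tens_flip_apply[OF vector_space_s d0(2)] apply_eq_tens_lift[OF d0(2)] bilinear_swap)
  then show ?thesis by (auto simp: d0_skew_def)
qed

text \<open>
  The terms with \<open>\<Delta>\<close> are antisymmetrised by construction, so only \<open>\<delta>\<^sub>0\<close> contributes.
\<close>
lemma \<delta>_skew_iff: "(\<forall>r. \<delta> r = - tens_flip vR (\<delta> r)) \<longleftrightarrow> d0_skew"
proof -
  have ev: "(- tens_flip vR (\<delta> r)) (\<lambda>p q. \<phi> (vpoly s x p) (vpoly s y q)) =
      - cobr_form y x (vpoly s (x + y) r) (\<lambda>p q. \<phi> q p)"
    if \<phi>: "bilinear_map s s (*) \<phi>" for \<phi> x y r
    by (simp add: tens_flip_apply[OF vector_space_vR \<delta>(2) bilinear_vpoly[OF \<phi>]]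
        \<delta>_vpoly[OF bilinear_swap[OF \<phi>], where x = y and y = x] add.commute)
  show ?thesis
  proof
    assume *: "\<forall>r. \<delta> r = - tens_flip vR (\<delta> r)"
    show d0_skew unfolding d0_skew_def
    proof (intro allI impI)
      fix a \<phi> assume \<phi>: "bilinear_map s s (*) \<phi>"
      have "cobr_form 0 0 a \<phi> = - cobr_form 0 0 a (\<lambda>p q. \<phi> q p)"
        using \<delta>_vpoly[OF \<phi>, of "kdA_const a" 0 0] ev[OF \<phi>, of "kdA_const a" 0 0] *
        by (simp add: vpoly_const)
      then show "tens_lift s (\<lambda>p q. \<phi> q p) (d0 a) = - tens_lift s \<phi> (d0 a)"
        by (simp add: cobr_form_def)
    qed
  next
    assume d0_skew
    then show "\<forall>r. \<delta> r = - tens_flip vR (\<delta> r)"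
      by (intro allI tens_eq_vpolyI[OF vector_space_s \<delta>(2)
            uminus_in_tens_space[OF vector_space_vR tens_flip_in_tens_space]])
        (simp only: ev \<delta>_vpoly, simp add: cobr_form_def d0_skew_def)
  qed
qed

lemma bilinear_cobr_form_nested:
  assumes \<Phi>: "trilinear_map s (*) \<Phi>"
  shows "bilinear_map s s (*) (\<lambda>p q. cobr_form y z q (\<Phi> p))"
proof -
  note 1 = bilinear_rules[OF bilinear_nested[OF d0 \<Phi>]]
    and 2 = bilinear_rules[OF bilinear_nested[OF dl \<Phi>]]
    and 3 = bilinear_rules[OF bilinear_nested[OF dl trilinear_swap23[OF \<Phi>]]]
  show ?thesis
    unfolding cobr_form_def
    by (rule bilinearI) (simp_all add: vector_space_s vector_space_field 1(1-4) 2(1-4) 3(1-4) algebra_simps)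
qed

lemma trilinear_vpoly:
  "trilinear_map s (*) \<Phi> \<Longrightarrow>
   trilinear_map vR (*) (\<lambda>p q r. \<Phi> (vpoly s x p) (vpoly s y q) (vpoly s z r))"
  by (rule trilinear_comp[OF _ linear_vpoly linear_vpoly linear_vpoly])

lemma \<delta>_nested_vpoly:
  assumes \<Phi>: "trilinear_map s (*) \<Phi>"
  shows "id_tens_cop vR \<delta> (\<delta> r) (\<lambda>p q r. \<Phi> (vpoly s x p) (vpoly s y q) (vpoly s z r)) =
      cobr_form x (y + z) (vpoly s (x + y + z) r) (\<lambda>p q. cobr_form y z q (\<Phi> p))"
    and "cop_tens_id vR \<delta> (\<delta> r) (\<lambda>p q r. \<Phi> (vpoly s x p) (vpoly s y q) (vpoly s z r)) =
      cobr_form (x + y) z (vpoly s (x + y + z) r) (\<lambda>p q. cobr_form x y p (\<lambda>u v. \<Phi> u v q))"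
proof -
  have b: "bilinear_map s s (*) (\<lambda>p q. cobr_form x y p (\<lambda>u v. \<Phi> u v q))"
    by (rule bilinear_swap[OF bilinear_cobr_form_nested[OF trilinear_swap12[OF trilinear_swap23[OF \<Phi>]]]])
  show
    "id_tens_cop vR \<delta> (\<delta> r) (\<lambda>p q r. \<Phi> (vpoly s x p) (vpoly s y q) (vpoly s z r)) =
      cobr_form x (y + z) (vpoly s (x + y + z) r) (\<lambda>p q. cobr_form y z q (\<Phi> p))"
    "cop_tens_id vR \<delta> (\<delta> r) (\<lambda>p q r. \<Phi> (vpoly s x p) (vpoly s y q) (vpoly s z r)) =
      cobr_form (x + y) z (vpoly s (x + y + z) r) (\<lambda>p q. cobr_form x y p (\<lambda>u v. \<Phi> u v q))"
    by (simp_all add: tens_lift_apply_tensor3[OF vector_space_vR \<delta>(2) \<delta>(1,2) trilinear_vpoly[OF \<Phi>]]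
        \<delta>_vpoly[OF trilinear_slice(1)[OF \<Phi>]] \<delta>_vpoly[OF trilinear_slice(3)[OF \<Phi>]]
        \<delta>_vpoly[OF bilinear_cobr_form_nested[OF \<Phi>]] \<delta>_vpoly[OF b] add.assoc)
qed

lemma \<delta>_cojacobi_iff:
  "(\<forall>r. id_tens_cop vR \<delta> (\<delta> r) - flip_tens_id vR (id_tens_cop vR \<delta> (\<delta> r)) = cop_tens_id vR \<delta> (\<delta> r))
   \<longleftrightarrow> (\<forall>x y z a \<Phi>. trilinear_map s (*) \<Phi> \<longrightarrow> conf_cojacobi_defect x y z a \<Phi> = 0)"
  (is "(\<forall>r. ?L r = ?R r) \<longleftrightarrow> _")
proof -
  have ev: "?L r (\<lambda>p q r. \<Phi> (vpoly s x p) (vpoly s y q) (vpoly s z r)) -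
      ?R r (\<lambda>p q r. \<Phi> (vpoly s x p) (vpoly s y q) (vpoly s z r)) =
      conf_cojacobi_defect x y z (vpoly s (x + y + z) r) \<Phi>"
    if \<Phi>: "trilinear_map s (*) \<Phi>" for \<Phi> x y z r
    using \<delta>_nested_vpoly(1)[OF trilinear_swap12[OF \<Phi>], where r = r and x = y and y = x and z = z]
    by (simp add: conf_cojacobi_defect_def \<delta>_nested_vpoly[OF \<Phi>]
        flip_tens_id_apply[OF vector_space_vR id_tens_cop_in_tens3_space trilinear_vpoly[OF \<Phi>]] add.commute)
  show ?thesis
  proof
    assume *: "\<forall>r. ?L r = ?R r"
    show "\<forall>x y z a \<Phi>. trilinear_map s (*) \<Phi> \<longrightarrow> conf_cojacobi_defect x y z a \<Phi> = 0"
    proof (intro allI impI)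
      fix x y z a \<Phi> assume "trilinear_map s (*) \<Phi>"
      then have "conf_cojacobi_defect x y z (vpoly s (x + y + z) (kdA_const a)) \<Phi> = 0"
        by (subst ev[symmetric]) (simp_all only: * diff_self)
      then show "conf_cojacobi_defect x y z a \<Phi> = 0" by (simp only: vpoly_const)
    qed
  next
    assume *: "\<forall>x y z a \<Phi>. trilinear_map s (*) \<Phi> \<longrightarrow> conf_cojacobi_defect x y z a \<Phi> = 0"
    show "\<forall>r. ?L r = ?R r"
    proof
      fix r
      show "?L r = ?R r"
        by (rule tens3_eq_vpolyI[OF vector_space_s])
          (use * ev in \<open>auto intro!: in_tens3_space vector_space_vR simp del: minus_apply\<close>)
    qed
  qed
qed

lemmas tens3_eval = tens_lift_eq_tensor3[OF vector_space_s d0(2) d0]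
  tens_lift_eq_tensor3[OF vector_space_s d0(2) dl] tens_lift_eq_tensor3[OF vector_space_s dl(2) d0]
  tens_lift_eq_tensor3[OF vector_space_s dl(2) dl]
  tens_lift_eq_tensor3[OF vector_space_s tens_flip_in_tens_space d0]
  tens_lift_eq_tensor3[OF vector_space_s tens_flip_in_tens_space dl]
lemmas tens_lift_flip_nested = tens_lift_flip[OF vector_space_s dl(2) bilinear_nested[OF d0]]
  tens_lift_flip[OF vector_space_s dl(2) bilinear_nested[OF dl]]

lemma cojacobi_iff:
  "(\<forall>a. id_tens_cop s d0 (d0 a) - flip_tens_id s (id_tens_cop s d0 (d0 a))
       = cop_tens_id s d0 (d0 a))
   \<longleftrightarrow> (\<forall>a \<Phi>. trilinear_map s (*) \<Phi> \<longrightarrow> cojacobi_defect a \<Phi> = 0)"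
proof (rule tens3_all_eq_iff; (intro in_tens3_space vector_space_s)?)
  fix a \<Phi> assume \<Phi>: "trilinear_map s (*) \<Phi>"
  note \<Phi>' = trilinear_swap12[OF \<Phi>]
  show "(id_tens_cop s d0 (d0 a) - flip_tens_id s (id_tens_cop s d0 (d0 a))) \<Phi>
     - (cop_tens_id s d0 (d0 a)) \<Phi> = cojacobi_defect a \<Phi>"
    by (simp add: flip_tens_id_apply[OF vector_space_s in_tens3_space(1) \<Phi>]
        flip_tens_id_apply[OF vector_space_s in_tens3_space(2) \<Phi>]
        tens3_eval[OF \<Phi>] tens3_eval[OF \<Phi>'] tens_lift_flip_nested[OF \<Phi>] tens_lift_flip_nested[OF \<Phi>']
        cojacobi_defect_def)
qed

lemma cop_left_symmetric_iff:
  "(\<forall>a. id_tens_cop s dl (dl a) - flip_tens_id s (id_tens_cop s dl (dl a))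
       = cop_tens_id s dl (dl a) - flip_tens_id s (cop_tens_id s dl (dl a)))
   \<longleftrightarrow> (\<forall>a \<Phi>. trilinear_map s (*) \<Phi> \<longrightarrow> cop_ls_defect a \<Phi> = 0)"
proof (rule tens3_all_eq_iff; (intro in_tens3_space vector_space_s)?)
  fix a \<Phi> assume \<Phi>: "trilinear_map s (*) \<Phi>"
  note \<Phi>' = trilinear_swap12[OF \<Phi>]
  show "(id_tens_cop s dl (dl a) - flip_tens_id s (id_tens_cop s dl (dl a))) \<Phi>
     - (cop_tens_id s dl (dl a) - flip_tens_id s (cop_tens_id s dl (dl a))) \<Phi> = cop_ls_defect a \<Phi>"
    by (simp add: flip_tens_id_apply[OF vector_space_s in_tens3_space(1) \<Phi>]
        flip_tens_id_apply[OF vector_space_s in_tens3_space(2) \<Phi>]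
        tens3_eval[OF \<Phi>] tens3_eval[OF \<Phi>'] tens_lift_flip_nested[OF \<Phi>] tens_lift_flip_nested[OF \<Phi>']
        cop_ls_defect_def)
qed

lemma cop_right_commutative_iff:
  "(\<forall>a. flip_tens_id s (id_tens_cop s dl (tens_flip s (dl a)))
       = cop_tens_id s dl (dl a))
   \<longleftrightarrow> (\<forall>a \<Phi>. trilinear_map s (*) \<Phi> \<longrightarrow> cop_rc_defect a \<Phi> = 0)"
proof (rule tens3_all_eq_iff; (intro in_tens3_space vector_space_s)?)
  fix a \<Phi> assume \<Phi>: "trilinear_map s (*) \<Phi>"
  note \<Phi>' = trilinear_swap12[OF \<Phi>]
  show "(flip_tens_id s (id_tens_cop s dl (tens_flip s (dl a)))) \<Phi>
     - (cop_tens_id s dl (dl a)) \<Phi> = cop_rc_defect a \<Phi>"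
    by (simp add: flip_tens_id_apply[OF vector_space_s in_tens3_space(1) \<Phi>]
        flip_tens_id_apply[OF vector_space_s in_tens3_space(2) \<Phi>]
        tens3_eval[OF \<Phi>] tens3_eval[OF \<Phi>'] tens_lift_flip_nested[OF \<Phi>] tens_lift_flip_nested[OF \<Phi>']
        cop_rc_defect_def)
qed

lemma gd_cop_compat_iff:
  "(\<forall>a. id_tens_cop s d0 (dl a) - flip_tens_id s (id_tens_cop s dl (d0 a))
       + flip_tens_id s (id_tens_cop s d0 (tens_flip s (dl a)))
       = cop_tens_id s dl (d0 a) + cop_tens_id s d0 (dl a))
   \<longleftrightarrow> (\<forall>a \<Phi>. trilinear_map s (*) \<Phi> \<longrightarrow> gd_cop_defect a \<Phi> = 0)"
proof (rule tens3_all_eq_iff; (intro in_tens3_space vector_space_s)?)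
  fix a \<Phi> assume \<Phi>: "trilinear_map s (*) \<Phi>"
  note \<Phi>' = trilinear_swap12[OF \<Phi>]
  show "(id_tens_cop s d0 (dl a) - flip_tens_id s (id_tens_cop s dl (d0 a))
       + flip_tens_id s (id_tens_cop s d0 (tens_flip s (dl a)))) \<Phi>
     - (cop_tens_id s dl (d0 a) + cop_tens_id s d0 (dl a)) \<Phi> = gd_cop_defect a \<Phi>"
    by (simp add: flip_tens_id_apply[OF vector_space_s in_tens3_space(1) \<Phi>]
        flip_tens_id_apply[OF vector_space_s in_tens3_space(2) \<Phi>]
        tens3_eval[OF \<Phi>] tens3_eval[OF \<Phi>'] tens_lift_flip_nested[OF \<Phi>] tens_lift_flip_nested[OF \<Phi>']
        gd_cop_defect_def)
qed

lemma gd_coalgebra_iff: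
  "gd_coalgebra s dl d0 \<longleftrightarrow> d0_skew \<and> (\<forall>a \<Phi>. trilinear_map s (*) \<Phi> \<longrightarrow>
     cojacobi_defect a \<Phi> = 0 \<and> gd_cop_defect a \<Phi> = 0 \<and> cop_rc_defect a \<Phi> = 0 \<and> cop_ls_defect a \<Phi> = 0)"
  using dl d0 cojacobi_iff cop_left_symmetric_iff cop_right_commutative_iff gd_cop_compat_iff
    d0_skew_iff fd_space_axioms
  unfolding gd_coalgebra_def novikov_coalgebra_def lie_coalgebra_def gd_coalgebra_axioms_def
    novikov_coalgebra_axioms_def lie_coalgebra_axioms_def
  by auto

text \<open>
  The line \<open>(t, 0, 0)\<close> isolates the coefficients of \<open>1, x, x\<^sup>2\<close>; once these are known to vanish,
  the point \<open>(1, 1, 0)\<close> leaves only the coefficient of \<open>xy\<close>.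
\<close>
lemma conf_cojacobi_iff:
  assumes skew: "d0_skew"
  shows "(\<forall>x y z a \<Phi>. trilinear_map s (*) \<Phi> \<longrightarrow> conf_cojacobi_defect x y z a \<Phi> = 0) \<longleftrightarrow>
    (\<forall>a \<Phi>. trilinear_map s (*) \<Phi> \<longrightarrow>
     cojacobi_defect a \<Phi> = 0 \<and> gd_cop_defect a \<Phi> = 0 \<and> cop_rc_defect a \<Phi> = 0 \<and> cop_ls_defect a \<Phi> = 0)"
  (is "?L \<longleftrightarrow> ?R")
proof
  assume R: ?R
  show ?L
  proof (intro allI impI)
    fix x y z a \<Phi> assume \<Phi>: "trilinear_map s (*) \<Phi>"
    show "conf_cojacobi_defect x y z a \<Phi> = 0"
      using R[rule_format, OF \<Phi>] R[rule_format, OF trilinear_swap12[OF \<Phi>]]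
        R[rule_format, OF trilinear_swap13[OF \<Phi>]] R[rule_format, OF trilinear_swap23[OF \<Phi>]]
      by (simp add: conf_cojacobi_expand[OF \<Phi> skew])
  qed
next
  assume L: ?L
  have 1: "cojacobi_defect a \<Phi> = 0" "gd_cop_defect a \<Phi> = 0" "cop_rc_defect a \<Phi> = 0"
    if "trilinear_map s (*) \<Phi>" for a \<Phi>
  proof -
    have "cojacobi_defect a \<Phi> + t * gd_cop_defect a \<Phi> + t^2 * cop_rc_defect a \<Phi> = 0" for t
      using L[rule_format, OF that, of t 0 0 a] by (simp add: conf_cojacobi_expand[OF that skew])
    from quadratic_eq_0[OF this]
    show "cojacobi_defect a \<Phi> = 0" "gd_cop_defect a \<Phi> = 0" "cop_rc_defect a \<Phi> = 0" .
  qed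
  have "cop_ls_defect a \<Phi> = 0" if "trilinear_map s (*) \<Phi>" for a \<Phi>
    using L[rule_format, OF that, of 1 1 0 a]
    by (simp add: conf_cojacobi_expand[OF that skew] 1[OF that] 1[OF trilinear_swap12[OF that]])
  with 1 show ?R by blast
qed

lemma lie_conformal_coalgebra_iff:
  "lie_conformal_coalgebra vR kdA_del \<delta> \<longleftrightarrow> gd_coalgebra s dl d0"
proof -
  have "lie_conformal_coalgebra vR kdA_del \<delta> \<longleftrightarrow> d0_skew \<and>
      (\<forall>x y z a \<Phi>. trilinear_map s (*) \<Phi> \<longrightarrow> conf_cojacobi_defect x y z a \<Phi> = 0)"
    unfolding lie_conformal_coalgebra_def lie_conformal_coalgebra_axioms_def \<delta>_skew_iff \<delta>_cojacobi_iff
    using fg_kd_module_kdA \<delta>_hom by simp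
  then show ?thesis using conf_cojacobi_iff gd_coalgebra_iff by blast
qed

end

section \<open>The cocycle condition\<close>

lemma tens_apply_add:
  assumes t: "t \<in> tens_space s" and \<phi>: "bilinear_map s s (*) \<phi>" and \<psi>: "bilinear_map s s (*) \<psi>"
  shows "t (\<lambda>x y. \<phi> x y + \<psi> x y) = t \<phi> + t \<psi>"
proof -
  have "vector_space s" using \<phi> by (auto simp: bilinear_map_def Vector_Spaces.linear_def)
  then have "bilinear_map s s (*) (\<lambda>x y. \<phi> x y + \<psi> x y)"
    by (intro bilinearI) (simp_all add: vector_space_field bilinear_rules(1-4)[OF \<phi>]
        bilinear_rules(1-4)[OF \<psi>] algebra_simps)
  then show ?thesis
    by (simp add: apply_eq_tens_lift[OF t] \<phi> \<psi> tens_lift_add)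
qed

lemma subst_var_in:
  assumes "0 \<in> W" "\<And>v w. v \<in> W \<Longrightarrow> w \<in> W \<Longrightarrow> v + w \<in> W" "\<And>v. v \<in> W \<Longrightarrow> X v \<in> W"
    "\<And>i. \<iota> (coeff p i) \<in> W"
  shows "subst_var X \<iota> p \<in> W"
proof -
  have pow: "(X ^^ n) v \<in> W" if "v \<in> W" for n v
    using that by (induction n) (auto simp: assms(3))
  have "(\<Sum>i\<in>I. (X ^^ i) (\<iota> (coeff p i))) \<in> W" if "finite I" for I
    using that pow by (induction I rule: finite_induct) (auto simp: assms)
  then show ?thesis by (simp add: subst_var_def)
qed

text \<open>
  \<open>(R \<otimes> R)[\<lambda>]\<close>; the operator \<open>\<partial> \<otimes> id + id \<otimes> \<partial>\<close> is controlled only on genuine tensors, so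
  substitutions have to be followed inside this set.
\<close>
definition tens_poly :: "('k::field \<Rightarrow> 'a::ab_group_add \<Rightarrow> 'a) \<Rightarrow> ('a, 'k) tensor2 poly set" where
  "tens_poly s = {P. \<forall>n. coeff P n \<in> tens_space s}"

lemma vpoly_in_tens_space:
  assumes s: "vector_space s" and "P \<in> tens_poly s"
  shows "vpoly tens_scale l P \<in> tens_space s"
proof -
  have "(\<Sum>i\<in>I. tens_scale (l ^ i) (coeff P i)) \<in> tens_space s" if "finite I" for I
    using that assms(2) by (induction I rule: finite_induct)
      (auto simp: tens_poly_def intro: zero_in_tens_space add_in_tens_space scale_in_tens_space[OF s])
  then show ?thesis by (simp add: vpoly_def)
qed

lemma diff_in_tens_poly:
  "vector_space s \<Longrightarrow> P \<in> tens_poly s \<Longrightarrow> Q \<in> tens_poly s \<Longrightarrow> P - Q \<in> tens_poly s"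
  by (simp add: tens_poly_def diff_in_tens_space del: minus_apply)

lemma tens_lift_zero:
  "bilinear_map s s sV f \<Longrightarrow> tens_lift s f 0 = 0"
  using tens_lift_sum[of s sV f "[]"] by simp

context gd_cobracket begin

lemma tens_del_in: "tens_del vR kdA_del t \<in> tens_space vR"
  unfolding tens_del_def by (intro add_in_tens_space tens_map_in_tens_space)

lemma tens_del_zero: "tens_del vR kdA_del 0 = 0"
  unfolding tens_del_def tens_map_def
    tens_lift_zero[OF bilinear_tens_comp[OF linear_del linear_id_vR]]
    tens_lift_zero[OF bilinear_tens_comp[OF linear_id_vR linear_del]] by simp

lemma linear_eval_form: "Vector_Spaces.linear (kdA_scale tens_scale) (*) (\<lambda>P. vpoly tens_scale l P \<phi>)"
  by (rule linear_comp[OF vector_space.linear_vpoly[OF vector_space_tens] linear_apply_form])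

text \<open>
  \<open>\<partial>\<close> acts on \<open>R \<otimes> R\<close> as \<open>x + y\<close>, so substituting \<open>-\<lambda>-\<partial>\<close> for \<open>\<lambda>\<close> and then evaluating at \<open>l\<close>
  is the same as evaluating at \<open>-l-x-y\<close>.
\<close>
lemma vpoly_subst_neg_lam_del:
  assumes P: "P \<in> tens_poly vR" and \<phi>: "bilinear_map s s (*) \<phi>"
  shows "subst_neg_lam_del (tens_del vR kdA_del) P \<in> tens_poly vR"
    and "vpoly tens_scale l (subst_neg_lam_del (tens_del vR kdA_del) P)
        (\<lambda>p q. \<phi> (vpoly s x p) (vpoly s y q)) =
      vpoly tens_scale (- l - x - y) P (\<lambda>p q. \<phi> (vpoly s x p) (vpoly s y q))"
proof -
  let ?X = "\<lambda>Q. - pCons 0 Q - map_poly (tens_del vR kdA_del) Q"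
  let ?f = "\<lambda>p q. \<phi> (vpoly s x p) (vpoly s y q)"
  have X: "?X Q \<in> tens_poly vR" if "Q \<in> tens_poly vR" for Q
    using that by (auto simp: tens_poly_def coeff_map_poly tens_del_zero coeff_pCons
        intro!: diff_in_tens_space uminus_in_tens_space vector_space_vR tens_del_in zero_in_tens_space
        split: nat.splits simp del: minus_apply uminus_apply)
  have const: "[:coeff P i:] \<in> tens_poly vR" for i
    using P by (auto simp: tens_poly_def coeff_pCons zero_in_tens_space split: nat.splits)
  show "subst_neg_lam_del (tens_del vR kdA_del) P \<in> tens_poly vR"
    unfolding subst_neg_lam_del_def
    by (rule subst_var_in[where X = ?X and \<iota> = "\<lambda>r. [:r:]", OF _ _ X const])
      (auto simp: tens_poly_def zero_in_tens_space add_in_tens_space simp del: plus_fun_apply)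
  note E = linear_rules[OF linear_eval_form]
  have eX: "vpoly tens_scale l (?X Q) ?f = (- l - x - y) * vpoly tens_scale l Q ?f"
    if Q: "Q \<in> tens_poly vR" for Q
  proof -
    have "vpoly tens_scale l (map_poly (tens_del vR kdA_del) Q) ?f =
        (\<Sum>i\<le>degree Q. l ^ i * tens_del vR kdA_del (coeff Q i) ?f)"
      by (simp add: vector_space.vpoly_altdef[OF vector_space_tens map_poly_degree_leq] coeff_map_poly
          tens_del_zero linear_rules(8)[OF linear_apply_form] linear_rules(2)[OF linear_apply_form])
    also have "\<dots> = (x + y) * vpoly tens_scale l Q ?f"
      using Q by (simp add: vpoly_def[of tens_scale] tens_del_apply[OF _ \<phi>] tens_poly_def
          linear_rules(8)[OF linear_apply_form] linear_rules(2)[OF linear_apply_form]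
          sum_distrib_left algebra_simps)
    finally show ?thesis
      by (simp add: E vector_space.vpoly_pCons[OF vector_space_tens] tens_scale_def algebra_simps
          del: minus_pCons)
  qed
  show "vpoly tens_scale l (subst_neg_lam_del (tens_del vR kdA_del) P) ?f =
      vpoly tens_scale (- l - x - y) P ?f"
    unfolding subst_neg_lam_del_def
    by (rule vector_space.vpoly_subst_var[where \<Phi> = "\<lambda>Q. vpoly tens_scale l Q ?f" and X = ?X
          and F = "\<lambda>t. t ?f" and \<iota> = "\<lambda>r. [:r:]" and W = "tens_poly vR",
          OF vector_space_tens linear_apply_form E(1) E(3) conjI[OF X eX]])
      (simp_all add: const vector_space.vpoly_pCons[OF vector_space_tens]
        vector_space.vpoly_0[OF vector_space_tens] tens_scale_def)
qed

lemma bilinear_lam_act: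
  "bilinear_map vR vR (kdA_scale tens_scale) (\<lambda>p q. map_poly (\<lambda>r. tens vR r q) (gd_lbr circ br a p) +
     map_poly (\<lambda>r. tens vR p r) (gd_lbr circ br a q))"
  by (rule bilinearI) (simp_all add: vector_space_vR vector_space_kdA vector_space_tens poly_eq_iff
      coeff_map_poly kdA_scale_def[of tens_scale] kdA_scale_def[of vR]
      bilinear_rules[OF tens_bilinear[OF vector_space_vR]] linear_rules(1,2)[OF linear_gd_lbr(1)]
      vector_space.vector_space_assms[OF vector_space_tens]
      linear_rules[OF linear_scale_by[OF vector_space_tens]] linear_rules[OF linear_scale_by[OF vector_space_vR]])

lemma lam_act_in: "lam_act vR (gd_lbr circ br) a t \<in> tens_poly vR"
proof -
  have *: "map_poly (\<lambda>r. tens vR r q) (gd_lbr circ br a p) +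
     map_poly (\<lambda>r. tens vR p r) (gd_lbr circ br a q) \<in> tens_poly vR" for p q
    by (auto simp: tens_poly_def coeff_map_poly bilinear_rules[OF tens_bilinear[OF vector_space_vR]]
        intro!: add_in_tens_space tens_in_tens_space simp del: plus_fun_apply)
  have "sum_list (map f xs) \<in> tens_poly vR" if "\<And>x. f x \<in> tens_poly vR"
    for f :: "_ \<Rightarrow> ('a poly, 'k) tensor2 poly" and xs :: "('a poly \<times> 'a poly) list"
    using that by (induction xs)
      (auto simp: tens_poly_def zero_in_tens_space intro!: add_in_tens_space simp del: plus_fun_apply)
  then show ?thesis
    unfolding lam_act_def tens_lift_def using * by (auto simp: split_def)
qed

text \<open>
  The action \<open>a\<^sub>\<lambda>\<delta>(b)\<close> with \<open>u = -\<lambda>\<close>: the argument \<open>a\<close> carries the value \<open>u\<close> of \<open>\<partial>\<close>, so the tensor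
  factor it is bracketed with carries \<open>u\<close> less than the resulting factor.
\<close>
definition act_form :: "'k \<Rightarrow> 'k \<Rightarrow> 'k \<Rightarrow> 'a \<Rightarrow> 'a \<Rightarrow> ('a \<Rightarrow> 'a \<Rightarrow> 'k) \<Rightarrow> 'k" where
  "act_form u x y a b \<phi> =
     cobr_form (x - u) y b (\<lambda>c d. \<phi> (gd_pair u (x - u) a c) d)
   + cobr_form x (y - u) b (\<lambda>c d. \<phi> c (gd_pair u (y - u) a d))"

lemma linear_gd_pair: "Vector_Spaces.linear s s (gd_pair u v a)"
  using bilinear_gd_pair by (simp add: bilinear_map_def)

lemma vpoly_lam_act:
  assumes \<phi>: "bilinear_map s s (*) \<phi>"
  shows "vpoly tens_scale l (lam_act vR (gd_lbr circ br) a (\<delta> b)) (\<lambda>p q. \<phi> (vpoly s x p) (vpoly s y q)) =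
    act_form (- l) x y (vpoly s (- l) a) (vpoly s (x + y + l) b) \<phi>"
proof -
  let ?f = "\<lambda>p q. \<phi> (vpoly s x p) (vpoly s y q)"
  let ?a = "vpoly s (- l) a"
  have b1: "bilinear_map s s (*) (\<lambda>c d. \<phi> (gd_pair (- l) (x + l) ?a c) d)"
    by (rule bilinear_comp[OF \<phi> linear_gd_pair linear_identity[OF vector_space_s]])
  have b2: "bilinear_map s s (*) (\<lambda>c d. \<phi> c (gd_pair (- l) (y + l) ?a d))"
    by (rule bilinear_comp[OF \<phi> linear_identity[OF vector_space_s] linear_gd_pair])
  have l1: "Vector_Spaces.linear vR tens_scale (\<lambda>r. tens vR r q)"
    and l2: "Vector_Spaces.linear vR tens_scale (tens vR p)" for p q
    using tens_bilinear[OF vector_space_vR] by (auto simp: bilinear_map_def)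
  have "vpoly tens_scale l (lam_act vR (gd_lbr circ br) a (\<delta> b)) ?f =
      \<delta> b (\<lambda>p q. vpoly tens_scale l (map_poly (\<lambda>r. tens vR r q) (gd_lbr circ br a p) +
        map_poly (\<lambda>r. tens vR p r) (gd_lbr circ br a q)) ?f)"
    unfolding lam_act_def
    by (rule apply_tens_lift[where l = "\<lambda>P. vpoly tens_scale l P ?f",
          OF \<delta>(2) bilinear_lam_act linear_eval_form])
  also have "\<dots> = \<delta> b (\<lambda>p q. \<phi> (gd_pair (- l) (x + l) ?a (vpoly s (x + l) p)) (vpoly s y q)
      + \<phi> (vpoly s x p) (gd_pair (- l) (y + l) ?a (vpoly s (y + l) q)))"
    by (simp add: linear_rules(1)[OF linear_eval_form] tens_apply[OF bilinear_vpoly[OF \<phi>]] vpoly_gd_lbr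
        vector_space.vpoly_map_poly[OF vector_space_vR l1] vector_space.vpoly_map_poly[OF vector_space_vR l2])
  also have "\<dots> = act_form (- l) x y ?a (vpoly s (x + y + l) b) \<phi>"
    by (simp only: tens_apply_add[OF \<delta>(2) bilinear_vpoly[OF b1, where x = "x + l" and y = y]
          bilinear_vpoly[OF b2, where x = x and y = "y + l"]]
        \<delta>_vpoly[OF b1, where x = "x + l" and y = y] \<delta>_vpoly[OF b2, where x = x and y = "y + l"]
        act_form_def diff_minus_eq_add) (simp only: add_ac)
  finally show ?thesis .
qed

text \<open>
  The cocycle condition for arguments on which \<open>\<partial>\<close> acts as \<open>u\<close> and \<open>v\<close>, with \<open>x\<close> and \<open>y\<close> its values
  on the tensor factors. Only \<open>x + y = u + v\<close> is meaningful; substituting \<open>-\<lambda>-\<partial>\<close> for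
  \<open>\<lambda> = -u\<close> then amounts to exchanging \<open>u\<close> and \<open>v\<close>.
\<close>
definition conf_cocycle_defect where
  "conf_cocycle_defect x y u v a b \<phi> =
     cobr_form x y (gd_pair u v a b) \<phi> - act_form u x y a b \<phi> + act_form v x y b a \<phi>"

lemma conf_cocycle_iff:
  "(\<forall>p q. lam_act vR (gd_lbr circ br) p (\<delta> q)
       - subst_neg_lam_del (tens_del vR kdA_del) (lam_act vR (gd_lbr circ br) q (\<delta> p)) =
     map_poly \<delta> (gd_lbr circ br p q)) \<longleftrightarrow>
   (\<forall>x y u v a b \<phi>. bilinear_map s s (*) \<phi> \<longrightarrow> x + y = u + v \<longrightarrow> conf_cocycle_defect x y u v a b \<phi> = 0)"
  (is "(\<forall>p q. ?L p q = ?R p q) \<longleftrightarrow> ?C")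
proof -
  note E = linear_rules[OF linear_eval_form]
  have bil0: "bilinear_map s s (*) (\<lambda>_ _. 0)"
    by (rule bilinearI) (simp_all add: vector_space_s vector_space_field)
  have L_in: "?L p q \<in> tens_poly vR" for p q
    by (intro diff_in_tens_poly vector_space_vR lam_act_in vpoly_subst_neg_lam_del(1)[OF _ bil0])
  have R_in: "?R p q \<in> tens_poly vR" for p q
    by (simp add: tens_poly_def coeff_map_poly linear_rules(3)[OF \<delta>(1)] \<delta>(2))
  have ev: "vpoly tens_scale l (?R p q) (\<lambda>p q. \<phi> (vpoly s x p) (vpoly s y q))
      - vpoly tens_scale l (?L p q) (\<lambda>p q. \<phi> (vpoly s x p) (vpoly s y q)) =
      conf_cocycle_defect x y (- l) (x + y + l) (vpoly s (- l) p) (vpoly s (x + y + l) q) \<phi>"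
    if \<phi>: "bilinear_map s s (*) \<phi>" for \<phi> x y l p q
  proof -
    have "vpoly tens_scale l (?R p q) = \<delta> (vpoly vR l (gd_lbr circ br p q))"
      by (rule vector_space.vpoly_map_poly[OF vector_space_vR \<delta>(1)])
    moreover have "- (- l - x - y) = x + y + l" "x + y + (- l - x - y) = - l" by simp_all
    ultimately show ?thesis
      by (simp only: E vpoly_subst_neg_lam_del(2)[OF lam_act_in \<phi>] vpoly_lam_act[OF \<phi>]
          \<delta>_vpoly[OF \<phi>] vpoly_gd_lbr conf_cocycle_defect_def) (simp add: algebra_simps)
  qed
  show ?thesis
  proof
    assume *: "\<forall>p q. ?L p q = ?R p q"
    show ?C
    proof (intro allI impI)
      fix x y u v :: 'k and a b \<phi> assume \<phi>: "bilinear_map s s (*) \<phi>" and "x + y = u + v"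
      then have v: "x + y + - u = v" by simp
      have "conf_cocycle_defect x y (- (- u)) (x + y + - u) (vpoly s (- (- u)) (kdA_const a))
          (vpoly s (x + y + - u) (kdA_const b)) \<phi> = 0"
        unfolding ev[OF \<phi>, symmetric] *[rule_format] by simp
      then show "conf_cocycle_defect x y u v a b \<phi> = 0"
        by (simp only: v vpoly_const minus_minus)
    qed
  next
    assume C: ?C
    show "\<forall>p q. ?L p q = ?R p q"
    proof (intro allI)
      fix p q
      show "?L p q = ?R p q"
      proof (rule vpoly_separation[OF vector_space_tens], rule tens_eq_vpolyI[OF vector_space_s])
        fix l \<phi> x y
        show "vpoly tens_scale l (?L p q) \<in> tens_space vR" "vpoly tens_scale l (?R p q) \<in> tens_space vR"
          by (intro vpoly_in_tens_space vector_space_vR L_in R_in)+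
        assume \<phi>: "bilinear_map s s (*) \<phi>"
        have "conf_cocycle_defect x y (- l) (x + y + l) (vpoly s (- l) p) (vpoly s (x + y + l) q) \<phi> = 0"
          by (rule C[rule_format, OF \<phi>]) simp
        then show "vpoly tens_scale l (?L p q) (\<lambda>p q. \<phi> (vpoly s x p) (vpoly s y q)) =
          vpoly tens_scale l (?R p q) (\<lambda>p q. \<phi> (vpoly s x p) (vpoly s y q))"
          unfolding ev[OF \<phi>, symmetric] by (simp only: right_minus_eq)
      qed
    qed
  qed
qed

text \<open>
  Left side minus right side of the compatibility conditions in a Gel'fand-Dorfman bialgebra,
  paired with a bilinear form.
\<close>
definition lie_bialg_defect where
  "lie_bialg_defect a b \<phi> = tens_lift s \<phi> (d0 (br a b))
   - tens_lift s (\<lambda>c d. \<phi> (br a c) d + \<phi> c (br a d)) (d0 b)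
   + tens_lift s (\<lambda>c d. \<phi> (br b c) d + \<phi> c (br b d)) (d0 a)"

definition gd_bialg_defect where
  "gd_bialg_defect a b \<phi> = tens_lift s \<phi> (d0 (b \<odot> a)) + tens_lift s \<phi> (dl (br a b))
   - tens_lift s (\<lambda>c d. \<phi> (c \<odot> a) d) (d0 b) - tens_lift s (\<lambda>c d. \<phi> (b \<odot> c) d) (d0 a)
   - tens_lift s (\<lambda>c d. \<phi> c (b \<odot> d + d \<odot> b)) (d0 a)
   - tens_lift s (\<lambda>c d. \<phi> (br a c) d + \<phi> c (br a d)) (dl b)
   + tens_lift s (\<lambda>c d. \<phi> c (br b d)) (dl a) + tens_lift s (\<lambda>c d. \<phi> d (br b c)) (dl a)"

definition nov_bialg1_defect where
  "nov_bialg1_defect a b \<phi> = tens_lift s \<phi> (dl (a \<odot> b))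
   - tens_lift s (\<lambda>c d. \<phi> (c \<odot> b) d) (dl a)
   - tens_lift s (\<lambda>c d. \<phi> c (a \<odot> d + d \<odot> a)) (dl b)
   - tens_lift s (\<lambda>c d. \<phi> d (a \<odot> c + c \<odot> a)) (dl b)"

definition nov_bialg2_defect where
  "nov_bialg2_defect a b \<phi> =
     tens_lift s (\<lambda>c d. \<phi> (a \<odot> c + c \<odot> a) d) (dl b) - tens_lift s (\<lambda>c d. \<phi> d (a \<odot> c + c \<odot> a)) (dl b)
   - tens_lift s (\<lambda>c d. \<phi> (b \<odot> c + c \<odot> b) d) (dl a) + tens_lift s (\<lambda>c d. \<phi> d (b \<odot> c + c \<odot> b)) (dl a)"

definition nov_bialg3_defect where
  "nov_bialg3_defect a b \<phi> =
     tens_lift s (\<lambda>c d. \<phi> c (d \<odot> a)) (dl b) + tens_lift s (\<lambda>c d. \<phi> d (c \<odot> a)) (dl b)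
   - tens_lift s (\<lambda>c d. \<phi> (c \<odot> a) d) (dl b) - tens_lift s (\<lambda>c d. \<phi> (d \<odot> a) c) (dl b)
   - tens_lift s (\<lambda>c d. \<phi> c (d \<odot> b)) (dl a) - tens_lift s (\<lambda>c d. \<phi> d (c \<odot> b)) (dl a)
   + tens_lift s (\<lambda>c d. \<phi> (c \<odot> b) d) (dl a) + tens_lift s (\<lambda>c d. \<phi> (d \<odot> b) c) (dl a)"

lemma linear_ops:
  "Vector_Spaces.linear s s (\<lambda>x. x \<odot> a)" "Vector_Spaces.linear s s (\<lambda>x. a \<odot> x)"
  "Vector_Spaces.linear s s (br a)" "Vector_Spaces.linear s s (\<lambda>x. a \<odot> x + x \<odot> a)"
  "Vector_Spaces.linear s s id"
proof -
  show "Vector_Spaces.linear s s (\<lambda>x. x \<odot> a)" "Vector_Spaces.linear s s (\<lambda>x. a \<odot> x)"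
    "Vector_Spaces.linear s s (br a)"
    using circ_bilinear br_bilinear by (auto simp: bilinear_map_def)
  show "Vector_Spaces.linear s s (\<lambda>x. a \<odot> x + x \<odot> a)"
    by (rule vector_space_linearI) (simp_all add: vector_space_s circ_rules scale_right_distrib)
  show "Vector_Spaces.linear s s id"
    using linear_identity[OF vector_space_s] by (simp add: id_def)
qed

text \<open>
  The left side is a quadratic polynomial \<open>C(x, y, u, v; a, b; \<phi>)\<close> on the hyperplane
  \<open>x + y = u + v\<close>. It changes sign when \<open>u, v\<close> and \<open>a, b\<close> are exchanged, and also when \<open>x, y\<close> and the
  arguments of \<open>\<phi>\<close> are exchanged.

  \<^item> The constant term is the Lie bialgebra condition.

  \<^item> The linear part at \<open>(x, y, u, v) = (1, 0, 0, 1)\<close> is the compatibility condition between \<open>\<delta>\<^sub>0\<close>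
    and \<open>\<Delta>\<close>, and the symmetries give its values at \<open>(1, 0, 1, 0)\<close> and \<open>(0, 1, 1, 0)\<close>. These
    three vectors span the hyperplane, and \<open>v, x - v, y\<close> are the coordinates with respect to them.

  \<^item> The quadratic part at \<open>(1, 0, 0, 1)\<close> is the first Novikov bialgebra identity, and the
    symmetries give it at \<open>(1, 0, 1, 0)\<close>, \<open>(0, 1, 0, 1)\<close>, \<open>(0, 1, 1, 0)\<close>. The forms vanishing at
    these four points are the combinations of \<open>xy\<close> and \<open>uv\<close>, whose coefficients are found at
    \<open>(1, -1, 0, 0)\<close> and \<open>(0, 0, 1, -1)\<close>: up to sign they are the third
    and the second identity.
\<close>
lemma conf_cocycle_expand:
  assumes \<phi>: "bilinear_map s s (*) \<phi>" and skew: "d0_skew" and xy: "x + y = u + v"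
  shows "conf_cocycle_defect x y u v a b \<phi> = lie_bialg_defect a b \<phi>
    + v * gd_bialg_defect a b \<phi> - (x - v) * gd_bialg_defect b a \<phi>
    + y * gd_bialg_defect b a (\<lambda>c d. \<phi> d c)
    + x * v * nov_bialg1_defect b a \<phi> - x * u * nov_bialg1_defect a b \<phi>
    - y * v * nov_bialg1_defect b a (\<lambda>c d. \<phi> d c) + y * u * nov_bialg1_defect a b (\<lambda>c d. \<phi> d c)
    - x * y * nov_bialg3_defect a b \<phi> + u * v * nov_bialg2_defect a b \<phi>"
proof -
  have u: "u = x + y - v" using xy by (simp add: algebra_simps)
  have sk: "tens_lift s (\<lambda>p q. \<psi> q p) (d0 c) = - tens_lift s \<psi> (d0 c)"
    if "bilinear_map s s (*) \<psi>" for \<psi> c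
    using skew that by (auto simp: d0_skew_def)
  note id = linear_identity[OF vector_space_s]
  have flips: "tens_lift s (\<lambda>c d. \<phi> d c) (d0 e) = - tens_lift s \<phi> (d0 e)"
    "tens_lift s (\<lambda>c d. \<phi> d (c \<odot> e)) (d0 f) = - tens_lift s (\<lambda>c d. \<phi> c (d \<odot> e)) (d0 f)"
    "tens_lift s (\<lambda>c d. \<phi> d (e \<odot> c)) (d0 f) = - tens_lift s (\<lambda>c d. \<phi> c (e \<odot> d)) (d0 f)"
    "tens_lift s (\<lambda>c d. \<phi> (d \<odot> e) c) (d0 f) = - tens_lift s (\<lambda>c d. \<phi> (c \<odot> e) d) (d0 f)"
    "tens_lift s (\<lambda>c d. \<phi> (e \<odot> d) c) (d0 f) = - tens_lift s (\<lambda>c d. \<phi> (e \<odot> c) d) (d0 f)" for e f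
    using sk[OF \<phi>] sk[OF bilinear_comp[OF \<phi> id linear_ops(1)]] sk[OF bilinear_comp[OF \<phi> id linear_ops(2)]]
      sk[OF bilinear_comp[OF \<phi> linear_ops(1) id]] sk[OF bilinear_comp[OF \<phi> linear_ops(2) id]]
    by blast+
  have brba: "br b a = - br a b" by (rule br_skew)
  \<comment> \<open>The same rules for a form with only one argument supplied, as \<open>\<phi>\<close> appears under abstractions that are eta-contracted.\<close>
  have fn: "\<phi> (c + c') = (\<lambda>d. \<phi> c d + \<phi> c' d)" "\<phi> (c - c') = (\<lambda>d. \<phi> c d - \<phi> c' d)"
    "\<phi> (s k c) = (\<lambda>d. k * \<phi> c d)" "\<phi> (- c) = (\<lambda>d. - \<phi> c d)" for c c' k
    by (simp_all add: fun_eq_iff bilinear_rules[OF \<phi>])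
  note lin = linear_rules(1-5)[OF linear_tens_lift_cop[OF d0 \<phi>]]
    linear_rules(1-5)[OF linear_tens_lift_cop[OF dl \<phi>]]
    linear_rules(1-5)[OF linear_tens_lift_cop[OF dl bilinear_swap[OF \<phi>]]]
  show ?thesis
    unfolding conf_cocycle_defect_def act_form_def cobr_form_def gd_pair_def lie_bialg_defect_def
      gd_bialg_defect_def nov_bialg1_defect_def nov_bialg2_defect_def nov_bialg3_defect_def u brba
    by (simp add: bilinear_rules[OF \<phi>] fn lin tens_lift_distribs flips)
      (simp add: algebra_simps)
qed

end

section \<open>Comparison of the two notions of bialgebra\<close>

lemma tens_all2_eq_iff:
  assumes "\<And>a b. t a b \<in> tens_space s" "\<And>a b. u a b \<in> tens_space s"
    and "\<And>a b \<phi>. bilinear_map s s (*) \<phi> \<Longrightarrow> t a b \<phi> - u a b \<phi> = d a b \<phi>"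
  shows "(\<forall>a b. t a b = u a b) \<longleftrightarrow> (\<forall>a b \<phi>. bilinear_map s s (*) \<phi> \<longrightarrow> d a b \<phi> = 0)"
  unfolding tens_eq_iff[OF assms(1,2)] by (simp add: assms(3)[symmetric])

context gd_cobracket begin

lemma tens_map_eq_lift:
  assumes \<phi>: "bilinear_map s s (*) \<phi>" and t: "t \<in> tens_space s"
    and f: "Vector_Spaces.linear s s f" and g: "Vector_Spaces.linear s s g"
  shows "tens_map s s f g t \<phi> = tens_lift s (\<lambda>x y. \<phi> (f x) (g y)) t"
  unfolding tens_map_apply[OF t f g \<phi>] by (rule apply_eq_tens_lift[OF t bilinear_comp[OF \<phi> f g]])

lemma tens_map_sym_eq_lift:
  assumes \<phi>: "bilinear_map s s (*) \<phi>" and t: "t \<in> tens_space s"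
    and f: "Vector_Spaces.linear s s f" and g: "Vector_Spaces.linear s s g"
  shows "tens_map s s f g (t + tens_flip s t) \<phi> =
    tens_lift s (\<lambda>x y. \<phi> (f x) (g y)) t + tens_lift s (\<lambda>x y. \<phi> (f y) (g x)) t"
  unfolding tens_map_eq_lift[OF \<phi> add_in_tens_space[OF t tens_flip_in_tens_space] f g]
    tens_lift_add_tensor[OF bilinear_comp[OF \<phi> f g] t tens_flip_in_tens_space]
    tens_lift_flip[OF vector_space_s t bilinear_comp[OF \<phi> f g]] ..

lemma tens_map_flip_eq_lift:
  assumes \<phi>: "bilinear_map s s (*) \<phi>" and t: "t \<in> tens_space s"
    and f: "Vector_Spaces.linear s s f" and g: "Vector_Spaces.linear s s g"
  shows "tens_map s s f g (tens_flip s t) \<phi> = tens_lift s (\<lambda>x y. \<phi> (f y) (g x)) t"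
  unfolding tens_map_eq_lift[OF \<phi> tens_flip_in_tens_space f g]
    tens_lift_flip[OF vector_space_s t bilinear_comp[OF \<phi> f g]] ..

lemma tens_ad_in: "tens_ad s br a t \<in> tens_space s"
  unfolding tens_ad_def by (intro tens_lift_in_tens_space add_in_tens_space tens_in_tens_space)

lemma tens_ad_eq_lift:
  assumes \<phi>: "bilinear_map s s (*) \<phi>" and t: "t \<in> tens_space s"
  shows "tens_ad s br a t \<phi> = tens_lift s (\<lambda>b c. \<phi> (br a b) c + \<phi> b (br a c)) t"
proof -
  note T = bilinear_rules(1-4)[OF tens_bilinear[OF vector_space_s]]
  have b: "bilinear_map s s tens_scale (\<lambda>b c. tens s (br a b) c + tens s b (br a c))"
    by (rule bilinearI) (simp_all add: vector_space_s vector_space_tens T br_rules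
        linear_rules(1)[OF linear_scale_by[OF vector_space_tens]])
  have "bilinear_map s s (*) (\<lambda>b c. \<phi> (br a b) c + \<phi> b (br a c))"
    by (rule bilinearI) (simp_all add: vector_space_s vector_space_field bilinear_rules[OF \<phi>] br_rules algebra_simps)
  then show ?thesis
    unfolding tens_ad_def tens_lift_apply[OF t b]
    by (simp add: tens_apply[OF \<phi>] apply_eq_tens_lift[OF t])
qed

lemma form_eval:
  assumes \<phi>: "bilinear_map s s (*) \<phi>"
  shows "d0 a \<phi> = tens_lift s \<phi> (d0 a)" "dl a \<phi> = tens_lift s \<phi> (dl a)"
    "tens_ad s br a (d0 b) \<phi> = tens_lift s (\<lambda>b c. \<phi> (br a b) c + \<phi> b (br a c)) (d0 b)"
    "tens_ad s br a (dl b) \<phi> = tens_lift s (\<lambda>b c. \<phi> (br a b) c + \<phi> b (br a c)) (dl b)"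
    "tens_map s s (\<lambda>x. x \<odot> a) id (d0 b) \<phi> = tens_lift s (\<lambda>x y. \<phi> (x \<odot> a) y) (d0 b)"
    "tens_map s s (\<lambda>x. a \<odot> x) id (d0 b) \<phi> = tens_lift s (\<lambda>x y. \<phi> (a \<odot> x) y) (d0 b)"
    "tens_map s s id (\<lambda>x. a \<odot> x + x \<odot> a) (d0 b) \<phi> =
       tens_lift s (\<lambda>x y. \<phi> x (a \<odot> y + y \<odot> a)) (d0 b)"
    "tens_map s s (\<lambda>x. x \<odot> a) id (dl b) \<phi> = tens_lift s (\<lambda>x y. \<phi> (x \<odot> a) y) (dl b)"
    "tens_map s s (\<lambda>x. a \<odot> x + x \<odot> a) id (dl b) \<phi> =
       tens_lift s (\<lambda>x y. \<phi> (a \<odot> x + x \<odot> a) y) (dl b)"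
    "tens_map s s id (\<lambda>x. a \<odot> x + x \<odot> a) (tens_flip s (dl b)) \<phi> =
       tens_lift s (\<lambda>x y. \<phi> y (a \<odot> x + x \<odot> a)) (dl b)"
    "tens_map s s id (br a) (dl b + tens_flip s (dl b)) \<phi> =
       tens_lift s (\<lambda>x y. \<phi> x (br a y)) (dl b) + tens_lift s (\<lambda>x y. \<phi> y (br a x)) (dl b)"
    "tens_map s s id (\<lambda>x. a \<odot> x + x \<odot> a) (dl b + tens_flip s (dl b)) \<phi> =
       tens_lift s (\<lambda>x y. \<phi> x (a \<odot> y + y \<odot> a)) (dl b)
       + tens_lift s (\<lambda>x y. \<phi> y (a \<odot> x + x \<odot> a)) (dl b)"
    "tens_map s s id (\<lambda>x. x \<odot> a) (dl b + tens_flip s (dl b)) \<phi> =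
       tens_lift s (\<lambda>x y. \<phi> x (y \<odot> a)) (dl b) + tens_lift s (\<lambda>x y. \<phi> y (x \<odot> a)) (dl b)"
    "tens_map s s (\<lambda>x. x \<odot> a) id (dl b + tens_flip s (dl b)) \<phi> =
       tens_lift s (\<lambda>x y. \<phi> (x \<odot> a) y) (dl b) + tens_lift s (\<lambda>x y. \<phi> (y \<odot> a) x) (dl b)"
  by (simp_all only: apply_eq_tens_lift[OF d0(2) \<phi>] apply_eq_tens_lift[OF dl(2) \<phi>]
      tens_ad_eq_lift[OF \<phi> d0(2)] tens_ad_eq_lift[OF \<phi> dl(2)]
      tens_map_eq_lift[OF \<phi> d0(2)] tens_map_eq_lift[OF \<phi> dl(2)]
      tens_map_sym_eq_lift[OF \<phi> dl(2)] tens_map_flip_eq_lift[OF \<phi> dl(2)] linear_ops id_apply)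

lemmas tens_memI = add_in_tens_space diff_in_tens_space[OF vector_space_s] d0(2) dl(2)
  tens_map_in_tens_space tens_ad_in

lemma lie_bialg_iff:
  "(\<forall>a b. d0 (br a b) =
       tens_ad s br a (d0 b) - tens_ad s br b (d0 a))
   \<longleftrightarrow> (\<forall>a b \<phi>. bilinear_map s s (*) \<phi> \<longrightarrow> lie_bialg_defect a b \<phi> = 0)"
proof (rule tens_all2_eq_iff)
  fix a b
  show "d0 (br a b) \<in> tens_space s"
    "tens_ad s br a (d0 b) - tens_ad s br b (d0 a) \<in> tens_space s"
    by (intro tens_memI)+
  fix \<phi> assume \<phi>: "bilinear_map s s (*) \<phi>"
  show "(d0 (br a b)) \<phi>
     - (tens_ad s br a (d0 b) - tens_ad s br b (d0 a)) \<phi> = lie_bialg_defect a b \<phi>"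
    by (simp add: form_eval[OF \<phi>] lie_bialg_defect_def)
qed

lemma gd_bialg_iff:
  "(\<forall>a b. d0 (b \<odot> a) + dl (br a b) =
       tens_map s s (\<lambda>x. x \<odot> a) id (d0 b) + tens_map s s (\<lambda>x. b \<odot> x) id (d0 a)
       + tens_map s s id (\<lambda>x. b \<odot> x + x \<odot> b) (d0 a) + tens_ad s br a (dl b)
       - tens_map s s id (br b) (dl a + tens_flip s (dl a)))
   \<longleftrightarrow> (\<forall>a b \<phi>. bilinear_map s s (*) \<phi> \<longrightarrow> gd_bialg_defect a b \<phi> = 0)"
proof (rule tens_all2_eq_iff)
  fix a b
  show "d0 (b \<odot> a) + dl (br a b) \<in> tens_space s"
    "tens_map s s (\<lambda>x. x \<odot> a) id (d0 b) + tens_map s s (\<lambda>x. b \<odot> x) id (d0 a)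
       + tens_map s s id (\<lambda>x. b \<odot> x + x \<odot> b) (d0 a) + tens_ad s br a (dl b)
       - tens_map s s id (br b) (dl a + tens_flip s (dl a)) \<in> tens_space s"
    by (intro tens_memI)+
  fix \<phi> assume \<phi>: "bilinear_map s s (*) \<phi>"
  show "(d0 (b \<odot> a) + dl (br a b)) \<phi>
     - (tens_map s s (\<lambda>x. x \<odot> a) id (d0 b) + tens_map s s (\<lambda>x. b \<odot> x) id (d0 a)
       + tens_map s s id (\<lambda>x. b \<odot> x + x \<odot> b) (d0 a) + tens_ad s br a (dl b)
       - tens_map s s id (br b) (dl a + tens_flip s (dl a))) \<phi> = gd_bialg_defect a b \<phi>"
    by (simp add: form_eval[OF \<phi>] gd_bialg_defect_def)
qed

lemma nov_bialg1_iff: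
  "(\<forall>a b. dl (a \<odot> b) =
       tens_map s s (\<lambda>x. x \<odot> b) id (dl a) + tens_map s s id (\<lambda>x. a \<odot> x + x \<odot> a) (dl b + tens_flip s (dl b)))
   \<longleftrightarrow> (\<forall>a b \<phi>. bilinear_map s s (*) \<phi> \<longrightarrow> nov_bialg1_defect a b \<phi> = 0)"
proof (rule tens_all2_eq_iff)
  fix a b
  show "dl (a \<odot> b) \<in> tens_space s"
    "tens_map s s (\<lambda>x. x \<odot> b) id (dl a) + tens_map s s id (\<lambda>x. a \<odot> x + x \<odot> a) (dl b + tens_flip s (dl b)) \<in> tens_space s"
    by (intro tens_memI)+
  fix \<phi> assume \<phi>: "bilinear_map s s (*) \<phi>"
  show "(dl (a \<odot> b)) \<phi>
     - (tens_map s s (\<lambda>x. x \<odot> b) id (dl a) + tens_map s s id (\<lambda>x. a \<odot> x + x \<odot> a) (dl b + tens_flip s (dl b))) \<phi> = nov_bialg1_defect a b \<phi>"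
    by (simp add: form_eval[OF \<phi>] nov_bialg1_defect_def)
qed

lemma nov_bialg2_iff:
  "(\<forall>a b. tens_map s s (\<lambda>x. a \<odot> x + x \<odot> a) id (dl b) - tens_map s s id (\<lambda>x. a \<odot> x + x \<odot> a) (tens_flip s (dl b)) =
       tens_map s s (\<lambda>x. b \<odot> x + x \<odot> b) id (dl a) - tens_map s s id (\<lambda>x. b \<odot> x + x \<odot> b) (tens_flip s (dl a)))
   \<longleftrightarrow> (\<forall>a b \<phi>. bilinear_map s s (*) \<phi> \<longrightarrow> nov_bialg2_defect a b \<phi> = 0)"
proof (rule tens_all2_eq_iff)
  fix a b
  show "tens_map s s (\<lambda>x. a \<odot> x + x \<odot> a) id (dl b) - tens_map s s id (\<lambda>x. a \<odot> x + x \<odot> a) (tens_flip s (dl b)) \<in> tens_space s"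
    "tens_map s s (\<lambda>x. b \<odot> x + x \<odot> b) id (dl a) - tens_map s s id (\<lambda>x. b \<odot> x + x \<odot> b) (tens_flip s (dl a)) \<in> tens_space s"
    by (intro tens_memI)+
  fix \<phi> assume \<phi>: "bilinear_map s s (*) \<phi>"
  show "(tens_map s s (\<lambda>x. a \<odot> x + x \<odot> a) id (dl b) - tens_map s s id (\<lambda>x. a \<odot> x + x \<odot> a) (tens_flip s (dl b))) \<phi>
     - (tens_map s s (\<lambda>x. b \<odot> x + x \<odot> b) id (dl a) - tens_map s s id (\<lambda>x. b \<odot> x + x \<odot> b) (tens_flip s (dl a))) \<phi> = nov_bialg2_defect a b \<phi>"
    by (simp add: form_eval[OF \<phi>] nov_bialg2_defect_def)
qed

lemma nov_bialg3_iff: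
  "(\<forall>a b. tens_map s s id (\<lambda>x. x \<odot> a) (dl b + tens_flip s (dl b)) - tens_map s s (\<lambda>x. x \<odot> a) id (dl b + tens_flip s (dl b)) =
       tens_map s s id (\<lambda>x. x \<odot> b) (dl a + tens_flip s (dl a)) - tens_map s s (\<lambda>x. x \<odot> b) id (dl a + tens_flip s (dl a)))
   \<longleftrightarrow> (\<forall>a b \<phi>. bilinear_map s s (*) \<phi> \<longrightarrow> nov_bialg3_defect a b \<phi> = 0)"
proof (rule tens_all2_eq_iff)
  fix a b
  show "tens_map s s id (\<lambda>x. x \<odot> a) (dl b + tens_flip s (dl b)) - tens_map s s (\<lambda>x. x \<odot> a) id (dl b + tens_flip s (dl b)) \<in> tens_space s"
    "tens_map s s id (\<lambda>x. x \<odot> b) (dl a + tens_flip s (dl a)) - tens_map s s (\<lambda>x. x \<odot> b) id (dl a + tens_flip s (dl a)) \<in> tens_space s"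
    by (intro tens_memI)+
  fix \<phi> assume \<phi>: "bilinear_map s s (*) \<phi>"
  show "(tens_map s s id (\<lambda>x. x \<odot> a) (dl b + tens_flip s (dl b)) - tens_map s s (\<lambda>x. x \<odot> a) id (dl b + tens_flip s (dl b))) \<phi>
     - (tens_map s s id (\<lambda>x. x \<odot> b) (dl a + tens_flip s (dl a)) - tens_map s s (\<lambda>x. x \<odot> b) id (dl a + tens_flip s (dl a))) \<phi> = nov_bialg3_defect a b \<phi>"
    by (simp add: form_eval[OF \<phi>] nov_bialg3_defect_def)
qed

lemma gd_bialgebra_iff:
  "gd_bialgebra s circ br dl d0 \<longleftrightarrow> gd_coalgebra s dl d0 \<and>
     (\<forall>a b \<phi>. bilinear_map s s (*) \<phi> \<longrightarrow>
        lie_bialg_defect a b \<phi> = 0 \<and> gd_bialg_defect a b \<phi> = 0 \<and> nov_bialg1_defect a b \<phi> = 0 \<and>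
        nov_bialg2_defect a b \<phi> = 0 \<and> nov_bialg3_defect a b \<phi> = 0)"
proof -
  have "novikov_bialgebra s circ dl \<longleftrightarrow> novikov_coalgebra s dl \<and>
      (\<forall>a b \<phi>. bilinear_map s s (*) \<phi> \<longrightarrow> nov_bialg1_defect a b \<phi> = 0) \<and>
      (\<forall>a b \<phi>. bilinear_map s s (*) \<phi> \<longrightarrow> nov_bialg2_defect a b \<phi> = 0) \<and>
      (\<forall>a b \<phi>. bilinear_map s s (*) \<phi> \<longrightarrow> nov_bialg3_defect a b \<phi> = 0)"
    unfolding novikov_bialgebra_def novikov_bialgebra_axioms_def nov_bialg1_iff nov_bialg2_iff nov_bialg3_iff
    using novikov_algebra_axioms by simp
  moreover have "lie_bialgebra s br d0 \<longleftrightarrow> lie_coalgebra s d0 \<and>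
      (\<forall>a b \<phi>. bilinear_map s s (*) \<phi> \<longrightarrow> lie_bialg_defect a b \<phi> = 0)"
    unfolding lie_bialgebra_def lie_bialgebra_axioms_def lie_bialg_iff
    using lie_algebra_axioms by simp
  moreover have "gd_bialgebra s circ br dl d0 \<longleftrightarrow> gd_coalgebra s dl d0 \<and> novikov_bialgebra s circ dl \<and>
      lie_bialgebra s br d0 \<and> (\<forall>a b \<phi>. bilinear_map s s (*) \<phi> \<longrightarrow> gd_bialg_defect a b \<phi> = 0)"
    unfolding gd_bialgebra_def gd_bialgebra_axioms_def gd_bialg_iff[symmetric]
    using gd_algebra_axioms by blast
  moreover have "gd_coalgebra s dl d0 \<Longrightarrow> novikov_coalgebra s dl \<and> lie_coalgebra s d0"
    by (simp add: gd_coalgebra_def)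
  ultimately show ?thesis by blast
qed

text \<open>
  The polynomial identity is tested where the expansion was interpolated: on the line spanned by
  \<open>(1, 0, 0, 1)\<close>, and at \<open>(1, -1, 0, 0)\<close> and \<open>(0, 0, 1, -1)\<close>.
\<close>
lemma conf_cocycle_defect_iff:
  assumes skew: "d0_skew"
  shows "(\<forall>x y u v a b \<phi>. bilinear_map s s (*) \<phi> \<longrightarrow> x + y = u + v \<longrightarrow> conf_cocycle_defect x y u v a b \<phi> = 0)
    \<longleftrightarrow> (\<forall>a b \<phi>. bilinear_map s s (*) \<phi> \<longrightarrow>
        lie_bialg_defect a b \<phi> = 0 \<and> gd_bialg_defect a b \<phi> = 0 \<and> nov_bialg1_defect a b \<phi> = 0 \<and>
        nov_bialg2_defect a b \<phi> = 0 \<and> nov_bialg3_defect a b \<phi> = 0)"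
  (is "?L \<longleftrightarrow> ?R")
proof
  assume R: ?R
  show ?L
  proof (intro allI impI)
    fix x y u v :: 'k and a b \<phi>
    assume \<phi>: "bilinear_map s s (*) \<phi>" and xy: "x + y = u + v"
    show "conf_cocycle_defect x y u v a b \<phi> = 0"
      using R[rule_format, OF \<phi>] R[rule_format, OF bilinear_swap[OF \<phi>]]
      by (simp add: conf_cocycle_expand[OF \<phi> skew xy])
  qed
next
  assume L: ?L
  have 1: "lie_bialg_defect a b \<phi> = 0" "gd_bialg_defect a b \<phi> = 0" "nov_bialg1_defect b a \<phi> = 0"
    if \<phi>: "bilinear_map s s (*) \<phi>" for a b \<phi>
  proof -
    have "lie_bialg_defect a b \<phi> + t * gd_bialg_defect a b \<phi> + t^2 * nov_bialg1_defect b a \<phi> = 0" for t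
      using L[rule_format, OF \<phi>, of t 0 0 t a b] conf_cocycle_expand[OF \<phi> skew, of t 0 0 t a b]
      by (simp add: power2_eq_square)
    from quadratic_eq_0[OF this]
    show "lie_bialg_defect a b \<phi> = 0" "gd_bialg_defect a b \<phi> = 0" "nov_bialg1_defect b a \<phi> = 0" .
  qed
  have 2: "nov_bialg3_defect a b \<phi> = 0" if \<phi>: "bilinear_map s s (*) \<phi>" for a b \<phi>
    using L[rule_format, OF \<phi>, of 1 "- 1" 0 0 a b] conf_cocycle_expand[OF \<phi> skew, of 1 "- 1" 0 0 a b]
    by (simp add: 1[OF \<phi>] 1[OF bilinear_swap[OF \<phi>]])
  have 3: "nov_bialg2_defect a b \<phi> = 0" if \<phi>: "bilinear_map s s (*) \<phi>" for a b \<phi>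
    using L[rule_format, OF \<phi>, of 0 0 1 "- 1" a b] conf_cocycle_expand[OF \<phi> skew, of 0 0 1 "- 1" a b]
    by (simp add: 1[OF \<phi>])
  from 1 2 3 show ?R by blast
qed

lemma lie_conformal_bialgebra_iff:
  "lie_conformal_bialgebra vR kdA_del (gd_lbr circ br) \<delta> \<longleftrightarrow> gd_bialgebra s circ br dl d0"
proof -
  have "lie_conformal_bialgebra vR kdA_del (gd_lbr circ br) \<delta> \<longleftrightarrow> gd_coalgebra s dl d0 \<and>
      (\<forall>x y u v a b \<phi>. bilinear_map s s (*) \<phi> \<longrightarrow> x + y = u + v \<longrightarrow> conf_cocycle_defect x y u v a b \<phi> = 0)"
    unfolding lie_conformal_bialgebra_def lie_conformal_bialgebra_axioms_def conf_cocycle_iff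
      lie_conformal_coalgebra_iff
    using lie_conformal_gd by simp
  then show ?thesis
    unfolding gd_bialgebra_iff using conf_cocycle_defect_iff gd_coalgebra_iff by blast
qed

end

text \<open>
  The inclusion \<open>A \<otimes> A \<rightarrow> R \<otimes> R\<close> is linear and injective, so its partial inverse is linear as well.
\<close>
lemma restrict_to_A:
  assumes s: "vector_space s" and hom: "kd_hom_tens (kdA_scale s) kdA_del f"
    and A: "\<And>a. f (kdA_const a) \<in> tens_incl s ` tens_space s"
  shows "tens_incl s (restrict_to_A s f a) = f (kdA_const a)" (is ?incl)
    and "restrict_to_A s f a \<in> tens_space s" (is ?mem)
    and "Vector_Spaces.linear s tens_scale (restrict_to_A s f)"
proof -
  interpret vector_space s by fact
  note inj = inj_tens_incl[OF s]
  have incl: "tens_incl s (restrict_to_A s f a) = f (kdA_const a)" for a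
    unfolding restrict_to_A_def by (rule f_the_inv_into_f[OF inj A])
  have mem: "restrict_to_A s f a \<in> tens_space s" for a
    unfolding restrict_to_A_def by (rule the_inv_into_into[OF inj A subset_refl])
  show ?incl ?mem by (rule incl mem)+
  have c: "Vector_Spaces.linear s (kdA_scale s) kdA_const"
    using linear_monom[OF s, of 0] by (simp add: monom_0 kdA_const_def[abs_def])
  have b: "bilinear_map s s tens_scale (\<lambda>x y. tens (kdA_scale s) (kdA_const x) (kdA_const y))"
    by (rule bilinear_tens_comp[OF c c])
  have f: "Vector_Spaces.linear s tens_scale (\<lambda>a. f (kdA_const a))"
    by (rule linear_comp[OF c]) (use hom in \<open>simp add: kd_hom_tens_def\<close>)
  show "Vector_Spaces.linear s tens_scale (restrict_to_A s f)"
  proof (rule vector_space_linearI[OF s vector_space_tens])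
    fix a b c
    have "tens_incl s (restrict_to_A s f a + restrict_to_A s f b) = tens_incl s (restrict_to_A s f (a + b))"
      unfolding incl linear_rules(1)[OF f] unfolding incl[symmetric] unfolding tens_incl_def tens_map_def
      by (rule tens_lift_add_tensor[OF b mem mem])
    from inj_onD[OF inj this[symmetric] mem add_in_tens_space[OF mem mem]]
    show "restrict_to_A s f (a + b) = restrict_to_A s f a + restrict_to_A s f b" .
    have "tens_incl s (tens_scale c (restrict_to_A s f a)) = tens_incl s (restrict_to_A s f (s c a))"
      unfolding incl linear_rules(2)[OF f] unfolding incl[symmetric] unfolding tens_incl_def tens_map_def
      by (rule tens_lift_scale_tensor[OF b mem])
    from inj_onD[OF inj this[symmetric] mem scale_in_tens_space[OF s mem]]
    show "restrict_to_A s f (s c a) = tens_scale c (restrict_to_A s f a)" .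
  qed
qed

theorem theorem2p13:
  fixes s :: "'k::field_char_0 \<Rightarrow> 'a::ab_group_add \<Rightarrow> 'a"
    and circ br :: "'a \<Rightarrow> 'a \<Rightarrow> 'a"
    and \<delta>0 \<Delta> \<delta> :: "'a poly \<Rightarrow> ('a poly, 'k) tensor2"
  assumes gd: "gd_algebra s circ br"
    and hom0: "kd_hom_tens (kdA_scale s) kdA_del \<delta>0"
    and hom1: "kd_hom_tens (kdA_scale s) kdA_del \<Delta>"
    and A0: "\<And>a. \<delta>0 (kdA_const a) \<in> tens_incl s ` tens_space s"
    and A1: "\<And>a. \<Delta> (kdA_const a) \<in> tens_incl s ` tens_space s"
    and hom: "kd_hom_tens (kdA_scale s) kdA_del \<delta>"
    and \<delta>: "\<And>a. \<delta> (kdA_const a) = \<delta>0 (kdA_const a)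
        + tens_map (kdA_scale s) (kdA_scale s) kdA_del id (\<Delta> (kdA_const a))
        - tens_flip (kdA_scale s)
            (tens_map (kdA_scale s) (kdA_scale s) kdA_del id (\<Delta> (kdA_const a)))"
  shows "lie_conformal_bialgebra (kdA_scale s) kdA_del (gd_lbr circ br) \<delta> \<longleftrightarrow>
         gd_bialgebra s circ br (restrict_to_A s \<Delta>) (restrict_to_A s \<delta>0)"
proof -
  interpret gd_algebra s circ br by (rule gd)
  note r0 = restrict_to_A[OF vector_space_s hom0 A0] and r1 = restrict_to_A[OF vector_space_s hom1 A1]
  interpret gd_cobracket s circ br "restrict_to_A s \<Delta>" "restrict_to_A s \<delta>0" \<delta>
    by (intro gd_cobracket.intro gd_cobracket_axioms.intro gd r0(2,3) r1(2,3) hom)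
      (simp only: r0(1) r1(1) \<delta>)
  show ?thesis by (rule lie_conformal_bialgebra_iff)
qed

end
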